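(* Assume that $n_1=n_2=1$, $\theta_1,\theta_2>0$ and $\theta:=\theta_1+\theta_2\le 1$, and let $\mathcal{E}(u):=\mathcal{E}_{2}^{\theta_1,\theta_2}(u)$. There exists a constant $C\ge 0$, depending only on $\theta_1,\theta_2$, $\Omega$ and $\rho$, such that for every $u\in L^\infty(\Omega)$ with $\|u\|_\infty\le 1$ and $\mathcal{E}(u)<\infty$ there exists $\bar u\in S(\Omega)$ such that $u-\bar u\in BV(\Omega)\cap L^\infty(\Omega)$ and $$\|u-\bar u\|_\infty+|\nabla[u-\bar u]|(\Omega)\le C\left(\mathcal{E}(u)+\mathcal{E}(u)^{1/2}\right).$$
   Context: Setting: $n_1,n_2\ge 1$, $n=n_1+n_2$, $\mathbf{R}^n=X_1\oplus X_2$ with $X_1\perp X_2$ and $\dim X_l=n_l$ (here $n_1=n_2=1$, $n=2$); each $x\in\mathbf{R}^n$ is written $x=x_1+x_2$ with $x_l\in X_l$. For $l=1,2$, $\Omega_l\subset X_l$ is a non-empty bounded connected open subset of $X_l$, and $\Omega:=\Omega_1+\Omega_2$. $L(U)$ denotes the space of real-valued Lebesgue-measurable functions on $U$. The set $S(\Omega)$ consists of all $u\in L(\Omega)$ such that for $l=1$ or $l=2$ there is $u_l\in L(\Omega_l)$ with $u(x)=u_l(x_l)$ for almost every $x\in\Omega$. Kernel: $\rho\in L^1(\mathbf{R}^n,[0,\infty))$ is a fixed radial function with $\int\rho=1$ and $\operatorname{supp}\rho\subset B_1$; $\rho_\varepsilon(z):=\varepsilon^{-n}\rho(z/\varepsilon)$.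 Energies: for $\varepsilon>0$, $\Omega_l^\varepsilon:=\bigcap_{z_l\in X_l,\,|z_l|<\varepsilon}(\Omega_l-z_l)$ and $\Omega^\varepsilon:=\Omega_1^\varepsilon+\Omega_2^\varepsilon$. For $p,\theta_1,\theta_2>0$ and $u\in L(\Omega)$, $$\mathcal{E}_{\varepsilon,p}^{\theta_1,\theta_2}(u):=\int_{\mathbf{R}^n}\rho_\varepsilon(z)\int_{\Omega^\varepsilon}\frac{|u(x+z_1)-u(x)|^{\theta_1}\,|u(x+z_2)-u(x)|^{\theta_2}}{|z|^p}\,dx\,dz,\qquad \mathcal{E}_p^{\theta_1,\theta_2}(u):=\liminf_{\varepsilon\downarrow 0}\mathcal{E}_{\varepsilon,p}^{\theta_1,\theta_2}(u).$$ $|\nabla v|(\Omega)$ denotes the total variation of the measure $\nabla v$ for $v\in BV(\Omega)$. *)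

theory Defs
  imports "HOL-Analysis.Analysis" "HOL-Probability.Essential_Supremum"
begin

section \<open>Splitting the space along two subspaces\<close>

text \<open>For a direct sum of \<open>X\<close> and \<open>Y\<close>, this is the \<open>X\<close>-part of \<open>z\<close>; the \<open>Y\<close>-part is
  \<open>component Y X z\<close>.\<close>

definition component :: "'a::euclidean_space set \<Rightarrow> 'a set \<Rightarrow> 'a \<Rightarrow> 'a" where
  "component X Y z = (THE a. a \<in> X \<and> z - a \<in> Y)"

definition orthogonal_splitting :: "'a::euclidean_space set \<Rightarrow> 'a set \<Rightarrow> bool" where
  "orthogonal_splitting X1 X2 \<longleftrightarrow>
     subspace X1 \<and> subspace X2 \<and> X1 + X2 = UNIV \<and> (\<forall>x\<in>X1. \<forall>y\<in>X2. orthogonal x y)"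

text \<open>Non-empty bounded connected relatively open subsets of a subspace \<open>X\<close>.\<close>

definition bounded_domain_in :: "'a::euclidean_space set \<Rightarrow> 'a set \<Rightarrow> bool" where
  "bounded_domain_in X U \<longleftrightarrow>
     openin (top_of_set X) U \<and> U \<noteq> {} \<and> bounded U \<and> connected U"


section \<open>Function spaces\<close>

text \<open>Functions on \<open>U\<close> are represented by total functions; their values outside \<open>U\<close> are irrelevant
  everywhere below.\<close>

definition L_space :: "'a::euclidean_space set \<Rightarrow> ('a \<Rightarrow> real) set" where
  "L_space U = borel_measurable (lebesgue_on U)"

text \<open>Functions on a subset \<open>U\<close> of a line \<open>X\<close> that are measurable for the one-dimensional
  Lebesgue measure of \<open>X\<close>, i.e. the image of the Lebesgue measure of \<open>\<real>\<close> under a linear isometry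
  of \<open>\<real>\<close> onto \<open>X\<close>. Two such isometries differ by a sign only, so the choice does not matter.\<close>

definition L_space_line :: "'a::euclidean_space set \<Rightarrow> 'a set \<Rightarrow> ('a \<Rightarrow> real) set" where
  "L_space_line X U = {v. \<exists>\<phi>::real \<Rightarrow> 'a. linear \<phi> \<and> (\<forall>t. norm (\<phi> t) = \<bar>t\<bar>) \<and> range \<phi> = X \<and>
     (\<lambda>t. v (\<phi> t)) \<in> borel_measurable (lebesgue_on (\<phi> -` U))}"

text \<open>The set \<open>S(\<Omega>)\<close> for \<open>\<Omega> = \<Omega>1 + \<Omega>2\<close>, where \<open>X1\<close> and \<open>X2\<close> are lines.\<close>

definition S_space ::
  "'a::euclidean_space set \<Rightarrow> 'a set \<Rightarrow> 'a set \<Rightarrow> 'a set \<Rightarrow> ('a \<Rightarrow> real) set" where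
  "S_space X1 X2 \<Omega>1 \<Omega>2 = {u \<in> L_space (\<Omega>1 + \<Omega>2).
     (\<exists>v \<in> L_space_line X1 \<Omega>1. AE x in lebesgue_on (\<Omega>1 + \<Omega>2). u x = v (component X1 X2 x)) \<or>
     (\<exists>v \<in> L_space_line X2 \<Omega>2. AE x in lebesgue_on (\<Omega>1 + \<Omega>2). u x = v (component X2 X1 x))}"

definition Linf_norm :: "'a::euclidean_space set \<Rightarrow> ('a \<Rightarrow> real) \<Rightarrow> ennreal" where
  "Linf_norm U u = esssup (lebesgue_on U) (\<lambda>x. ennreal \<bar>u x\<bar>)"

definition Linf_space :: "'a::euclidean_space set \<Rightarrow> ('a \<Rightarrow> real) set" where
  "Linf_space U = {u \<in> L_space U. Linf_norm U u < \<infinity>}"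


section \<open>Functions of bounded variation\<close>

text \<open>Class \<open>C\<^sup>k\<close> on the whole space.\<close>

primrec C_k :: "nat \<Rightarrow> ('a::euclidean_space \<Rightarrow> real) \<Rightarrow> bool" where
  "C_k 0 f \<longleftrightarrow> continuous_on UNIV f"
| "C_k (Suc k) f \<longleftrightarrow> (\<forall>x. f differentiable at x) \<and>
     (\<forall>b\<in>Basis. C_k k (\<lambda>x. frechet_derivative f (at x) b))"

definition test_functions :: "'a::euclidean_space set \<Rightarrow> ('a \<Rightarrow> real) set" where
  "test_functions U = {f. (\<forall>k. C_k k f) \<and>
     compact (closure {x. f x \<noteq> 0}) \<and> closure {x. f x \<noteq> 0} \<subseteq> U}"

text \<open>\<open>gradient_measure U v \<nu>\<close>: the distributional gradient of \<open>v\<close> on the open set \<open>U\<close> is the finite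
  vector-valued measure \<open>\<nu>\<close> on the Borel subsets of \<open>U\<close>. Each component of \<open>\<nu>\<close> is a finite signed
  measure, given as a difference \<open>P b - N b\<close> of two finite measures (which exists by Jordan
  decomposition and need not be minimal). The values of \<open>\<nu>\<close> on the Borel subsets of \<open>U\<close> are
  determined by \<open>v\<close>.\<close>

definition gradient_measure ::
  "'a::euclidean_space set \<Rightarrow> ('a \<Rightarrow> real) \<Rightarrow> ('a set \<Rightarrow> 'a) \<Rightarrow> bool" where
  "gradient_measure U v \<nu> \<longleftrightarrow> (\<exists>P N :: 'a \<Rightarrow> 'a measure. \<forall>b\<in>Basis.
     finite_measure (P b) \<and> sets (P b) = sets (restrict_space borel U) \<and>
     finite_measure (N b) \<and> sets (N b) = sets (restrict_space borel U) \<and>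
     (\<forall>A \<in> sets (restrict_space borel U). \<nu> A \<bullet> b = measure (P b) A - measure (N b) A) \<and>
     (\<forall>f \<in> test_functions U.
        (LINT x|lebesgue_on U. v x * frechet_derivative f (at x) b)
          = - ((LINT x|P b. f x) - (LINT x|N b. f x))))"

definition total_variation :: "'a::euclidean_space set \<Rightarrow> ('a set \<Rightarrow> 'a) \<Rightarrow> ennreal" where
  "total_variation U \<nu> =
     (SUP A \<in> {A :: nat \<Rightarrow> 'a set. range A \<subseteq> sets (restrict_space borel U) \<and>
                  disjoint_family A \<and> (\<Union>k. A k) = U}.
        (\<Sum>k. ennreal (norm (\<nu> (A k)))))"

definition BV_space :: "'a::euclidean_space set \<Rightarrow> ('a \<Rightarrow> real) set" where
  "BV_space U = {v. integrable (lebesgue_on U) v \<and> (\<exists>\<nu>. gradient_measure U v \<nu>)}"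

text \<open>The number \<open>|\<nabla>v|(U)\<close>. For \<open>v\<close> in \<open>BV(U)\<close> the measure \<open>\<nu> = \<nabla>v\<close> is unique on the Borel subsets
  of \<open>U\<close>, so the infimum is over a one-element set.\<close>

definition grad_variation :: "'a::euclidean_space set \<Rightarrow> ('a \<Rightarrow> real) \<Rightarrow> ennreal" where
  "grad_variation U v = (INF \<nu> \<in> {\<nu>. gradient_measure U v \<nu>}. total_variation U \<nu>)"


section \<open>The kernel and the energies\<close>

text \<open>Support of an a.e. class: the complement of the largest open set on which \<open>f\<close> vanishes a.e.\<close>

definition ess_support :: "('a::euclidean_space \<Rightarrow> real) \<Rightarrow> 'a set" where
  "ess_support f = {z. \<forall>r>0. \<not> (AE w in lebesgue. w \<in> ball z r \<longrightarrow> f w = 0)}"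

text \<open>Elements of \<open>L\<^sup>1\<close> are classes of functions, so the pointwise conditions are required a.e.\<close>

definition radial_kernel :: "('a::euclidean_space \<Rightarrow> real) \<Rightarrow> bool" where
  "radial_kernel \<rho> \<longleftrightarrow>
     integrable lebesgue \<rho> \<and> (AE z in lebesgue. 0 \<le> \<rho> z) \<and>
     (\<exists>r :: real \<Rightarrow> real. AE z in lebesgue. \<rho> z = r (norm z)) \<and>
     integral\<^sup>L lebesgue \<rho> = 1 \<and> ess_support \<rho> \<subseteq> ball 0 1"

definition rescaled :: "('a::euclidean_space \<Rightarrow> real) \<Rightarrow> real \<Rightarrow> 'a \<Rightarrow> real" where
  "rescaled \<rho> \<epsilon> z = \<rho> (z /\<^sub>R \<epsilon>) / \<epsilon> ^ DIM('a)"

definition inner_part :: "'a::euclidean_space set \<Rightarrow> 'a set \<Rightarrow> real \<Rightarrow> 'a set" where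
  "inner_part X U \<epsilon> = (\<Inter>z \<in> {z \<in> X. norm z < \<epsilon>}. (\<lambda>x. x - z) ` U)"

definition energy_eps ::
  "'a::euclidean_space set \<Rightarrow> 'a set \<Rightarrow> 'a set \<Rightarrow> 'a set \<Rightarrow> ('a \<Rightarrow> real) \<Rightarrow>
   real \<Rightarrow> real \<Rightarrow> real \<Rightarrow> real \<Rightarrow> ('a \<Rightarrow> real) \<Rightarrow> ennreal" where
  "energy_eps X1 X2 \<Omega>1 \<Omega>2 \<rho> \<theta>1 \<theta>2 p \<epsilon> u =
     (\<integral>\<^sup>+ z. ennreal (rescaled \<rho> \<epsilon> z) *
        (\<integral>\<^sup>+ x. ennreal (\<bar>u (x + component X1 X2 z) - u x\<bar> powr \<theta>1 *
                       \<bar>u (x + component X2 X1 z) - u x\<bar> powr \<theta>2 / norm z powr p)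
           \<partial>lebesgue_on (inner_part X1 \<Omega>1 \<epsilon> + inner_part X2 \<Omega>2 \<epsilon>)) \<partial>lebesgue)"

definition energy ::
  "'a::euclidean_space set \<Rightarrow> 'a set \<Rightarrow> 'a set \<Rightarrow> 'a set \<Rightarrow> ('a \<Rightarrow> real) \<Rightarrow>
   real \<Rightarrow> real \<Rightarrow> real \<Rightarrow> ('a \<Rightarrow> real) \<Rightarrow> ennreal" where
  "energy X1 X2 \<Omega>1 \<Omega>2 \<rho> \<theta>1 \<theta>2 p u =
     Liminf (at_right 0) (\<lambda>\<epsilon>. energy_eps X1 X2 \<Omega>1 \<Omega>2 \<rho> \<theta>1 \<theta>2 p \<epsilon> u)"

end

theory Submission
  imports Defs
begin

text \<open>
  Choose orthonormal vectors \<open>e1\<close>, \<open>e2\<close> spanning the two lines. In the coordinates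
  \<open>frame e1 e2 (s, t) = s e1 + t e2\<close> the domain is a rectangle \<open>I \<times> J\<close>, and \<open>u\<close> becomes a function
  \<open>w\<close> with values in \<open>[-1, 1]\<close>.

  The heart of the matter is a statement on finite grids. Consider one cell of a grid, the
  differences \<open>a\<close>, \<open>b\<close> of a function \<open>U\<close> along its two horizontal edges and \<open>c\<close>, \<open>d\<close> along its two vertical
  edges. The mixed difference is \<open>b - a = d - c\<close>, hence \<open>(\<bar>a\<bar>^\<theta>1 + \<bar>b\<bar>^\<theta>1) (\<bar>c\<bar>^\<theta>2 + \<bar>d\<bar>^\<theta>2)\<close> bounds
  \<open>\<bar>b - a\<bar>^(\<theta>1 + \<theta>2)\<close> up to a constant, and because \<open>\<theta>1 + \<theta>2 \<le> 1\<close> and \<open>U\<close> is bounded it bounds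
  \<open>\<bar>b - a\<bar>\<close>. So the energy \<open>e\<close>, the sum of these products, controls the total mixed variation of \<open>U\<close>.
  Then the variation along a horizontal line hardly depends on the line, and similarly for
  vertical lines; where the differences do not change much, the product structure of the energy shows
  that the product of the horizontal variation and the vertical variation is at most \<open>e\<close>. Hence one of
  the two is at most a multiple of \<open>e + sqrt e\<close> (\<open>discrete_dichotomy\<close>).

  To use this, note that the kernel charges the open quadrant, and by symmetry all four quadrants
  alike. Therefore one finds increments \<open>a\<close>, \<open>b\<close>, both comparable with \<open>\<epsilon>\<close>, for which the integral of
  the four corner products is at most a constant times \<open>(E + \<eta>) a b\<close> (\<open>exists_good_increments\<close>). Averaging
  over the offset of a grid with these step sizes gives a grid whose discrete energy is
  at most a multiple of \<open>E + \<eta>\<close> and whose step interpolant is close to \<open>w\<close> in the mean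
  (\<open>exists_step_approximation\<close>); the closeness rests on the continuity of translations in the mean.

  Suppose that the horizontal variation is the small one along a sequence of such interpolants. Their
  estimates pass to the limit: subtract from \<open>w\<close> its average over \<open>s\<close>, a function of \<open>t\<close> alone. The
  remainder \<open>v\<close> is bounded by \<open>K\<close>, a multiple of \<open>E + sqrt E\<close>, and the integrals of
  \<open>\<bar>v(\<cdot> + h e) - v\<bar>\<close> for both coordinate directions \<open>e\<close> are at most a multiple of \<open>K h\<close>
  (\<open>limit_of_nearly_column\<close>). In the other case the roles of \<open>s\<close> and \<open>t\<close> are exchanged.

  Finally, such bounds on differences produce the gradient measure explicitly, without a
  compactness argument. On a line, \<open>1/h\<close> times the integral of the positive part of \<open>v(\<sigma> + h) - v \<sigma>\<close> up to \<open>s\<close>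
  increases as \<open>h = 1/2^k\<close> decreases; its limit is the positive variation of \<open>v\<close>, a monotone function
  of \<open>s\<close>. The positive and the negative variation differ, up to a constant, by \<open>v\<close>. A family of monotone
  functions, one on every line, is the family of distribution functions of one finite measure
  on the rectangle, namely the image of Lebesgue measure under the quantile map
  (\<open>monotone_sections_measure\<close>). Its total mass is the integral of the total masses on the lines.
\<close>

section \<open>A dichotomy for functions on a finite grid\<close>

lemma powr_le_add_powr:
  fixes a b x t :: real
  assumes "0 < t" "0 \<le> x" "x \<le> \<bar>a\<bar> \<or> x \<le> \<bar>b\<bar>"
  shows "x powr t \<le> \<bar>a\<bar> powr t + \<bar>b\<bar> powr t"
proof -
  have "x powr t \<le> \<bar>a\<bar> powr t \<or> x powr t \<le> \<bar>b\<bar> powr t"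
    using assms by (auto intro: powr_mono2)
  then show ?thesis
    using powr_ge_zero[of "\<bar>a\<bar>" t] powr_ge_zero[of "\<bar>b\<bar>" t] by linarith
qed

text \<open>The assumption \<open>\<theta>1 + \<theta>2 \<le> 1\<close> enters because half of the absolute mixed difference lies in \<open>[0, 2]\<close>, where
  \<open>x / 2 \<le> x powr (\<theta>1 + \<theta>2)\<close>.\<close>

lemma cell_energy_ge_mixed:
  fixes a b c d \<theta>1 \<theta>2 :: real
  assumes th: "\<theta>1 > 0" "\<theta>2 > 0" "\<theta>1 + \<theta>2 \<le> 1"
    and m: "b - a = d - c" "\<bar>b - a\<bar> \<le> 4"
  shows "\<bar>b - a\<bar> / 4 \<le> (\<bar>a\<bar> powr \<theta>1 + \<bar>b\<bar> powr \<theta>1) * (\<bar>c\<bar> powr \<theta>2 + \<bar>d\<bar> powr \<theta>2)"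
proof -
  define x where "x = \<bar>b - a\<bar> / 2"
  have x: "0 \<le> x" "x \<le> 2" using m by (auto simp: x_def)
  have 1: "x powr \<theta>1 \<le> \<bar>a\<bar> powr \<theta>1 + \<bar>b\<bar> powr \<theta>1"
    by (rule powr_le_add_powr) (use th in \<open>auto simp: x_def\<close>)
  have 2: "x powr \<theta>2 \<le> \<bar>c\<bar> powr \<theta>2 + \<bar>d\<bar> powr \<theta>2"
    by (rule powr_le_add_powr) (use th m in \<open>auto simp: x_def\<close>)
  have "x / 2 \<le> x powr (\<theta>1 + \<theta>2)"
  proof (cases "x \<le> 1")
    case True
    then have "x powr 1 \<le> x powr (\<theta>1 + \<theta>2)"
      using th x by (intro powr_mono') auto
    then show ?thesis using x by auto
  next
    case False
    then have "1 \<le> x powr (\<theta>1 + \<theta>2)"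
      using th by (intro ge_one_powr_ge_zero) auto
    then show ?thesis using x by auto
  qed
  also have "\<dots> = x powr \<theta>1 * x powr \<theta>2" by (rule powr_add)
  also have "\<dots> \<le> (\<bar>a\<bar> powr \<theta>1 + \<bar>b\<bar> powr \<theta>1) * (\<bar>c\<bar> powr \<theta>2 + \<bar>d\<bar> powr \<theta>2)"
    using 1 2 by (intro mult_mono) auto
  finally show ?thesis by (simp add: x_def)
qed

lemma cell_energy_ge_product:
  fixes a b c d f g \<theta>1 \<theta>2 :: real
  assumes th: "\<theta>1 > 0" "\<theta>2 > 0" "\<theta>1 + \<theta>2 \<le> 1"
    and f: "0 \<le> f" "f \<le> 2" "f / 2 \<le> \<bar>a\<bar>" "f / 2 \<le> \<bar>b\<bar>"
    and g: "0 \<le> g" "g \<le> 2" "g / 2 \<le> \<bar>c\<bar>" "g / 2 \<le> \<bar>d\<bar>"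
  shows "f * g \<le> (\<bar>a\<bar> powr \<theta>1 + \<bar>b\<bar> powr \<theta>1) * (\<bar>c\<bar> powr \<theta>2 + \<bar>d\<bar> powr \<theta>2)"
proof -
  have le: "x \<le> x powr t" if "0 \<le> x" "x \<le> 1" "0 < t" "t \<le> 1" for x t :: real
    using powr_mono'[of t 1 x] that by auto
  have 1: "f / 2 \<le> (f / 2) powr \<theta>1" and 2: "g / 2 \<le> (g / 2) powr \<theta>2"
    using assms by (intro le; linarith)+
  have "f \<le> \<bar>a\<bar> powr \<theta>1 + \<bar>b\<bar> powr \<theta>1"
    using 1 powr_mono2[of \<theta>1 "f/2" "\<bar>a\<bar>"] powr_mono2[of \<theta>1 "f/2" "\<bar>b\<bar>"] th f by simp
  moreover have "g \<le> \<bar>c\<bar> powr \<theta>2 + \<bar>d\<bar> powr \<theta>2"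
    using 2 powr_mono2[of \<theta>2 "g/2" "\<bar>c\<bar>"] powr_mono2[of \<theta>2 "g/2" "\<bar>d\<bar>"] th g by simp
  ultimately show ?thesis using f g by (intro mult_mono) auto
qed

text \<open>The indices at which \<open>f\<close> is less than twice the perturbation \<open>a\<close> contribute at most twice the sum of
  the perturbations.\<close>

lemma sum_small_le_twice:
  fixes f a :: "nat \<Rightarrow> real"
  assumes "\<And>i. 0 \<le> a i"
  shows "(\<Sum>i<N. f i) \<le> (\<Sum>i\<in>{i\<in>{..<N}. 2 * a i \<le> f i}. f i) + 2 * (\<Sum>i<N. a i)"
proof -
  have "(\<Sum>i<N. f i) \<le> (\<Sum>i<N. (if 2 * a i \<le> f i then f i else 0) + 2 * a i)"
    by (intro sum_mono) (use assms in auto)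
  also have "\<dots> = (\<Sum>i<N. if 2 * a i \<le> f i then f i else 0) + 2 * (\<Sum>i<N. a i)"
    by (simp add: sum.distrib sum_distrib_left)
  also have "(\<Sum>i<N. if 2 * a i \<le> f i then f i else 0) = (\<Sum>i\<in>{i\<in>{..<N}. 2 * a i \<le> f i}. f i)"
    by (rule sum.inter_filter[symmetric]) auto
  finally show ?thesis .
qed

lemma half_le_abs:
  fixes x y a :: real
  assumes "\<bar>x - y\<bar> \<le> a" "2 * a \<le> \<bar>y\<bar>"
  shows "\<bar>y\<bar> / 2 \<le> \<bar>x\<bar>"
  using assms by linarith

text \<open>The energy of one grid cell: the sum, over its four corners, of the products
  \<open>\<bar>horizontal difference\<bar>^\<theta>1 \<bar>vertical difference\<bar>^\<theta>2\<close> along the two edges that meet at the corner.\<close>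

definition cell_energy ::
  "real \<Rightarrow> real \<Rightarrow> (nat \<Rightarrow> nat \<Rightarrow> real) \<Rightarrow> nat \<Rightarrow> nat \<Rightarrow> real" where
  "cell_energy \<theta>1 \<theta>2 U i j =
     (\<bar>U (Suc i) j - U i j\<bar> powr \<theta>1 + \<bar>U (Suc i) (Suc j) - U i (Suc j)\<bar> powr \<theta>1) *
     (\<bar>U i (Suc j) - U i j\<bar> powr \<theta>2 + \<bar>U (Suc i) (Suc j) - U (Suc i) j\<bar> powr \<theta>2)"

text \<open>The mixed second difference of \<open>U\<close> on the cell with lower left corner \<open>(i, j)\<close>.\<close>

definition mixed_diff :: "(nat \<Rightarrow> nat \<Rightarrow> real) \<Rightarrow> nat \<Rightarrow> nat \<Rightarrow> real" where
  "mixed_diff U i j = U (Suc i) (Suc j) - U i (Suc j) - U (Suc i) j + U i j"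

lemma sum_mixed_diff_le:
  assumes th: "\<theta>1 > 0" "\<theta>2 > 0" "\<theta>1 + \<theta>2 \<le> 1"
    and U: "\<And>i j. \<bar>U i j\<bar> \<le> 1"
  shows "(\<Sum>i<N. \<Sum>j<M. \<bar>mixed_diff U i j\<bar>) \<le> 4 * (\<Sum>i<N. \<Sum>j<M. cell_energy \<theta>1 \<theta>2 U i j)"
proof -
  have "\<bar>mixed_diff U i j\<bar> / 4 \<le> cell_energy \<theta>1 \<theta>2 U i j" for i j
  proof -
    have "\<bar>(U (Suc i) (Suc j) - U i (Suc j)) - (U (Suc i) j - U i j)\<bar> / 4 \<le> cell_energy \<theta>1 \<theta>2 U i j"
      unfolding cell_energy_def using U[of i j] U[of i "Suc j"] U[of "Suc i" j] U[of "Suc i" "Suc j"]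
      by (intro cell_energy_ge_mixed th) linarith+
    then show ?thesis by (simp add: mixed_diff_def algebra_simps)
  qed
  then have "\<bar>mixed_diff U i j\<bar> \<le> 4 * cell_energy \<theta>1 \<theta>2 U i j" for i j
    by (simp add: field_simps)
  then show ?thesis by (auto simp: sum_distrib_left intro!: sum_mono)
qed

lemma edge_diff_le_mixed:
  "\<bar>(U (Suc i) j - U i j) - (U (Suc i) 0 - U i 0)\<bar> \<le> (\<Sum>k<j. \<bar>mixed_diff U i k\<bar>)"
  by (induction j) (auto simp: mixed_diff_def)

lemma mixed_diff_swap: "mixed_diff (\<lambda>i j. U j i) i j = mixed_diff U j i"
  by (simp add: mixed_diff_def)

text \<open>A function of small energy on a grid has small variation along all rows, or along all columns.\<close>

lemma discrete_dichotomy: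
  fixes U :: "nat \<Rightarrow> nat \<Rightarrow> real"
  assumes th: "\<theta>1 > 0" "\<theta>2 > 0" "\<theta>1 + \<theta>2 \<le> 1"
    and U: "\<And>i j. \<bar>U i j\<bar> \<le> 1"
    and e: "(\<Sum>i<N. \<Sum>j<M. cell_energy \<theta>1 \<theta>2 U i j) \<le> e"
  shows "(\<forall>j\<le>M. (\<Sum>i<N. \<bar>U (Suc i) j - U i j\<bar>) \<le> 12 * e + sqrt e) \<or>
         (\<forall>i\<le>N. (\<Sum>j<M. \<bar>U i (Suc j) - U i j\<bar>) \<le> 12 * e + sqrt e)"
proof -
  \<comment> \<open>The differences along the row 0 and the column 0, and the variation of these differences from one row or column to another.\<close>
  define f where "f i = \<bar>U (Suc i) 0 - U i 0\<bar>" for i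
  define g where "g j = \<bar>U 0 (Suc j) - U 0 j\<bar>" for j
  define a where "a i = (\<Sum>k<M. \<bar>mixed_diff U i k\<bar>)" for i
  define b where "b j = (\<Sum>k<N. \<bar>mixed_diff U k j\<bar>)" for j
  have a0: "0 \<le> a i" and b0: "0 \<le> b i" for i by (auto simp: a_def b_def intro: sum_nonneg)
  have sa: "(\<Sum>i<N. a i) \<le> 4 * e"
    using sum_mixed_diff_le[where U = U and N = N and M = M, OF th U] e by (simp add: a_def)
  have "(\<Sum>j<M. b j) = (\<Sum>i<N. a i)" unfolding a_def b_def by (rule sum.swap)
  then have sb: "(\<Sum>j<M. b j) \<le> 4 * e" using sa by simp
  have da: "\<bar>(U (Suc i) j - U i j) - (U (Suc i) 0 - U i 0)\<bar> \<le> a i" if "j \<le> M" for i j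
    by (rule order_trans[OF edge_diff_le_mixed]) (use that in \<open>auto simp: a_def intro!: sum_mono2\<close>)
  have db: "\<bar>(U i (Suc j) - U i j) - (U 0 (Suc j) - U 0 j)\<bar> \<le> b j" if "i \<le> N" for i j
  proof -
    have "\<bar>(U i (Suc j) - U i j) - (U 0 (Suc j) - U 0 j)\<bar> \<le> (\<Sum>k<i. \<bar>mixed_diff U k j\<bar>)"
      using edge_diff_le_mixed[of "\<lambda>i j. U j i" j i] unfolding mixed_diff_swap[of U] .
    also have "\<dots> \<le> b j"
      unfolding b_def by (rule sum_mono2) (use that in auto)
    finally show ?thesis .
  qed
  \<comment> \<open>Indices for which the difference keeps at least half of its size on every row (column); \<open>F\<close> and \<open>G\<close> sum over these only.\<close>
  let ?A = "{i\<in>{..<N}. 2 * a i \<le> f i}" and ?B = "{j\<in>{..<M}. 2 * b j \<le> g j}"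
  define F where "F = (\<Sum>i\<in>?A. f i)"
  define G where "G = (\<Sum>j\<in>?B. g j)"
  have ce0: "0 \<le> cell_energy \<theta>1 \<theta>2 U i j" for i j
    by (simp add: cell_energy_def)
  have "F * G = (\<Sum>i\<in>?A. \<Sum>j\<in>?B. f i * g j)"
    by (simp add: F_def G_def sum_product)
  also have "\<dots> \<le> (\<Sum>i\<in>?A. \<Sum>j\<in>?B. cell_energy \<theta>1 \<theta>2 U i j)"
  proof (intro sum_mono)
    fix i j assume i: "i \<in> ?A" and j: "j \<in> ?B"
    have ai: "2 * a i \<le> f i" and bj: "2 * b j \<le> g j"
      and iN: "i \<le> N" "Suc i \<le> N" and jM: "j \<le> M" "Suc j \<le> M" using i j by auto
    show "f i * g j \<le> cell_energy \<theta>1 \<theta>2 U i j"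
      unfolding cell_energy_def
    proof (rule cell_energy_ge_product[OF th])
      show "f i \<le> 2" "g j \<le> 2"
        using U[of "Suc i" 0] U[of i 0] U[of 0 "Suc j"] U[of 0 j] by (auto simp: f_def g_def)
      show "f i / 2 \<le> \<bar>U (Suc i) j - U i j\<bar>"
        using da[OF jM(1), of i] ai unfolding f_def by (rule half_le_abs)
      show "f i / 2 \<le> \<bar>U (Suc i) (Suc j) - U i (Suc j)\<bar>"
        using da[OF jM(2), of i] ai unfolding f_def by (rule half_le_abs)
      show "g j / 2 \<le> \<bar>U i (Suc j) - U i j\<bar>"
        using db[OF iN(1), of j] bj unfolding g_def by (rule half_le_abs)
      show "g j / 2 \<le> \<bar>U (Suc i) (Suc j) - U (Suc i) j\<bar>"
        using db[OF iN(2), of j] bj unfolding g_def by (rule half_le_abs)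
    qed (auto simp: f_def g_def)
  qed
  also have "\<dots> \<le> (\<Sum>i<N. \<Sum>j\<in>?B. cell_energy \<theta>1 \<theta>2 U i j)"
    by (intro sum_mono2 sum_nonneg) (auto simp: ce0)
  also have "\<dots> \<le> (\<Sum>i<N. \<Sum>j<M. cell_energy \<theta>1 \<theta>2 U i j)"
    by (intro sum_mono sum_mono2) (auto simp: ce0)
  finally have FG: "F * G \<le> e" using e by simp
  have F0: "0 \<le> F" and G0: "0 \<le> G" by (auto simp: F_def G_def f_def g_def intro: sum_nonneg)
  have FG2: "F \<le> sqrt e \<or> G \<le> sqrt e"
  proof (rule ccontr)
    assume "\<not> ?thesis"
    moreover have "0 \<le> e" using FG F0 G0 by (meson mult_nonneg_nonneg order_trans)
    ultimately have "sqrt e * sqrt e < F * G"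
      by (intro mult_strict_mono) (auto simp: not_le intro: le_less_trans[OF real_sqrt_ge_zero])
    then show False using FG \<open>0 \<le> e\<close> by simp
  qed
  have row: "(\<Sum>i<N. \<bar>U (Suc i) j - U i j\<bar>) \<le> F + 12 * e" if "j \<le> M" for j
  proof -
    have "(\<Sum>i<N. \<bar>U (Suc i) j - U i j\<bar>) \<le> (\<Sum>i<N. f i + a i)"
      proof (intro sum_mono)
      fix i show "\<bar>U (Suc i) j - U i j\<bar> \<le> f i + a i"
        using da[OF that, of i] unfolding f_def by linarith
    qed
    also have "\<dots> \<le> F + 2 * (\<Sum>i<N. a i) + (\<Sum>i<N. a i)"
      using sum_small_le_twice[of a f N, OF a0] by (simp add: sum.distrib F_def)
    finally show ?thesis using sa by simp
  qed
  have col: "(\<Sum>j<M. \<bar>U i (Suc j) - U i j\<bar>) \<le> G + 12 * e" if "i \<le> N" for i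
  proof -
    have "(\<Sum>j<M. \<bar>U i (Suc j) - U i j\<bar>) \<le> (\<Sum>j<M. g j + b j)"
      proof (intro sum_mono)
      fix j show "\<bar>U i (Suc j) - U i j\<bar> \<le> g j + b j"
        using db[OF that, of j] unfolding g_def by linarith
    qed
    also have "\<dots> \<le> G + 2 * (\<Sum>j<M. b j) + (\<Sum>j<M. b j)"
      using sum_small_le_twice[of b g M, OF b0] by (simp add: sum.distrib G_def)
    finally show ?thesis using sb by simp
  qed
  from FG2 consider "F \<le> sqrt e" | "G \<le> sqrt e" by blast
  then show ?thesis
  proof cases
    case 1
    have "(\<Sum>i<N. \<bar>U (Suc i) j - U i j\<bar>) \<le> 12 * e + sqrt e" if "j \<le> M" for j
      using row[OF that] 1 by linarith
    then show ?thesis by blast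
  next
    case 2
    have "(\<Sum>j<M. \<bar>U i (Suc j) - U i j\<bar>) \<le> 12 * e + sqrt e" if "i \<le> N" for i
      using col[OF that] 2 by linarith
    then show ?thesis by blast
  qed
qed

text \<open>A step function \<open>\<phi> \<circ> i\<close> of total variation \<open>V\<close> satisfies the difference bound with \<open>V h\<close>: the jump from \<open>l\<close>
  to \<open>l + 1\<close> is crossed between \<open>s\<close> and \<open>s + h\<close> only for \<open>s\<close> in an interval of length \<open>h\<close>.\<close>

lemma nn_integral_step_shift_le:
  fixes \<phi> :: "nat \<Rightarrow> real" and i :: "real \<Rightarrow> nat"
  assumes "mono i" "\<And>s. i s \<le> N" "h > 0"
  shows "(\<integral>\<^sup>+ s. ennreal \<bar>\<phi> (i (s + h)) - \<phi> (i s)\<bar> \<partial>lborel)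
           \<le> ennreal (h * (\<Sum>l<N. \<bar>\<phi> (Suc l) - \<phi> l\<bar>))"
proof -
  have *: "\<exists>p. {s. i s \<le> l \<and> l < i (s + h)} \<subseteq> {p - h .. p}" for l
  proof (cases "{s. i s \<le> l \<and> l < i (s + h)} = {}")
    case False
    then obtain s0 where s0: "i s0 \<le> l" "l < i (s0 + h)" by auto
    let ?S = "{s. i s \<le> l}"
    have bdd: "bdd_above ?S"
    proof (rule bdd_aboveI)
      fix x assume "x \<in> ?S"
      then show "x \<le> s0 + h" using s0 \<open>mono i\<close>
        by (metis leD le_cases mem_Collect_eq monoD order_trans)
    qed
    have "s \<in> {Sup ?S - h .. Sup ?S}" if "i s \<le> l" "l < i (s + h)" for s
    proof -
      have "s \<le> Sup ?S" using that bdd by (auto intro: cSup_upper)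
      moreover have "Sup ?S \<le> s + h"
      proof (rule cSup_least)
        fix x assume "x \<in> ?S"
        then show "x \<le> s + h" using that \<open>mono i\<close>
          by (metis leD le_cases mem_Collect_eq monoD order_trans)
      qed (use that in auto)
      ultimately show ?thesis by auto
    qed
    then show ?thesis by blast
  qed auto
  then obtain p where p: "\<And>l. {s. i s \<le> l \<and> l < i (s + h)} \<subseteq> {p l - h .. p l}" by metis
  have tel: "\<bar>\<phi> n - \<phi> m\<bar> \<le> (\<Sum>l\<in>{m..<n}. \<bar>\<phi> (Suc l) - \<phi> l\<bar>)" if "m \<le> n" for m n
    using that
  proof (induction n rule: dec_induct)
    case (step n)
    have "\<bar>\<phi> (Suc n) - \<phi> m\<bar> \<le> \<bar>\<phi> n - \<phi> m\<bar> + \<bar>\<phi> (Suc n) - \<phi> n\<bar>" by linarith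
    then show ?case using step by simp
  qed simp
  have "ennreal \<bar>\<phi> (i (s + h)) - \<phi> (i s)\<bar>
      \<le> (\<Sum>l<N. ennreal \<bar>\<phi> (Suc l) - \<phi> l\<bar> * indicator {p l - h .. p l} s)" for s
  proof -
    have le: "i s \<le> i (s + h)" using assms by (auto intro: monoD)
    have "\<bar>\<phi> (i (s + h)) - \<phi> (i s)\<bar> \<le> (\<Sum>l\<in>{i s..<i (s + h)}. \<bar>\<phi> (Suc l) - \<phi> l\<bar>)"
      by (rule tel[OF le])
    also have "\<dots> = (\<Sum>l\<in>{i s..<i (s + h)}. \<bar>\<phi> (Suc l) - \<phi> l\<bar> * indicator {p l - h .. p l} s)"
      by (intro sum.cong refl) (use p in \<open>auto simp: indicator_def subset_iff\<close>)
    also have "\<dots> \<le> (\<Sum>l<N. \<bar>\<phi> (Suc l) - \<phi> l\<bar> * indicator {p l - h .. p l} s)"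
      by (rule sum_mono2) (use assms(2)[of "s + h"] in auto)
    finally have "ennreal \<bar>\<phi> (i (s + h)) - \<phi> (i s)\<bar> \<le>
       ennreal (\<Sum>l<N. \<bar>\<phi> (Suc l) - \<phi> l\<bar> * indicator {p l - h .. p l} s)"
      by (rule ennreal_leI)
    also have "\<dots> = (\<Sum>l<N. ennreal (\<bar>\<phi> (Suc l) - \<phi> l\<bar> * indicator {p l - h .. p l} s))"
      by (rule sum_ennreal[symmetric]) auto
    also have "\<dots> = (\<Sum>l<N. ennreal \<bar>\<phi> (Suc l) - \<phi> l\<bar> * indicator {p l - h .. p l} s)"
      by (intro sum.cong refl) (auto simp: indicator_def)
    finally show ?thesis .
  qed
  then have "(\<integral>\<^sup>+ s. ennreal \<bar>\<phi> (i (s + h)) - \<phi> (i s)\<bar> \<partial>lborel) \<le>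
      (\<integral>\<^sup>+ s. (\<Sum>l<N. ennreal \<bar>\<phi> (Suc l) - \<phi> l\<bar> * indicator {p l - h .. p l} s) \<partial>lborel)"
    by (intro nn_integral_mono) auto
  also have "\<dots> = (\<Sum>l<N. ennreal \<bar>\<phi> (Suc l) - \<phi> l\<bar> * ennreal h)"
    using assms by (subst nn_integral_sum) (auto simp: nn_integral_cmult_indicator)
  also have "\<dots> = ennreal (\<Sum>l<N. \<bar>\<phi> (Suc l) - \<phi> l\<bar> * h)"
    using assms by (subst sum_ennreal[symmetric]) (auto simp: ennreal_mult)
  finally show ?thesis by (simp add: sum_distrib_left mult.commute)
qed

section \<open>Continuity of translations in the mean\<close>

text \<open>A Borel function is an almost everywhere limit of continuous functions on the whole space.\<close>

lemma borel_imp_continuous_limit: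
  fixes f :: "'a::euclidean_space \<Rightarrow> real"
  assumes "f \<in> borel_measurable borel"
  obtains g where "\<And>n::nat. continuous_on UNIV (g n)" "AE x in lborel. (\<lambda>n. g n x) \<longlonglongrightarrow> f x"
proof -
  have "f \<in> borel_measurable lebesgue" using assms by (auto intro: measurable_completion)
  then have "f measurable_on UNIV"
    by (intro lebesgue_measurable_imp_measurable_on) auto
  then obtain N g where N: "negligible N" and g: "\<And>n. continuous_on UNIV (g n)"
    and lim: "\<And>x. x \<notin> N \<Longrightarrow> (\<lambda>n. g n x) \<longlonglongrightarrow> f x"
    unfolding measurable_on_def by auto
  have "AE x in lebesgue. (\<lambda>n. g n x) \<longlonglongrightarrow> f x"
    using N lim by (intro AE_I'[of N]) (auto simp: negligible_iff_null_sets)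
  then have "AE x in lborel. (\<lambda>n. g n x) \<longlonglongrightarrow> f x" by (simp add: AE_completion_iff)
  then show ?thesis using g by (rule that[rotated])
qed

text \<open>Approximate \<open>f\<close> in the mean by a continuous function of compact support, which is uniformly
  continuous.\<close>

lemma nn_integral_abs_diff_translate_small:
  fixes f :: "'a::euclidean_space \<Rightarrow> real"
  assumes f[measurable]: "f \<in> borel_measurable borel" and bdd: "\<And>x. \<bar>f x\<bar> \<le> 1"
    and supp: "\<And>x. x \<notin> cball 0 R \<Longrightarrow> f x = 0" and R: "R > 0" and e: "e > 0"
  obtains d where "d > 0"
    "\<And>z. norm z < d \<Longrightarrow> (\<integral>\<^sup>+ x. ennreal \<bar>f (x + z) - f x\<bar> \<partial>lborel) \<le> ennreal e"
proof -
  obtain g where g: "\<And>n::nat. continuous_on UNIV (g n)" and lim: "AE x in lborel. (\<lambda>n. g n x) \<longlonglongrightarrow> f x"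
    using borel_imp_continuous_limit[OF f] by blast
  \<comment> \<open>A cutoff, equal to 1 on the ball of radius \<open>R\<close>.\<close>
  define q :: "'a \<Rightarrow> real" where "q x = max 0 (min 1 (R + 1 - norm x))" for x
  define h where "h n x = q x * max (-1) (min 1 (g n x))" for n x
  have q: "0 \<le> q x" "q x \<le> 1" "x \<in> cball 0 R \<Longrightarrow> q x = 1" "x \<notin> cball 0 (R+1) \<Longrightarrow> q x = 0" for x
    by (auto simp: q_def)
  have hc: "continuous_on UNIV (h n)" for n
    unfolding h_def q_def by (intro continuous_intros g)
  then have hm[measurable]: "h n \<in> borel_measurable borel" for n
    by (rule borel_measurable_continuous_onI)
  have hb: "\<bar>h n x\<bar> \<le> indicator (cball 0 (R+1)) x" for n x
  proof -
    have "\<bar>h n x\<bar> = q x * \<bar>max (-1) (min 1 (g n x))\<bar>" using q(1) by (simp add: h_def abs_mult)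
    also have "\<dots> \<le> q x * 1" by (intro mult_left_mono q) auto
    also have "\<dots> \<le> indicator (cball 0 (R+1)) x" using q(2)[of x] q(4)[of x] by (auto simp: indicator_def)
    finally show ?thesis .
  qed
  have hlim: "AE x in lborel. (\<lambda>n. h n x) \<longlonglongrightarrow> f x"
    using lim
  proof eventually_elim
    fix x assume "(\<lambda>n. g n x) \<longlonglongrightarrow> f x"
    then have "(\<lambda>n. h n x) \<longlonglongrightarrow> q x * max (-1) (min 1 (f x))"
      unfolding h_def by (intro tendsto_intros)
    also have "q x * max (-1) (min 1 (f x)) = f x"
    proof (cases "x \<in> cball 0 R")
      case True then show ?thesis using q(3)[of x] bdd[of x] by (auto simp: abs_le_iff)
    qed (simp add: supp)
    finally show "(\<lambda>n. h n x) \<longlonglongrightarrow> f x" .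
  qed
  have "(\<lambda>n. \<integral>\<^sup>+ x. norm (f x - h n x) \<partial>lborel) \<longlonglongrightarrow> 0"
  proof (rule nn_integral_dominated_convergence_norm[where w = "indicator (cball 0 (R+1))"])
    show "(\<integral>\<^sup>+ x. ennreal (indicator (cball 0 (R+1)) x) \<partial>(lborel::'a measure)) < \<infinity>"
      using emeasure_bounded_finite[of "cball 0 (R+1) :: 'a set"] by (simp add: ennreal_indicator)
  qed (use hb hlim in \<open>auto intro!: borel_measurable_indicator\<close>)
  then have "eventually (\<lambda>n. (\<integral>\<^sup>+ x. norm (f x - h n x) \<partial>lborel) < ennreal (e/3)) sequentially"
    using e by (intro order_tendstoD(2)[of _ 0]) auto
  then obtain n where n: "(\<integral>\<^sup>+ x. ennreal \<bar>f x - h n x\<bar> \<partial>lborel) < ennreal (e/3)"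
    by (auto simp: eventually_sequentially)
  define V where "V = measure lborel (cball 0 (R+2) :: 'a set) + 1"
  have V: "V > 0" "emeasure lborel (cball 0 (R+2) :: 'a set) \<le> ennreal V"
    using emeasure_bounded_finite[of "cball 0 (R+2) :: 'a set"]
    by (auto simp: V_def add_nonneg_pos emeasure_eq_ennreal_measure)
  have "uniformly_continuous_on (cball 0 (R+2)) (h n)"
    by (intro compact_uniformly_continuous continuous_on_subset[OF hc]) auto
  then obtain d where d: "d > 0"
    "\<And>x y. x \<in> cball 0 (R+2) \<Longrightarrow> y \<in> cball 0 (R+2) \<Longrightarrow> dist y x < d \<Longrightarrow> dist (h n y) (h n x) < e / (3 * V)"
    unfolding uniformly_continuous_on_def using e V by (metis divide_pos_pos mult_pos_pos zero_less_numeral)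
  show ?thesis
  proof (rule that[of "min d 1"])
    show "0 < min d 1" using d by simp
    fix z :: 'a assume z: "norm z < min d 1"
    have pw: "\<bar>h n (x + z) - h n x\<bar> \<le> e / (3 * V) * indicator (cball 0 (R+2)) x" for x
    proof (cases "x \<in> cball 0 (R+1)")
      case True
      then have "x \<in> cball 0 (R+2)" "x + z \<in> cball 0 (R+2)"
        using z norm_triangle_ineq[of x z] by auto
      then show ?thesis using d(2)[of x "x+z"] z by (auto simp: dist_norm)
    next
      case False
      then have hx: "h n x = 0" by (simp add: h_def q)
      show ?thesis
      proof (cases "x \<in> cball 0 (R+2)")
        case T: True
        show ?thesis
        proof (cases "x + z \<in> cball 0 (R+2)")
          case True
          then show ?thesis using d(2)[of x "x+z"] z T by (auto simp: dist_norm)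
        next
          case False
          then have "x + z \<notin> cball 0 (R+1)" by auto
          then have "h n (x + z) = 0" by (simp add: h_def q)
          then show ?thesis using hx e V by (auto simp: indicator_def)
        qed
      next
        case F: False
        have "norm x \<le> norm (x + z) + norm z" using norm_triangle_ineq4[of "x+z" z] by simp
        then have "x + z \<notin> cball 0 (R+1)" using F z by auto
        then have "h n (x + z) = 0" by (simp add: h_def q)
        then show ?thesis using hx F by simp
      qed
    qed
    have [measurable]: "cball 0 (R+2) \<in> sets (borel :: 'a measure)" by auto
    have tr: "(\<integral>\<^sup>+ x. ennreal \<bar>f (x + z) - h n (x + z)\<bar> \<partial>lborel) = (\<integral>\<^sup>+ x. ennreal \<bar>f x - h n x\<bar> \<partial>lborel)"
    proof -
      have "(\<integral>\<^sup>+ x. ennreal \<bar>f x - h n x\<bar> \<partial>lborel) = (\<integral>\<^sup>+ x. ennreal \<bar>f x - h n x\<bar> \<partial>distr lborel borel ((+) z))"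
        by (simp add: lborel_distr_plus)
      also have "\<dots> = (\<integral>\<^sup>+ x. ennreal \<bar>f (z + x) - h n (z + x)\<bar> \<partial>lborel)"
        by (subst nn_integral_distr) auto
      finally show ?thesis by (simp add: add.commute)
    qed
    have "(\<integral>\<^sup>+ x. ennreal \<bar>f (x + z) - f x\<bar> \<partial>lborel) \<le>
       (\<integral>\<^sup>+ x. ennreal \<bar>f (x + z) - h n (x + z)\<bar> + (ennreal (e / (3 * V)) * indicator (cball 0 (R+2)) x + ennreal \<bar>h n x - f x\<bar>) \<partial>lborel)"
    proof (rule nn_integral_mono)
      fix x
      have "\<bar>f (x + z) - f x\<bar> \<le> \<bar>f (x + z) - h n (x + z)\<bar> + (e / (3 * V) * indicator (cball 0 (R+2)) x + \<bar>h n x - f x\<bar>)"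
        using pw[of x] by linarith
      then have "ennreal \<bar>f (x + z) - f x\<bar> \<le> ennreal (\<bar>f (x + z) - h n (x + z)\<bar> + (e / (3 * V) * indicator (cball 0 (R+2)) x + \<bar>h n x - f x\<bar>))"
        by (rule ennreal_leI)
      also have "\<dots> = ennreal \<bar>f (x + z) - h n (x + z)\<bar> + (ennreal (e / (3 * V)) * indicator (cball 0 (R+2)) x + ennreal \<bar>h n x - f x\<bar>)"
        using e V by (auto simp: ennreal_plus indicator_def)
      finally show "ennreal \<bar>f (x + z) - f x\<bar> \<le> \<dots>" .
    qed
    also have "\<dots> = (\<integral>\<^sup>+ x. ennreal \<bar>f (x + z) - h n (x + z)\<bar> \<partial>lborel) + ((\<integral>\<^sup>+ x. ennreal (e / (3 * V)) * indicator (cball 0 (R+2)) (x::'a) \<partial>lborel) + (\<integral>\<^sup>+ x. ennreal \<bar>h n x - f x\<bar> \<partial>lborel))"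
      by (subst nn_integral_add, measurable, subst nn_integral_add, measurable)
    also have "\<dots> = (\<integral>\<^sup>+ x. ennreal \<bar>f x - h n x\<bar> \<partial>lborel) + (ennreal (e / (3 * V)) * emeasure lborel (cball 0 (R+2) :: 'a set) + (\<integral>\<^sup>+ x. ennreal \<bar>h n x - f x\<bar> \<partial>lborel))"
      unfolding tr by (simp add: nn_integral_cmult_indicator)
    also have "\<dots> \<le> ennreal (e/3) + (ennreal (e / (3 * V)) * ennreal V + ennreal (e/3))"
      using n V by (intro add_mono mult_left_mono) (auto simp: abs_minus_commute intro: less_imp_le)
    also have "\<dots> = ennreal e"
      using e V by (simp add: ennreal_mult[symmetric] ennreal_plus[symmetric] del: ennreal_plus)
    finally show "(\<integral>\<^sup>+ x. ennreal \<bar>f (x + z) - f x\<bar> \<partial>lborel) \<le> ennreal e" .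
  qed
qed

section \<open>Functions that nearly depend on one variable only\<close>

lemma nn_integral_lborel_pair:
  fixes f :: "real \<times> real \<Rightarrow> ennreal"
  assumes [measurable]: "f \<in> borel_measurable borel"
  shows "(\<integral>\<^sup>+ x. f x \<partial>lborel) = (\<integral>\<^sup>+ s. \<integral>\<^sup>+ t. f (s, t) \<partial>lborel \<partial>lborel)"
    and "(\<integral>\<^sup>+ x. f x \<partial>lborel) = (\<integral>\<^sup>+ t. \<integral>\<^sup>+ s. f (s, t) \<partial>lborel \<partial>lborel)"
proof -
  have [measurable]: "f \<in> borel_measurable (lborel \<Otimes>\<^sub>M lborel)"
    by (simp add: lborel_prod)
  show "(\<integral>\<^sup>+ x. f x \<partial>lborel) = (\<integral>\<^sup>+ s. \<integral>\<^sup>+ t. f (s, t) \<partial>lborel \<partial>lborel)"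
    by (subst lborel_prod[symmetric], subst lborel.nn_integral_fst[symmetric]) auto
  show "(\<integral>\<^sup>+ x. f x \<partial>lborel) = (\<integral>\<^sup>+ t. \<integral>\<^sup>+ s. f (s, t) \<partial>lborel \<partial>lborel)"
    by (subst lborel_prod[symmetric], subst lborel_pair.nn_integral_snd[symmetric]) auto
qed

lemma nn_integral_lborel_translate:
  fixes f :: "'a::euclidean_space \<Rightarrow> ennreal"
  assumes [measurable]: "f \<in> borel_measurable borel"
  shows "(\<integral>\<^sup>+ x. f (x + z) \<partial>lborel) = (\<integral>\<^sup>+ x. f x \<partial>lborel)"
proof -
  have "(\<integral>\<^sup>+ x. f x \<partial>lborel) = (\<integral>\<^sup>+ x. f x \<partial>distr lborel borel ((+) z))"
    by (simp add: lborel_distr_plus)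
  also have "\<dots> = (\<integral>\<^sup>+ x. f (z + x) \<partial>lborel)"
    by (subst nn_integral_distr) auto
  finally show ?thesis by (simp add: add.commute)
qed

text \<open>The average of \<open>g(\<cdot>, t)\<close> over the interval from \<open>i0\<close> to \<open>i1\<close>.\<close>

definition row_average :: "real \<Rightarrow> real \<Rightarrow> (real \<times> real \<Rightarrow> real) \<Rightarrow> real \<Rightarrow> real" where
  "row_average i0 i1 g t = (\<integral>s. indicator {i0<..<i1} s * g (s, t) \<partial>lborel) / (i1 - i0)"

text \<open>The properties, uniform in the mesh, of the step functions that oscillate little in the first variable:
  the oscillation and the variation in \<open>s\<close> are at most \<open>K\<close>, and so is the variation in \<open>t\<close> of the difference of any two
  columns. Variation is expressed by integrals of differences, a form that is stable under convergence
  in the mean.\<close>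

definition nearly_column :: "real \<Rightarrow> (real \<times> real \<Rightarrow> real) \<Rightarrow> bool" where
  "nearly_column K g \<longleftrightarrow> g \<in> borel_measurable borel \<and> (\<forall>x. \<bar>g x\<bar> \<le> 1) \<and>
     (\<forall>s s' t. \<bar>g (s, t) - g (s', t)\<bar> \<le> K) \<and>
     (\<forall>h>0. \<forall>t. (\<integral>\<^sup>+ s. ennreal \<bar>g (s + h, t) - g (s, t)\<bar> \<partial>lborel) \<le> ennreal (K * h)) \<and>
     (\<forall>h>0. \<forall>s s'. (\<integral>\<^sup>+ t. ennreal \<bar>(g (s, t + h) - g (s, t)) - (g (s', t + h) - g (s', t))\<bar> \<partial>lborel)
        \<le> ennreal (K * h))"

lemma integrable_indicator_bounded:
  fixes \<phi> :: "real \<Rightarrow> real"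
  assumes [measurable]: "\<phi> \<in> borel_measurable borel" and "\<And>s. \<bar>\<phi> s\<bar> \<le> B"
  shows "integrable lborel (\<lambda>s. indicator {i0<..<i1} s * \<phi> s)"
proof (rule Bochner_Integration.integrable_bound[where f = "\<lambda>s. indicator {i0<..<i1} s * B"])
  show "integrable lborel (\<lambda>s. indicator {i0<..<i1} s * B)"
    using emeasure_bounded_finite[of "{i0<..<i1}"]
    by (intro integrable_mult_left integrable_real_indicator) auto
  have "0 \<le> B" using assms(2)[of 0] by linarith
  then show "AE s in lborel. norm (indicator {i0<..<i1} s * \<phi> s) \<le> norm (indicator {i0<..<i1} s * B)"
    using assms(2) by (auto simp: indicator_def)
qed measurable

lemma average_le:
  fixes \<phi> :: "real \<Rightarrow> real"
  assumes i: "i0 < i1" and [measurable]: "\<phi> \<in> borel_measurable borel" and b: "\<And>s. \<bar>\<phi> s\<bar> \<le> B"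
  shows "ennreal \<bar>(\<integral>s. indicator {i0<..<i1} s * \<phi> s \<partial>lborel) / (i1 - i0)\<bar>
     \<le> ennreal (1 / (i1 - i0)) * (\<integral>\<^sup>+ s. ennreal \<bar>\<phi> s\<bar> * indicator {i0<..<i1} s \<partial>lborel)"
proof -
  have "ennreal \<bar>(\<integral>s. indicator {i0<..<i1} s * \<phi> s \<partial>lborel) / (i1 - i0)\<bar>
     = ennreal (1 / (i1 - i0)) * ennreal (norm (\<integral>s. indicator {i0<..<i1} s * \<phi> s \<partial>lborel))"
    using i by (simp add: ennreal_mult[symmetric] abs_divide)
  also have "\<dots> \<le> ennreal (1 / (i1 - i0)) * (\<integral>\<^sup>+ s. norm (indicator {i0<..<i1} s * \<phi> s) \<partial>lborel)"
    by (intro mult_left_mono integral_norm_bound_ennreal integrable_indicator_bounded[OF _ b]) auto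
  also have "(\<integral>\<^sup>+ s. norm (indicator {i0<..<i1} s * \<phi> s) \<partial>lborel) = (\<integral>\<^sup>+ s. ennreal \<bar>\<phi> s\<bar> * indicator {i0<..<i1} s \<partial>lborel)"
    by (intro nn_integral_cong) (auto simp: indicator_def)
  finally show ?thesis .
qed

lemma row_average_measurable [measurable]:
  assumes [measurable]: "g \<in> borel_measurable borel"
  shows "row_average i0 i1 g \<in> borel_measurable borel"
proof -
  have [measurable]: "g \<in> borel_measurable (borel \<Otimes>\<^sub>M borel)" by (simp add: borel_prod)
  show ?thesis unfolding row_average_def by measurable
qed

lemma section_measurable:
  fixes g :: "real \<times> real \<Rightarrow> real"
  assumes [measurable]: "g \<in> borel_measurable borel"
  shows "(\<lambda>s. g (s, t)) \<in> borel_measurable borel" "(\<lambda>s. g (t, s)) \<in> borel_measurable borel"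
proof -
  have [measurable]: "g \<in> borel_measurable (borel \<Otimes>\<^sub>M borel)" by (simp add: borel_prod)
  show "(\<lambda>s. g (s, t)) \<in> borel_measurable borel" "(\<lambda>s. g (t, s)) \<in> borel_measurable borel"
    by measurable
qed

lemma row_average_diff:
  assumes i: "i0 < i1" and [measurable]: "g \<in> borel_measurable borel" "g' \<in> borel_measurable borel"
    and b: "\<And>x. \<bar>g x\<bar> \<le> 1" "\<And>x. \<bar>g' x\<bar> \<le> 1"
  shows "row_average i0 i1 g t - row_average i0 i1 g' t' =
     (\<integral>s. indicator {i0<..<i1} s * (g (s, t) - g' (s, t')) \<partial>lborel) / (i1 - i0)"
proof -
  note [measurable] = section_measurable
  have "(\<integral>s. indicator {i0<..<i1} s * (g (s, t) - g' (s, t')) \<partial>lborel)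
     = (\<integral>s. indicator {i0<..<i1} s * g (s, t) - indicator {i0<..<i1} s * g' (s, t') \<partial>lborel)"
    by (simp add: algebra_simps)
  also have "\<dots> = (\<integral>s. indicator {i0<..<i1} s * g (s, t) \<partial>lborel) - (\<integral>s. indicator {i0<..<i1} s * g' (s, t') \<partial>lborel)"
    by (intro Bochner_Integration.integral_diff integrable_indicator_bounded[OF _ b(1)] integrable_indicator_bounded[OF _ b(2)])
       measurable
  finally show ?thesis by (simp add: row_average_def diff_divide_distrib)
qed

text \<open>After subtraction of the row averages all variations are controlled, in \<open>t\<close> as well: the
  remainder is the average over \<open>s'\<close> of \<open>g(s, t) - g(s', t)\<close>, a difference of two columns.\<close>

lemma nearly_column_minus_average:
  assumes i: "i0 < i1" and g: "nearly_column K g"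
  defines "v \<equiv> \<lambda>x. g x - row_average i0 i1 g (snd x)"
  shows "s \<in> {i0<..<i1} \<Longrightarrow> \<bar>v (s, t)\<bar> \<le> K"
    and "h > 0 \<Longrightarrow> (\<integral>\<^sup>+ s. ennreal \<bar>v (s + h, t) - v (s, t)\<bar> \<partial>lborel) \<le> ennreal (K * h)"
    and "h > 0 \<Longrightarrow> (\<integral>\<^sup>+ t. ennreal \<bar>v (s, t + h) - v (s, t)\<bar> \<partial>lborel) \<le> ennreal (K * h)"
proof -
  have gm[measurable]: "g \<in> borel_measurable borel" and gb: "\<And>x. \<bar>g x\<bar> \<le> 1"
    and g1: "\<And>s s' t. \<bar>g (s, t) - g (s', t)\<bar> \<le> K"
    and g2: "\<And>h t. h > 0 \<Longrightarrow> (\<integral>\<^sup>+ s. ennreal \<bar>g (s + h, t) - g (s, t)\<bar> \<partial>lborel) \<le> ennreal (K * h)"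
    and g3: "\<And>h s s'. h > 0 \<Longrightarrow> (\<integral>\<^sup>+ t. ennreal \<bar>(g (s, t + h) - g (s, t)) - (g (s', t + h) - g (s', t))\<bar> \<partial>lborel)
        \<le> ennreal (K * h)"
    using g by (auto simp: nearly_column_def)
  note [measurable] = section_measurable
  have K: "0 \<le> K" using g1[of 0 0 0] by simp
  have ind: "(\<integral>\<^sup>+ s. c * indicator {i0<..<i1} s \<partial>lborel) = c * ennreal (i1 - i0)" for c
    using i by (simp add: nn_integral_cmult_indicator)
  have c1: "ennreal (1 / (i1 - i0)) * (c * ennreal (i1 - i0)) = c" for c
    using i by (simp add: mult.left_commute[of _ c] ennreal_mult[symmetric])
  have vs: "v (s, t) = (\<integral>s'. indicator {i0<..<i1} s' * (g (s, t) - g (s', t)) \<partial>lborel) / (i1 - i0)" for s t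
    unfolding v_def using row_average_diff[OF i _ gm, where g = "\<lambda>_. g (s, t)" and t = t and t' = t] gb i
    by (simp add: row_average_def)
  show "\<bar>v (s, t)\<bar> \<le> K"
  proof -
    have "ennreal \<bar>v (s, t)\<bar> \<le> ennreal (1 / (i1 - i0)) * (\<integral>\<^sup>+ s'. ennreal \<bar>g (s, t) - g (s', t)\<bar> * indicator {i0<..<i1} s' \<partial>lborel)"
      unfolding vs by (rule average_le[OF i _ g1]) measurable
    also have "\<dots> \<le> ennreal (1 / (i1 - i0)) * (\<integral>\<^sup>+ s'. ennreal K * indicator {i0<..<i1} s' \<partial>lborel)"
      by (intro mult_left_mono nn_integral_mono mult_right_mono ennreal_leI g1) auto
    also have "\<dots> = ennreal K" unfolding ind c1 ..
    finally show ?thesis using K by simp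
  qed
  show "(\<integral>\<^sup>+ s. ennreal \<bar>v (s + h, t) - v (s, t)\<bar> \<partial>lborel) \<le> ennreal (K * h)" if "h > 0"
    using g2[OF that, of t] by (simp add: v_def)
  show "(\<integral>\<^sup>+ t. ennreal \<bar>v (s, t + h) - v (s, t)\<bar> \<partial>lborel) \<le> ennreal (K * h)" if h: "h > 0"
  proof -
    let ?D = "\<lambda>s' t. (g (s, t + h) - g (s, t)) - (g (s', t + h) - g (s', t))"
    have [measurable]: "g \<in> borel_measurable (borel \<Otimes>\<^sub>M borel)" by (simp add: borel_prod)
    have Db: "\<bar>?D s' t\<bar> \<le> 4" for s' t
      using gb[of "(s, t + h)"] gb[of "(s, t)"] gb[of "(s', t + h)"] gb[of "(s', t)"] by linarith
    have "v (s, t + h) - v (s, t) = (\<integral>s'. indicator {i0<..<i1} s' * ?D s' t \<partial>lborel) / (i1 - i0)" for t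
    proof -
      have int: "integrable lborel (\<lambda>s'. indicator {i0<..<i1} s' * (g (s, t) - g (s', t)))" for t
        by (rule integrable_indicator_bounded[OF _ g1]) measurable
      have "(\<integral>s'. indicator {i0<..<i1} s' * ?D s' t \<partial>lborel) =
         (\<integral>s'. indicator {i0<..<i1} s' * (g (s, t + h) - g (s', t + h)) - indicator {i0<..<i1} s' * (g (s, t) - g (s', t)) \<partial>lborel)"
        by (intro Bochner_Integration.integral_cong) (auto simp: algebra_simps)
      also have "\<dots> = (\<integral>s'. indicator {i0<..<i1} s' * (g (s, t + h) - g (s', t + h)) \<partial>lborel) - (\<integral>s'. indicator {i0<..<i1} s' * (g (s, t) - g (s', t)) \<partial>lborel)"
        by (intro Bochner_Integration.integral_diff int)
      finally show ?thesis unfolding vs by (simp add: diff_divide_distrib)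
    qed
    then have "ennreal \<bar>v (s, t + h) - v (s, t)\<bar> \<le> ennreal (1 / (i1 - i0)) * (\<integral>\<^sup>+ s'. ennreal \<bar>?D s' t\<bar> * indicator {i0<..<i1} s' \<partial>lborel)" for t
      by (simp only:) (rule average_le[OF i _ Db], measurable)
    then have "(\<integral>\<^sup>+ t. ennreal \<bar>v (s, t + h) - v (s, t)\<bar> \<partial>lborel) \<le>
       (\<integral>\<^sup>+ t. ennreal (1 / (i1 - i0)) * (\<integral>\<^sup>+ s'. ennreal \<bar>?D s' t\<bar> * indicator {i0<..<i1} s' \<partial>lborel) \<partial>lborel)"
      by (intro nn_integral_mono)
    also have "\<dots> = ennreal (1 / (i1 - i0)) * (\<integral>\<^sup>+ t. (\<integral>\<^sup>+ s'. ennreal \<bar>?D s' t\<bar> * indicator {i0<..<i1} s' \<partial>lborel) \<partial>lborel)"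
      by (rule nn_integral_cmult) measurable
    also have "(\<integral>\<^sup>+ t. (\<integral>\<^sup>+ s'. ennreal \<bar>?D s' t\<bar> * indicator {i0<..<i1} s' \<partial>lborel) \<partial>lborel)
       = (\<integral>\<^sup>+ s'. (\<integral>\<^sup>+ t. ennreal \<bar>?D s' t\<bar> * indicator {i0<..<i1} s' \<partial>lborel) \<partial>lborel)"
      by (rule lborel_pair.Fubini') measurable
    also have "\<dots> = (\<integral>\<^sup>+ s'. (\<integral>\<^sup>+ t. ennreal \<bar>?D s' t\<bar> \<partial>lborel) * indicator {i0<..<i1} s' \<partial>lborel)"
      by (intro nn_integral_cong nn_integral_multc) measurable
    also have "\<dots> \<le> (\<integral>\<^sup>+ s'. ennreal (K * h) * indicator {i0<..<i1} s' \<partial>lborel)"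
      by (intro nn_integral_mono mult_right_mono g3 h) auto
    finally show ?thesis unfolding ind
      using c1[of "ennreal (K * h)"] by (simp add: mult_left_mono)
  qed
qed

lemma ennreal_le_of_le_add_mult:
  fixes x :: ennreal
  assumes "\<And>\<delta>. \<delta> > 0 \<Longrightarrow> x \<le> ennreal (A + \<delta> * B)" and "0 \<le> A" "0 \<le> B"
  shows "x \<le> ennreal A"
proof (rule ennreal_le_epsilon)
  fix e :: real assume e: "0 < e"
  have "x \<le> ennreal (A + e / (B + 1) * B)" using assms(3) e by (intro assms(1)) auto
  also have "\<dots> \<le> ennreal (A + e)"
    using assms(3) e by (intro ennreal_leI) (simp add: field_simps)
  finally show "x \<le> ennreal A + ennreal e" using assms(2) e by simp
qed

lemma nn_integral_indicator_translate_le: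
  fixes f :: "real \<times> real \<Rightarrow> ennreal"
  assumes [measurable]: "f \<in> borel_measurable borel" and A: "\<And>x. x \<in> A \<Longrightarrow> x + z \<in> B"
    and [measurable]: "B \<in> sets borel"
  shows "(\<integral>\<^sup>+ x. f (x + z) * indicator A x \<partial>lborel) \<le> (\<integral>\<^sup>+ x. f x * indicator B x \<partial>lborel)"
proof -
  have "(\<integral>\<^sup>+ x. f (x + z) * indicator A x \<partial>lborel) \<le> (\<integral>\<^sup>+ x. f (x + z) * indicator B (x + z) \<partial>lborel)"
    using A by (intro nn_integral_mono) (auto simp: indicator_def)
  also have "\<dots> = (\<integral>\<^sup>+ x. f x * indicator B x \<partial>lborel)"
    by (rule nn_integral_lborel_translate) measurable
  finally show ?thesis .
qed

text \<open>A difference bound passes from \<open>v'\<close> to a function \<open>v\<close> that is close to it in the mean.\<close>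

lemma nn_integral_diff_quotient_close:
  fixes v v' :: "real \<times> real \<Rightarrow> real"
  assumes [measurable]: "v \<in> borel_measurable borel" "v' \<in> borel_measurable borel"
    and A: "A \<subseteq> R" "\<And>x. x \<in> A \<Longrightarrow> x + z \<in> R"
    and [measurable]: "A \<in> sets borel" "R \<in> sets borel"
    and close: "(\<integral>\<^sup>+ x. ennreal \<bar>v x - v' x\<bar> * indicator R x \<partial>lborel) \<le> ennreal \<delta>" and \<delta>: "0 \<le> \<delta>"
    and v': "(\<integral>\<^sup>+ x. ennreal \<bar>v' (x + z) - v' x\<bar> * indicator A x \<partial>lborel) \<le> ennreal L" and L: "0 \<le> L"
  shows "(\<integral>\<^sup>+ x. ennreal \<bar>v (x + z) - v x\<bar> * indicator A x \<partial>lborel) \<le> ennreal (L + 2 * \<delta>)"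
proof -
  have "(\<integral>\<^sup>+ x. ennreal \<bar>v (x + z) - v x\<bar> * indicator A x \<partial>lborel) \<le>
     (\<integral>\<^sup>+ x. ennreal \<bar>v (x + z) - v' (x + z)\<bar> * indicator A x + (ennreal \<bar>v' (x + z) - v' x\<bar> * indicator A x
        + ennreal \<bar>v x - v' x\<bar> * indicator A x) \<partial>lborel)"
  proof (rule nn_integral_mono)
    fix x
    have "\<bar>v (x + z) - v x\<bar> \<le> \<bar>v (x + z) - v' (x + z)\<bar> + (\<bar>v' (x + z) - v' x\<bar> + \<bar>v x - v' x\<bar>)" by linarith
    then have "ennreal \<bar>v (x + z) - v x\<bar> \<le> ennreal \<bar>v (x + z) - v' (x + z)\<bar> + (ennreal \<bar>v' (x + z) - v' x\<bar> + ennreal \<bar>v x - v' x\<bar>)"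
      by (metis abs_ge_zero add_nonneg_nonneg ennreal_leI ennreal_plus)
    then show "ennreal \<bar>v (x + z) - v x\<bar> * indicator A x \<le> ennreal \<bar>v (x + z) - v' (x + z)\<bar> * indicator A x
       + (ennreal \<bar>v' (x + z) - v' x\<bar> * indicator A x + ennreal \<bar>v x - v' x\<bar> * indicator A x)"
      by (auto simp: indicator_def)
  qed
  also have "\<dots> = (\<integral>\<^sup>+ x. ennreal \<bar>v (x + z) - v' (x + z)\<bar> * indicator A x \<partial>lborel)
     + ((\<integral>\<^sup>+ x. ennreal \<bar>v' (x + z) - v' x\<bar> * indicator A x \<partial>lborel) + (\<integral>\<^sup>+ x. ennreal \<bar>v x - v' x\<bar> * indicator A x \<partial>lborel))"
    by (simp add: nn_integral_add)
  also have "\<dots> \<le> ennreal \<delta> + (ennreal L + ennreal \<delta>)"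
  proof (intro add_mono v')
    show "(\<integral>\<^sup>+ x. ennreal \<bar>v (x + z) - v' (x + z)\<bar> * indicator A x \<partial>lborel) \<le> ennreal \<delta>"
      by (rule order_trans[OF nn_integral_indicator_translate_le[of "\<lambda>x. ennreal \<bar>v x - v' x\<bar>" A z R] close])
         (use A in auto)
    show "(\<integral>\<^sup>+ x. ennreal \<bar>v x - v' x\<bar> * indicator A x \<partial>lborel) \<le> ennreal \<delta>"
      by (rule order_trans[OF nn_integral_mono close]) (use A in \<open>auto simp: indicator_def\<close>)
  qed
  also have "\<dots> = ennreal (L + 2 * \<delta>)" using L \<delta> by (simp add: ennreal_plus[symmetric] del: ennreal_plus)
  finally show ?thesis .
qed

lemma row_average_snd_measurable:
  assumes [measurable]: "g \<in> borel_measurable borel"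
  shows "(\<lambda>x::'a::topological_space \<times> real. row_average i0 i1 g (snd x)) \<in> borel_measurable borel"
  by (rule measurable_compose[OF _ row_average_measurable])
     (auto intro!: borel_measurable_continuous_onI continuous_intros assms)

text \<open>Subtracting row averages at most doubles the mean distance.\<close>

lemma row_average_close:
  assumes i: "i0 < i1" and [measurable]: "g \<in> borel_measurable borel" "w \<in> borel_measurable borel"
    and b: "\<And>x. \<bar>g x\<bar> \<le> 1" "\<And>x. \<bar>w x\<bar> \<le> 1"
    and close: "(\<integral>\<^sup>+ x. ennreal \<bar>g x - w x\<bar> * indicator ({i0<..<i1} \<times> {j0<..<j1}) x \<partial>lborel) \<le> ennreal \<delta>"
    and \<delta>: "0 \<le> \<delta>"
  shows "(\<integral>\<^sup>+ x. ennreal \<bar>(w x - row_average i0 i1 w (snd x)) - (g x - row_average i0 i1 g (snd x))\<bar>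
            * indicator ({i0<..<i1} \<times> {j0<..<j1}) x \<partial>lborel) \<le> ennreal (2 * \<delta>)"
proof -
  let ?R = "{i0<..<i1} \<times> {j0<..<j1}"
  note [measurable] = section_measurable
  have [measurable]: "g \<in> borel_measurable (borel \<Otimes>\<^sub>M borel)" "w \<in> borel_measurable (borel \<Otimes>\<^sub>M borel)"
    by (simp_all add: borel_prod)
  have [measurable]: "(\<lambda>x. row_average i0 i1 w (snd x)) \<in> borel_measurable borel"
     "(\<lambda>x. row_average i0 i1 g (snd x)) \<in> borel_measurable borel"
    by (rule row_average_snd_measurable; measurable)+
  have R[measurable]: "?R \<in> sets borel" by (intro borel_open open_Times) auto
  have I: "indicator ?R (s, t) = (indicator {i0<..<i1} s * indicator {j0<..<j1} t :: ennreal)" for s t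
    by (auto simp: indicator_def)
  have pair: "(\<integral>\<^sup>+ x. ennreal \<bar>g x - w x\<bar> * indicator ?R x \<partial>lborel) =
     (\<integral>\<^sup>+ t. (\<integral>\<^sup>+ s. ennreal \<bar>g (s, t) - w (s, t)\<bar> * indicator {i0<..<i1} s \<partial>lborel) * indicator {j0<..<j1} t \<partial>lborel)"
    by (subst nn_integral_lborel_pair(2)) (auto simp: I nn_integral_multc[symmetric] mult.assoc)
  have avg: "ennreal \<bar>row_average i0 i1 g t - row_average i0 i1 w t\<bar> \<le>
     ennreal (1 / (i1 - i0)) * (\<integral>\<^sup>+ s. ennreal \<bar>g (s, t) - w (s, t)\<bar> * indicator {i0<..<i1} s \<partial>lborel)" for t
  proof -
    have "\<bar>g x - w x\<bar> \<le> 2" for x using b(1)[of x] b(2)[of x] by linarith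
    then show ?thesis
      unfolding row_average_diff[OF i assms(2,3) b] by (intro average_le[OF i]) auto
  qed
  have "(\<integral>\<^sup>+ x. ennreal \<bar>row_average i0 i1 g (snd x) - row_average i0 i1 w (snd x)\<bar> * indicator ?R x \<partial>lborel)
     = (\<integral>\<^sup>+ t. (\<integral>\<^sup>+ s. ennreal \<bar>row_average i0 i1 g t - row_average i0 i1 w t\<bar> * indicator {j0<..<j1} t * indicator {i0<..<i1} s \<partial>lborel) \<partial>lborel)"
    by (subst nn_integral_lborel_pair(2)) (auto simp: I ac_simps)
  also have "\<dots> = (\<integral>\<^sup>+ t. ennreal \<bar>row_average i0 i1 g t - row_average i0 i1 w t\<bar> * indicator {j0<..<j1} t * ennreal (i1 - i0) \<partial>lborel)"
    using i by (simp add: nn_integral_cmult_indicator)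
  also have "\<dots> \<le> (\<integral>\<^sup>+ t. (ennreal (1 / (i1 - i0)) * (\<integral>\<^sup>+ s. ennreal \<bar>g (s, t) - w (s, t)\<bar> * indicator {i0<..<i1} s \<partial>lborel)) * indicator {j0<..<j1} t * ennreal (i1 - i0) \<partial>lborel)"
    by (intro nn_integral_mono mult_right_mono avg) auto
  also have "\<dots> = (\<integral>\<^sup>+ x. ennreal \<bar>g x - w x\<bar> * indicator ?R x \<partial>lborel)"
  proof -
    have c1: "ennreal (1 / (i1 - i0)) * c * d * ennreal (i1 - i0) = c * d" for c d
    proof -
      have "ennreal (1 / (i1 - i0)) * c * d * ennreal (i1 - i0) = (ennreal (1 / (i1 - i0)) * ennreal (i1 - i0)) * (c * d)"
        by (simp add: ac_simps)
      also have "ennreal (1 / (i1 - i0)) * ennreal (i1 - i0) = 1" using i by (simp add: ennreal_mult[symmetric])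
      finally show ?thesis by simp
    qed
    show ?thesis unfolding pair c1 ..
  qed
  also note close
  finally have a: "(\<integral>\<^sup>+ x. ennreal \<bar>row_average i0 i1 g (snd x) - row_average i0 i1 w (snd x)\<bar> * indicator ?R x \<partial>lborel) \<le> ennreal \<delta>" .
  have "(\<integral>\<^sup>+ x. ennreal \<bar>(w x - row_average i0 i1 w (snd x)) - (g x - row_average i0 i1 g (snd x))\<bar> * indicator ?R x \<partial>lborel)
    \<le> (\<integral>\<^sup>+ x. ennreal \<bar>g x - w x\<bar> * indicator ?R x + ennreal \<bar>row_average i0 i1 g (snd x) - row_average i0 i1 w (snd x)\<bar> * indicator ?R x \<partial>lborel)"
  proof (rule nn_integral_mono)
    fix x :: "real \<times> real"
    have "\<bar>(w x - row_average i0 i1 w (snd x)) - (g x - row_average i0 i1 g (snd x))\<bar> \<le> \<bar>g x - w x\<bar> + \<bar>row_average i0 i1 g (snd x) - row_average i0 i1 w (snd x)\<bar>"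
      by linarith
    then have "ennreal \<bar>(w x - row_average i0 i1 w (snd x)) - (g x - row_average i0 i1 g (snd x))\<bar> \<le> ennreal \<bar>g x - w x\<bar> + ennreal \<bar>row_average i0 i1 g (snd x) - row_average i0 i1 w (snd x)\<bar>"
      by (metis abs_ge_zero ennreal_leI ennreal_plus)
    then show "ennreal \<bar>(w x - row_average i0 i1 w (snd x)) - (g x - row_average i0 i1 g (snd x))\<bar> * indicator ?R x \<le>
      ennreal \<bar>g x - w x\<bar> * indicator ?R x + ennreal \<bar>row_average i0 i1 g (snd x) - row_average i0 i1 w (snd x)\<bar> * indicator ?R x"
      by (auto simp: indicator_def)
  qed
  also have "\<dots> = (\<integral>\<^sup>+ x. ennreal \<bar>g x - w x\<bar> * indicator ?R x \<partial>lborel) + (\<integral>\<^sup>+ x. ennreal \<bar>row_average i0 i1 g (snd x) - row_average i0 i1 w (snd x)\<bar> * indicator ?R x \<partial>lborel)"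
    by (rule nn_integral_add) measurable
  also have "\<dots> \<le> ennreal \<delta> + ennreal \<delta>" by (intro add_mono close a)
  also have "\<dots> = ennreal (2 * \<delta>)" using \<delta> by (simp add: ennreal_plus[symmetric] del: ennreal_plus)
  finally show ?thesis .
qed

text \<open>If \<open>w\<close> is a limit in the mean of nearly column functions with constants tending to \<open>K\<close>, then \<open>w\<close> minus its row average
  is bounded by \<open>K\<close> and satisfies difference bounds in both directions.\<close>

lemma limit_of_nearly_column:
  fixes w :: "real \<times> real \<Rightarrow> real"
  assumes i: "i0 < i1" and j: "j0 < j1" and wm[measurable]: "w \<in> borel_measurable borel" and wb: "\<And>x. \<bar>w x\<bar> \<le> 1"
    and K: "0 \<le> K"
    and approx: "\<And>\<delta>. \<delta> > 0 \<Longrightarrow> \<exists>g. nearly_column (K + \<delta>) g \<and>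
       (\<integral>\<^sup>+ x. ennreal \<bar>g x - w x\<bar> * indicator ({i0<..<i1} \<times> {j0<..<j1}) x \<partial>lborel) \<le> ennreal \<delta>"
  defines "v \<equiv> \<lambda>x. w x - row_average i0 i1 w (snd x)"
  shows "v \<in> borel_measurable borel"
    and "AE x in lborel. x \<in> {i0<..<i1} \<times> {j0<..<j1} \<longrightarrow> \<bar>v x\<bar> \<le> K"
    and "h > 0 \<Longrightarrow> (\<integral>\<^sup>+ x. ennreal \<bar>v (x + (h, 0)) - v x\<bar> * indicator ({i0<..<i1-h} \<times> {j0<..<j1}) x \<partial>lborel)
       \<le> ennreal (K * (j1 - j0) * h)"
    and "h > 0 \<Longrightarrow> (\<integral>\<^sup>+ x. ennreal \<bar>v (x + (0, h)) - v x\<bar> * indicator ({i0<..<i1} \<times> {j0<..<j1-h}) x \<partial>lborel)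
       \<le> ennreal (K * (i1 - i0) * h)"
proof -
  let ?R = "{i0<..<i1} \<times> {j0<..<j1}"
  let ?v = "\<lambda>g x. g x - row_average i0 i1 g (snd x)"
  have vm0: "?v g \<in> borel_measurable borel" if [measurable]: "g \<in> borel_measurable borel" for g
  proof -
    have [measurable]: "(\<lambda>x. row_average i0 i1 g (snd x)) \<in> borel_measurable borel"
      by (rule row_average_snd_measurable) measurable
    show ?thesis by measurable
  qed
  show vm[measurable]: "v \<in> borel_measurable borel" unfolding v_def by (rule vm0) measurable
  have R[measurable]: "{a<..<b} \<times> {c<..<d} \<in> sets (borel :: (real \<times> real) measure)" for a b c d
    by (intro borel_open open_Times) auto
  have mR: "emeasure lborel ?R = ennreal ((i1 - i0) * (j1 - j0))"
    using i j by (subst lborel_prod[symmetric], subst lborel.emeasure_pair_measure_Times) (auto simp: ennreal_mult)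
  have I: "indicator ({a<..<b} \<times> {c<..<d}) (s, t) = (indicator {a<..<b} s * indicator {c<..<d} t :: ennreal)" for s t a b c d :: real
    by (auto simp: indicator_def)
  have cl: "(\<integral>\<^sup>+ x. ennreal \<bar>v x - ?v g x\<bar> * indicator ?R x \<partial>lborel) \<le> ennreal (2 * \<delta>)"
    if "\<delta> > 0" "nearly_column (K + \<delta>) g" "(\<integral>\<^sup>+ x. ennreal \<bar>g x - w x\<bar> * indicator ?R x \<partial>lborel) \<le> ennreal \<delta>" for \<delta> g
    unfolding v_def using that by (intro row_average_close[OF i _ wm _ wb]) (auto simp: nearly_column_def)
  \<comment> \<open>\<open>ennreal\<close> truncates at 0, so this is the integral of the positive part of \<open>\<bar>v\<bar> - K\<close>.\<close>
  have "(\<integral>\<^sup>+ x. ennreal (\<bar>v x\<bar> - K) * indicator ?R x \<partial>lborel) \<le> ennreal 0"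
  proof (rule ennreal_le_of_le_add_mult[where B = "2 + (i1 - i0) * (j1 - j0)"])
    fix \<delta> :: real assume \<delta>: "\<delta> > 0"
    obtain g where g: "nearly_column (K + \<delta>) g" "(\<integral>\<^sup>+ x. ennreal \<bar>g x - w x\<bar> * indicator ?R x \<partial>lborel) \<le> ennreal \<delta>"
      using approx[OF \<delta>] by blast
    have [measurable]: "?v g \<in> borel_measurable borel" using g(1) by (intro vm0) (simp add: nearly_column_def)
    have "(\<integral>\<^sup>+ x. ennreal (\<bar>v x\<bar> - K) * indicator ?R x \<partial>lborel) \<le>
       (\<integral>\<^sup>+ x. ennreal \<bar>v x - ?v g x\<bar> * indicator ?R x + ennreal \<delta> * indicator ?R x \<partial>lborel)"
    proof (rule nn_integral_mono)
      fix x :: "real \<times> real"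
      show "ennreal (\<bar>v x\<bar> - K) * indicator ?R x \<le> ennreal \<bar>v x - ?v g x\<bar> * indicator ?R x + ennreal \<delta> * indicator ?R x"
      proof (cases "x \<in> ?R")
        case True
        have "\<bar>?v g x\<bar> \<le> K + \<delta>"
          using nearly_column_minus_average(1)[OF i g(1), of "fst x" "snd x"] True by (auto simp: mem_Times_iff)
        then have "\<bar>v x\<bar> - K \<le> \<bar>v x - ?v g x\<bar> + \<delta>" by linarith
        then have "ennreal (\<bar>v x\<bar> - K) \<le> ennreal \<bar>v x - ?v g x\<bar> + ennreal \<delta>"
          using \<delta> by (metis abs_ge_zero ennreal_leI ennreal_plus less_imp_le)
        then show ?thesis using True by simp
      qed simp
    qed
    also have "\<dots> = (\<integral>\<^sup>+ x. ennreal \<bar>v x - ?v g x\<bar> * indicator ?R x \<partial>lborel) + ennreal \<delta> * emeasure lborel ?R"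
      by (subst nn_integral_add) (auto simp: nn_integral_cmult_indicator)
    also have "\<dots> \<le> ennreal (2 * \<delta>) + ennreal \<delta> * emeasure lborel ?R"
      by (intro add_mono cl[OF \<delta> g]) auto
    also have "\<dots> = ennreal (0 + \<delta> * (2 + (i1 - i0) * (j1 - j0)))"
      unfolding mR using \<delta> i j
      by (subst ennreal_mult[symmetric], simp, simp, subst ennreal_plus[symmetric], simp, simp) (simp add: algebra_simps)
    finally show "(\<integral>\<^sup>+ x. ennreal (\<bar>v x\<bar> - K) * indicator ?R x \<partial>lborel) \<le> ennreal (0 + \<delta> * (2 + (i1 - i0) * (j1 - j0)))" .
  qed (use i j in auto)
  then have "(\<integral>\<^sup>+ x. ennreal (\<bar>v x\<bar> - K) * indicator ?R x \<partial>lborel) = 0" by simp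
  then have "AE x in lborel. ennreal (\<bar>v x\<bar> - K) * indicator ?R x = 0"
    by (subst (asm) nn_integral_0_iff_AE) auto
  then show "AE x in lborel. x \<in> ?R \<longrightarrow> \<bar>v x\<bar> \<le> K"
    by eventually_elim (auto simp: ennreal_eq_0_iff)
  show "(\<integral>\<^sup>+ x. ennreal \<bar>v (x + (h, 0)) - v x\<bar> * indicator ({i0<..<i1-h} \<times> {j0<..<j1}) x \<partial>lborel)
       \<le> ennreal (K * (j1 - j0) * h)" if h: "h > 0"
  proof (rule ennreal_le_of_le_add_mult[where B = "(j1 - j0) * h + 4"])
    fix \<delta> :: real assume \<delta>: "\<delta> > 0"
    obtain g where g: "nearly_column (K + \<delta>) g" "(\<integral>\<^sup>+ x. ennreal \<bar>g x - w x\<bar> * indicator ?R x \<partial>lborel) \<le> ennreal \<delta>"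
      using approx[OF \<delta>] by blast
    have gm[measurable]: "?v g \<in> borel_measurable borel" using g(1) by (intro vm0) (simp add: nearly_column_def)
    have "(\<integral>\<^sup>+ x. ennreal \<bar>?v g (x + (h, 0)) - ?v g x\<bar> * indicator ({i0<..<i1-h} \<times> {j0<..<j1}) x \<partial>lborel) =
       (\<integral>\<^sup>+ t. \<integral>\<^sup>+ s. ennreal \<bar>?v g (s + h, t) - ?v g (s, t)\<bar> * indicator ({i0<..<i1-h} \<times> {j0<..<j1}) (s, t) \<partial>lborel \<partial>lborel)"
      by (subst nn_integral_lborel_pair(2)) (measurable, auto intro!: open_Times)
    also have "\<dots> \<le> (\<integral>\<^sup>+ t. (\<integral>\<^sup>+ s. ennreal \<bar>?v g (s + h, t) - ?v g (s, t)\<bar> \<partial>lborel) * indicator {j0<..<j1} t \<partial>lborel)"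
      by (intro nn_integral_mono) (auto simp: indicator_def intro!: nn_integral_mono)
    also have "\<dots> \<le> (\<integral>\<^sup>+ t. ennreal ((K + \<delta>) * h) * indicator {j0<..<j1} t \<partial>lborel)"
      by (intro nn_integral_mono mult_right_mono nearly_column_minus_average(2)[OF i g(1) h]) auto
    also have "\<dots> = ennreal ((K + \<delta>) * h * (j1 - j0))"
      using j K \<delta> h by (simp add: nn_integral_cmult_indicator ennreal_mult)
    finally have "(\<integral>\<^sup>+ x. ennreal \<bar>?v g (x + (h, 0)) - ?v g x\<bar> * indicator ({i0<..<i1-h} \<times> {j0<..<j1}) x \<partial>lborel) \<le> ennreal ((K + \<delta>) * h * (j1 - j0))" .
    moreover have "{i0<..<i1-h} \<times> {j0<..<j1} \<subseteq> ?R" using h by auto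
    ultimately have "(\<integral>\<^sup>+ x. ennreal \<bar>v (x + (h, 0)) - v x\<bar> * indicator ({i0<..<i1-h} \<times> {j0<..<j1}) x \<partial>lborel)
      \<le> ennreal ((K + \<delta>) * h * (j1 - j0) + 2 * (2 * \<delta>))"
      using \<delta> h K j by (intro nn_integral_diff_quotient_close[OF vm gm _ _ _ _ cl[OF \<delta> g]]) auto
    then show "(\<integral>\<^sup>+ x. ennreal \<bar>v (x + (h, 0)) - v x\<bar> * indicator ({i0<..<i1-h} \<times> {j0<..<j1}) x \<partial>lborel)
      \<le> ennreal (K * (j1 - j0) * h + \<delta> * ((j1 - j0) * h + 4))"
      by (simp add: algebra_simps)
  qed (use h j K in auto)
  show "(\<integral>\<^sup>+ x. ennreal \<bar>v (x + (0, h)) - v x\<bar> * indicator ({i0<..<i1} \<times> {j0<..<j1-h}) x \<partial>lborel)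
       \<le> ennreal (K * (i1 - i0) * h)" if h: "h > 0"
  proof (rule ennreal_le_of_le_add_mult[where B = "(i1 - i0) * h + 4"])
    fix \<delta> :: real assume \<delta>: "\<delta> > 0"
    obtain g where g: "nearly_column (K + \<delta>) g" "(\<integral>\<^sup>+ x. ennreal \<bar>g x - w x\<bar> * indicator ?R x \<partial>lborel) \<le> ennreal \<delta>"
      using approx[OF \<delta>] by blast
    have gm[measurable]: "?v g \<in> borel_measurable borel" using g(1) by (intro vm0) (simp add: nearly_column_def)
    have "(\<integral>\<^sup>+ x. ennreal \<bar>?v g (x + (0, h)) - ?v g x\<bar> * indicator ({i0<..<i1} \<times> {j0<..<j1-h}) x \<partial>lborel) =
       (\<integral>\<^sup>+ s. \<integral>\<^sup>+ t. ennreal \<bar>?v g (s, t + h) - ?v g (s, t)\<bar> * indicator ({i0<..<i1} \<times> {j0<..<j1-h}) (s, t) \<partial>lborel \<partial>lborel)"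
      by (subst nn_integral_lborel_pair(1)) (measurable, auto intro!: open_Times)
    also have "\<dots> \<le> (\<integral>\<^sup>+ s. (\<integral>\<^sup>+ t. ennreal \<bar>?v g (s, t + h) - ?v g (s, t)\<bar> \<partial>lborel) * indicator {i0<..<i1} s \<partial>lborel)"
      by (intro nn_integral_mono) (auto simp: indicator_def intro!: nn_integral_mono)
    also have "\<dots> \<le> (\<integral>\<^sup>+ s. ennreal ((K + \<delta>) * h) * indicator {i0<..<i1} s \<partial>lborel)"
      by (intro nn_integral_mono mult_right_mono nearly_column_minus_average(3)[OF i g(1) h]) auto
    also have "\<dots> = ennreal ((K + \<delta>) * h * (i1 - i0))"
      using i K \<delta> h by (simp add: nn_integral_cmult_indicator ennreal_mult)
    finally have "(\<integral>\<^sup>+ x. ennreal \<bar>?v g (x + (0, h)) - ?v g x\<bar> * indicator ({i0<..<i1} \<times> {j0<..<j1-h}) x \<partial>lborel) \<le> ennreal ((K + \<delta>) * h * (i1 - i0))" .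
    moreover have "{i0<..<i1} \<times> {j0<..<j1-h} \<subseteq> ?R" using h by auto
    ultimately have "(\<integral>\<^sup>+ x. ennreal \<bar>v (x + (0, h)) - v x\<bar> * indicator ({i0<..<i1} \<times> {j0<..<j1-h}) x \<partial>lborel)
      \<le> ennreal ((K + \<delta>) * h * (i1 - i0) + 2 * (2 * \<delta>))"
      using \<delta> h K i by (intro nn_integral_diff_quotient_close[OF vm gm _ _ _ _ cl[OF \<delta> g]]) auto
    then show "(\<integral>\<^sup>+ x. ennreal \<bar>v (x + (0, h)) - v x\<bar> * indicator ({i0<..<i1} \<times> {j0<..<j1-h}) x \<partial>lborel)
      \<le> ennreal (K * (i1 - i0) * h + \<delta> * ((i1 - i0) * h + 4))"
      by (simp add: algebra_simps)
  qed (use h i K in auto)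
qed

section \<open>Sampling a function on a randomly shifted grid\<close>

lemma abs_diff_le_sum:
  fixes \<phi> :: "nat \<Rightarrow> real"
  assumes "m \<le> N" "n \<le> N"
  shows "\<bar>\<phi> n - \<phi> m\<bar> \<le> (\<Sum>l<N. \<bar>\<phi> (Suc l) - \<phi> l\<bar>)"
proof -
  have *: "\<bar>\<phi> n - \<phi> m\<bar> \<le> (\<Sum>l<N. \<bar>\<phi> (Suc l) - \<phi> l\<bar>)" if "m \<le> n" "n \<le> N" for m n
  proof -
    have "\<bar>\<phi> n - \<phi> m\<bar> \<le> (\<Sum>l\<in>{m..<n}. \<bar>\<phi> (Suc l) - \<phi> l\<bar>)"
      using that(1)
    proof (induction n rule: dec_induct)
      case (step n)
      have "\<bar>\<phi> (Suc n) - \<phi> m\<bar> \<le> \<bar>\<phi> n - \<phi> m\<bar> + \<bar>\<phi> (Suc n) - \<phi> n\<bar>" by linarith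
      then show ?case using step by simp
    qed simp
    also have "\<dots> \<le> (\<Sum>l<N. \<bar>\<phi> (Suc l) - \<phi> l\<bar>)"
      by (rule sum_mono2) (use that in auto)
    finally show ?thesis .
  qed
  show ?thesis
    using *[of m n] *[of n m] assms by (cases "m \<le> n") (auto simp: abs_minus_commute)
qed

lemma mono_nat_measurable:
  fixes i :: "real \<Rightarrow> nat"
  assumes "mono i"
  shows "i \<in> measurable borel (count_space UNIV)"
proof -
  have [measurable]: "(\<lambda>s. real (i s)) \<in> borel_measurable borel"
    by (rule borel_measurable_mono) (use assms in \<open>auto simp: mono_def\<close>)
  have "i -` {k} \<in> sets borel" for k
  proof -
    have "i -` {k} = {s \<in> space borel. real (i s) = real k}" by auto
    also have "\<dots> \<in> sets borel" by measurable
    finally show ?thesis .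
  qed
  then show ?thesis by (subst measurable_count_space_eq2_countable) auto
qed

text \<open>A grid function with small variation along rows and small total mixed variation, extended as a step
  function through monotone index maps \<open>i\<close> and \<open>j\<close>.\<close>

lemma nearly_column_step:
  fixes U :: "nat \<Rightarrow> nat \<Rightarrow> real"
  assumes U: "\<And>k l. \<bar>U k l\<bar> \<le> 1"
    and i: "mono i" "\<And>s. i s \<le> N" and j: "mono j" "\<And>t. j t \<le> M"
    and row: "\<forall>l\<le>M. (\<Sum>k<N. \<bar>U (Suc k) l - U k l\<bar>) \<le> K"
    and mix: "(\<Sum>k<N. \<Sum>l<M. \<bar>mixed_diff U k l\<bar>) \<le> K"
  shows "nearly_column K (\<lambda>x. U (i (fst x)) (j (snd x)))"
  unfolding nearly_column_def
proof (intro conjI allI impI)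
  have [measurable]: "i \<in> measurable borel (count_space UNIV)" "j \<in> measurable borel (count_space UNIV)"
    using i j by (auto intro: mono_nat_measurable)
  have [measurable]: "(\<lambda>x::real \<times> real. i (fst x)) \<in> measurable borel (count_space UNIV)"
      "(\<lambda>x::real \<times> real. j (snd x)) \<in> measurable borel (count_space UNIV)"
    by (simp_all add: borel_prod[symmetric])
  show "(\<lambda>x. U (i (fst x)) (j (snd x))) \<in> borel_measurable borel" by measurable
  show "\<bar>U (i (fst x)) (j (snd x))\<bar> \<le> 1" for x by (rule U)
  show "\<bar>U (i (fst (s, t))) (j (snd (s, t))) - U (i (fst (s', t))) (j (snd (s', t)))\<bar> \<le> K" for s s' t
    unfolding fst_conv snd_conv
    by (rule order_trans[OF abs_diff_le_sum[of _ N _ "\<lambda>k. U k (j t)"]])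
       (use i(2) row[rule_format, OF j(2)] in auto)
  show "(\<integral>\<^sup>+ s. ennreal \<bar>U (i (fst (s + h, t))) (j (snd (s + h, t))) - U (i (fst (s, t))) (j (snd (s, t)))\<bar> \<partial>lborel) \<le> ennreal (K * h)"
    if "h > 0" for h t
  proof -
    have "(\<integral>\<^sup>+ s. ennreal \<bar>U (i (s + h)) (j t) - U (i s) (j t)\<bar> \<partial>lborel) \<le> ennreal (h * (\<Sum>k<N. \<bar>U (Suc k) (j t) - U k (j t)\<bar>))"
      by (rule nn_integral_step_shift_le[OF i that])
    also have "\<dots> \<le> ennreal (K * h)"
      using row j(2) that by (intro ennreal_leI) (simp add: mult.commute mult_left_mono)
    finally show ?thesis by simp
  qed
  show "(\<integral>\<^sup>+ t. ennreal \<bar>U (i (fst (s, t + h))) (j (snd (s, t + h))) - U (i (fst (s, t))) (j (snd (s, t)))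
      - (U (i (fst (s', t + h))) (j (snd (s', t + h))) - U (i (fst (s', t))) (j (snd (s', t))))\<bar> \<partial>lborel) \<le> ennreal (K * h)"
    if "h > 0" for h s s'
  proof -
    let ?\<phi> = "\<lambda>l. U (i s) l - U (i s') l"
    have le: "\<bar>?\<phi> (Suc l) - ?\<phi> l\<bar> \<le> (\<Sum>k<N. \<bar>mixed_diff U k l\<bar>)" for l
    proof -
      have "\<bar>?\<phi> (Suc l) - ?\<phi> l\<bar> = \<bar>(U (i s) (Suc l) - U (i s) l) - (U (i s') (Suc l) - U (i s') l)\<bar>"
        by (simp add: algebra_simps)
      also have "\<dots> \<le> (\<Sum>k<N. \<bar>(U (Suc k) (Suc l) - U (Suc k) l) - (U k (Suc l) - U k l)\<bar>)"
        using abs_diff_le_sum[of "i s'" N "i s" "\<lambda>k. U k (Suc l) - U k l"] i by simp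
      also have "\<dots> = (\<Sum>k<N. \<bar>mixed_diff U k l\<bar>)"
        by (intro sum.cong) (auto simp: mixed_diff_def algebra_simps)
      finally show ?thesis .
    qed
    have "(\<integral>\<^sup>+ t. ennreal \<bar>?\<phi> (j (t + h)) - ?\<phi> (j t)\<bar> \<partial>lborel) \<le> ennreal (h * (\<Sum>l<M. \<bar>?\<phi> (Suc l) - ?\<phi> l\<bar>))"
      by (rule nn_integral_step_shift_le[OF j that])
    also have "\<dots> \<le> ennreal (h * (\<Sum>l<M. \<Sum>k<N. \<bar>mixed_diff U k l\<bar>))"
      using that by (intro ennreal_leI mult_left_mono sum_mono le) auto
    also have "(\<Sum>l<M. \<Sum>k<N. \<bar>mixed_diff U k l\<bar>) = (\<Sum>k<N. \<Sum>l<M. \<bar>mixed_diff U k l\<bar>)" by (rule sum.swap)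
    also have "ennreal (h * \<dots>) \<le> ennreal (K * h)"
      using mix that by (intro ennreal_leI) (simp add: mult.commute mult_left_mono)
    finally show ?thesis by (simp add: algebra_simps)
  qed
qed

text \<open>Integrating over the offset of a grid the sum over the grid points is integrating over the interval
  that the grid covers.\<close>

lemma nn_integral_unfold_grid_1:
  fixes f :: "real \<Rightarrow> ennreal"
  assumes [measurable]: "f \<in> borel_measurable borel" and a: "a > 0"
  shows "(\<integral>\<^sup>+ \<sigma>. (\<Sum>k\<le>N. f (A + \<sigma> + real k * a)) * indicator {0..<a} \<sigma> \<partial>lborel)
     = (\<integral>\<^sup>+ s. f s * indicator {A..<A + real (Suc N) * a} s \<partial>lborel)"
proof -
  have ind: "(\<Sum>k\<le>N. indicator {A + real k * a..<A + real (Suc k) * a} s) = (indicator {A..<A + real (Suc N) * a} s :: ennreal)" for s N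
  proof (induction N)
    case (Suc N)
    have "A \<le> A + real (Suc N) * a" "A + real (Suc N) * a \<le> A + real (Suc (Suc N)) * a"
      using a by (auto simp: algebra_simps)
    then show ?case using Suc by (auto simp: indicator_def not_le not_less)
  qed simp
  have "(\<integral>\<^sup>+ \<sigma>. (\<Sum>k\<le>N. f (A + \<sigma> + real k * a)) * indicator {0..<a} \<sigma> \<partial>lborel)
     = (\<integral>\<^sup>+ \<sigma>. (\<Sum>k\<le>N. f (\<sigma> + (A + real k * a)) * indicator {A + real k * a..<A + real (Suc k) * a} (\<sigma> + (A + real k * a))) \<partial>lborel)"
    by (intro nn_integral_cong) (auto simp: sum_distrib_right indicator_def algebra_simps)
  also have "\<dots> = (\<Sum>k\<le>N. \<integral>\<^sup>+ \<sigma>. f (\<sigma> + (A + real k * a)) * indicator {A + real k * a..<A + real (Suc k) * a} (\<sigma> + (A + real k * a)) \<partial>lborel)"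
    by (rule nn_integral_sum) measurable
  also have "\<dots> = (\<Sum>k\<le>N. \<integral>\<^sup>+ s. f s * indicator {A + real k * a..<A + real (Suc k) * a} s \<partial>lborel)"
    by (intro sum.cong refl nn_integral_lborel_translate) measurable
  also have "\<dots> = (\<integral>\<^sup>+ s. (\<Sum>k\<le>N. f s * indicator {A + real k * a..<A + real (Suc k) * a} s) \<partial>lborel)"
    by (rule nn_integral_sum[symmetric]) measurable
  also have "\<dots> = (\<integral>\<^sup>+ s. f s * indicator {A..<A + real (Suc N) * a} s \<partial>lborel)"
    by (simp only: sum_distrib_left[symmetric] ind)
  finally show ?thesis .
qed

lemma nn_integral_unfold_grid:
  fixes F :: "real \<times> real \<Rightarrow> ennreal"
  assumes [measurable]: "F \<in> borel_measurable borel" and a: "a > 0" "b > 0"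
  shows "(\<integral>\<^sup>+ \<sigma>. \<integral>\<^sup>+ \<tau>. (\<Sum>k\<le>N. \<Sum>l\<le>M. F (A + \<sigma> + real k * a, B + \<tau> + real l * b)) * indicator {0..<b} \<tau> * indicator {0..<a} \<sigma> \<partial>lborel \<partial>lborel)
     = (\<integral>\<^sup>+ x. F x * indicator ({A..<A + real (Suc N) * a} \<times> {B..<B + real (Suc M) * b}) x \<partial>lborel)"
proof -
  have [measurable]: "F \<in> borel_measurable (borel \<Otimes>\<^sub>M borel)" by (simp add: borel_prod)
  have [measurable]: "{A..<A + real (Suc N) * a} \<times> {B..<B + real (Suc M) * b} \<in> sets borel"
    by (simp add: borel_prod[symmetric])
  let ?G = "\<lambda>s. \<integral>\<^sup>+ t. F (s, t) * indicator {B..<B + real (Suc M) * b} t \<partial>lborel"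
  have "(\<integral>\<^sup>+ \<sigma>. \<integral>\<^sup>+ \<tau>. (\<Sum>k\<le>N. \<Sum>l\<le>M. F (A + \<sigma> + real k * a, B + \<tau> + real l * b)) * indicator {0..<b} \<tau> * indicator {0..<a} \<sigma> \<partial>lborel \<partial>lborel)
     = (\<integral>\<^sup>+ \<sigma>. (\<Sum>k\<le>N. \<integral>\<^sup>+ \<tau>. (\<Sum>l\<le>M. F (A + \<sigma> + real k * a, B + \<tau> + real l * b)) * indicator {0..<b} \<tau> \<partial>lborel) * indicator {0..<a} \<sigma> \<partial>lborel)"
  proof (intro nn_integral_cong)
    fix \<sigma> :: real
    let ?f = "\<lambda>k \<tau>. \<Sum>l\<le>M. F (A + \<sigma> + real k * a, B + \<tau> + real l * b)"
    have "(\<integral>\<^sup>+ \<tau>. (\<Sum>k\<le>N. ?f k \<tau>) * indicator {0..<b} \<tau> * indicator {0..<a} \<sigma> \<partial>lborel)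
       = (\<integral>\<^sup>+ \<tau>. (\<Sum>k\<le>N. ?f k \<tau>) * indicator {0..<b} \<tau> \<partial>lborel) * indicator {0..<a} \<sigma>"
      by (rule nn_integral_multc) measurable
    also have "(\<integral>\<^sup>+ \<tau>. (\<Sum>k\<le>N. ?f k \<tau>) * indicator {0..<b} \<tau> \<partial>lborel)
       = (\<integral>\<^sup>+ \<tau>. (\<Sum>k\<le>N. ?f k \<tau> * indicator {0..<b} \<tau>) \<partial>lborel)"
      by (simp only: sum_distrib_right)
    also have "\<dots> = (\<Sum>k\<le>N. \<integral>\<^sup>+ \<tau>. ?f k \<tau> * indicator {0..<b} \<tau> \<partial>lborel)"
      by (rule nn_integral_sum) measurable
    finally show "(\<integral>\<^sup>+ \<tau>. (\<Sum>k\<le>N. ?f k \<tau>) * indicator {0..<b} \<tau> * indicator {0..<a} \<sigma> \<partial>lborel)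
       = (\<Sum>k\<le>N. \<integral>\<^sup>+ \<tau>. ?f k \<tau> * indicator {0..<b} \<tau> \<partial>lborel) * indicator {0..<a} \<sigma>" .
  qed
  also have "\<dots> = (\<integral>\<^sup>+ \<sigma>. (\<Sum>k\<le>N. ?G (A + \<sigma> + real k * a)) * indicator {0..<a} \<sigma> \<partial>lborel)"
    by (intro nn_integral_cong arg_cong2[where f = "(*)"] sum.cong refl nn_integral_unfold_grid_1 a) measurable
  also have "\<dots> = (\<integral>\<^sup>+ s. ?G s * indicator {A..<A + real (Suc N) * a} s \<partial>lborel)"
    by (intro nn_integral_unfold_grid_1 a) measurable
  also have "\<dots> = (\<integral>\<^sup>+ s. \<integral>\<^sup>+ t. F (s, t) * indicator ({A..<A + real (Suc N) * a} \<times> {B..<B + real (Suc M) * b}) (s, t) \<partial>lborel \<partial>lborel)"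
    by (intro nn_integral_cong, subst nn_integral_multc[symmetric]) (auto intro!: nn_integral_cong simp: indicator_def)
  also have "\<dots> = (\<integral>\<^sup>+ x. F x * indicator ({A..<A + real (Suc N) * a} \<times> {B..<B + real (Suc M) * b}) x \<partial>lborel)"
    by (rule nn_integral_lborel_pair(1)[symmetric]) measurable
  finally show ?thesis .
qed

text \<open>The index of the last of the points \<open>A, A + a, \<dots>, A + N a\<close> not beyond \<open>s\<close>; it is clamped to \<open>{0..N}\<close>.\<close>

definition grid_index :: "real \<Rightarrow> real \<Rightarrow> nat \<Rightarrow> real \<Rightarrow> nat" where
  "grid_index A a N s = card {l \<in> {1..N}. A + real l * a \<le> s}"

lemma grid_index_props:
  shows "mono (grid_index A a N)" "grid_index A a N s \<le> N"
    and "a > 0 \<Longrightarrow> k \<le> N \<Longrightarrow> 0 \<le> x \<Longrightarrow> x < a \<Longrightarrow> grid_index A a N (A + x + real k * a) = k"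
proof -
  show "mono (grid_index A a N)"
    unfolding mono_def grid_index_def by (auto intro!: card_mono)
  have "card {l \<in> {1..N}. A + real l * a \<le> s} \<le> card {1..N}" by (rule card_mono) auto
  then show "grid_index A a N s \<le> N" by (simp add: grid_index_def)
  assume a: "a > 0" "k \<le> N" "0 \<le> x" "x < a"
  have "{l \<in> {1..N}. A + real l * a \<le> A + x + real k * a} = {1..k}"
  proof (intro set_eqI iffI)
    fix l assume "l \<in> {l \<in> {1..N}. A + real l * a \<le> A + x + real k * a}"
    then have l: "1 \<le> l" "real l * a \<le> x + real k * a" by auto
    then have "real l * a < (real k + 1) * a" using a by (simp add: algebra_simps)
    then have "real l < real k + 1" using a by simp
    then show "l \<in> {1..k}" using l by auto
  next
    fix l assume l: "l \<in> {1..k}"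
    then have "real l * a \<le> real k * a" using a by simp
    then show "l \<in> {l \<in> {1..N}. A + real l * a \<le> A + x + real k * a}" using l a by (auto intro: add_increasing)
  qed
  then show "grid_index A a N (A + x + real k * a) = k" by (simp add: grid_index_def)
qed

text \<open>The sum over the four choices of signs of the products \<open>\<bar>w(s \<plusminus> a, t) - w(s, t)\<bar>^\<theta>1 \<bar>w(s, t \<plusminus> b) - w(s, t)\<bar>^\<theta>2\<close>,
  in factored form.\<close>

definition corner_density ::
  "real \<Rightarrow> real \<Rightarrow> (real \<times> real \<Rightarrow> real) \<Rightarrow> real \<Rightarrow> real \<Rightarrow> real \<times> real \<Rightarrow> real" where
  "corner_density \<theta>1 \<theta>2 w a b x =
     (\<bar>w (fst x + a, snd x) - w x\<bar> powr \<theta>1 + \<bar>w (fst x - a, snd x) - w x\<bar> powr \<theta>1) *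
     (\<bar>w (fst x, snd x + b) - w x\<bar> powr \<theta>2 + \<bar>w (fst x, snd x - b) - w x\<bar> powr \<theta>2)"

text \<open>Each of the four terms of a cell energy is a term of the corner density at one of the four vertices of
  the cell, and every vertex belongs to at most four cells.\<close>

lemma sum_cell_energy_le_corner_density:
  fixes w :: "real \<times> real \<Rightarrow> real" and A B a b \<theta>1 \<theta>2 :: real
  defines "U \<equiv> \<lambda>k l. w (A + real k * a, B + real l * b)"
    and "\<psi> \<equiv> \<lambda>k l. corner_density \<theta>1 \<theta>2 w a b (A + real k * a, B + real l * b)"
  shows "(\<Sum>k<N. \<Sum>l<M. cell_energy \<theta>1 \<theta>2 U k l) \<le> 4 * (\<Sum>k\<le>N. \<Sum>l\<le>M. \<psi> k l)"
proof -
  have \<psi>0: "0 \<le> \<psi> k l" for k l by (simp add: \<psi>_def corner_density_def)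
  have eq: "A + real k * a + a = A + real (Suc k) * a" "A + real (Suc k) * a - a = A + real k * a"
     "B + real l * b + b = B + real (Suc l) * b" "B + real (Suc l) * b - b = B + real l * b" for k l
    by (simp_all add: algebra_simps)
  have cell: "cell_energy \<theta>1 \<theta>2 U k l \<le> \<psi> k l + \<psi> (Suc k) l + \<psi> k (Suc l) + \<psi> (Suc k) (Suc l)" for k l
  proof -
    let ?x = "\<bar>U (Suc k) l - U k l\<bar> powr \<theta>1" and ?x' = "\<bar>U (Suc k) (Suc l) - U k (Suc l)\<bar> powr \<theta>1"
    let ?y = "\<bar>U k (Suc l) - U k l\<bar> powr \<theta>2" and ?y' = "\<bar>U (Suc k) (Suc l) - U (Suc k) l\<bar> powr \<theta>2"
    have "?x * ?y \<le> \<psi> k l" "?x * ?y' \<le> \<psi> (Suc k) l" "?x' * ?y \<le> \<psi> k (Suc l)" "?x' * ?y' \<le> \<psi> (Suc k) (Suc l)"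
      unfolding \<psi>_def corner_density_def fst_conv snd_conv eq U_def
      by (intro mult_mono; simp add: abs_minus_commute)+
    moreover have "cell_energy \<theta>1 \<theta>2 U k l = ?x * ?y + ?x * ?y' + ?x' * ?y + ?x' * ?y'"
      by (simp add: cell_energy_def algebra_simps)
    ultimately show ?thesis by linarith
  qed
  have S: "(\<Sum>k<N. f (Suc k)) \<le> (\<Sum>k\<le>N. f k)" "(\<Sum>k<N. f k) \<le> (\<Sum>k\<le>N. f k)" if "\<And>k. 0 \<le> f k" for f :: "nat \<Rightarrow> real" and N
  proof -
    show "(\<Sum>k<N. f (Suc k)) \<le> (\<Sum>k\<le>N. f k)"
      using that[of 0] by (subst sum.atMost_shift) simp
    show "(\<Sum>k<N. f k) \<le> (\<Sum>k\<le>N. f k)" by (rule sum_mono2) (use that in auto)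
  qed
  have "(\<Sum>k<N. \<Sum>l<M. cell_energy \<theta>1 \<theta>2 U k l) \<le>
     (\<Sum>k<N. \<Sum>l<M. \<psi> k l + \<psi> (Suc k) l + \<psi> k (Suc l) + \<psi> (Suc k) (Suc l))"
    by (intro sum_mono cell)
  also have "\<dots> = (\<Sum>k<N. \<Sum>l<M. \<psi> k l) + (\<Sum>k<N. \<Sum>l<M. \<psi> (Suc k) l) + (\<Sum>k<N. \<Sum>l<M. \<psi> k (Suc l)) + (\<Sum>k<N. \<Sum>l<M. \<psi> (Suc k) (Suc l))"
    by (simp add: sum.distrib)
  also have "\<dots> \<le> (\<Sum>k\<le>N. \<Sum>l\<le>M. \<psi> k l) + (\<Sum>k\<le>N. \<Sum>l\<le>M. \<psi> k l) + (\<Sum>k\<le>N. \<Sum>l\<le>M. \<psi> k l) + (\<Sum>k\<le>N. \<Sum>l\<le>M. \<psi> k l)"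
  proof (intro add_mono)
    show "(\<Sum>k<N. \<Sum>l<M. \<psi> k l) \<le> (\<Sum>k\<le>N. \<Sum>l\<le>M. \<psi> k l)"
      by (rule order_trans[OF sum_mono S(2)]) (auto intro!: S(2) sum_nonneg \<psi>0)
    show "(\<Sum>k<N. \<Sum>l<M. \<psi> (Suc k) l) \<le> (\<Sum>k\<le>N. \<Sum>l\<le>M. \<psi> k l)"
      by (rule order_trans[OF sum_mono S(1)[of "\<lambda>k. \<Sum>l\<le>M. \<psi> k l"]]) (auto intro!: S(2) sum_nonneg \<psi>0)
    show "(\<Sum>k<N. \<Sum>l<M. \<psi> k (Suc l)) \<le> (\<Sum>k\<le>N. \<Sum>l\<le>M. \<psi> k l)"
      by (rule order_trans[OF sum_mono S(2)]) (auto intro!: S(1) sum_nonneg \<psi>0)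
    show "(\<Sum>k<N. \<Sum>l<M. \<psi> (Suc k) (Suc l)) \<le> (\<Sum>k\<le>N. \<Sum>l\<le>M. \<psi> k l)"
      by (rule order_trans[OF sum_mono S(1)[of "\<lambda>k. \<Sum>l\<le>M. \<psi> k l"]]) (auto intro!: S(1) sum_nonneg \<psi>0)
  qed
  finally show ?thesis by simp
qed

lemma nn_integral_unfold_grid_pair:
  fixes F :: "real \<times> real \<Rightarrow> ennreal"
  assumes [measurable]: "F \<in> borel_measurable borel" and a: "a > 0" "b > 0"
  shows "(\<integral>\<^sup>+ p. (\<Sum>k\<le>N. \<Sum>l\<le>M. F (A + fst p + real k * a, B + snd p + real l * b)) * indicator ({0..<a} \<times> {0..<b}) p \<partial>lborel)
     = (\<integral>\<^sup>+ x. F x * indicator ({A..<A + real (Suc N) * a} \<times> {B..<B + real (Suc M) * b}) x \<partial>lborel)"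
proof -
  have [measurable]: "F \<in> borel_measurable (borel \<Otimes>\<^sub>M borel)" by (simp add: borel_prod)
  have m: "(\<lambda>p. (\<Sum>k\<le>N. \<Sum>l\<le>M. F (A + fst p + real k * a, B + snd p + real l * b)) * indicator ({0..<a} \<times> {0..<b}) p) \<in> borel_measurable borel"
    unfolding borel_prod[symmetric] by measurable
  show ?thesis
    by (subst nn_integral_lborel_pair(1)[OF m], subst nn_integral_unfold_grid[OF assms, symmetric])
       (auto intro!: nn_integral_cong simp: indicator_def)
qed

lemma box_grid_sets [measurable]: "{a..<b} \<times> {c..<d} \<in> sets (borel :: (real \<times> real) measure)"
  unfolding borel_prod[symmetric] by measurable

lemma emeasure_box_half_open:
  "a > 0 \<Longrightarrow> b > 0 \<Longrightarrow> emeasure lborel ({0..<a} \<times> {0..<b} :: (real \<times> real) set) = ennreal (a * b)"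
  by (subst lborel_prod[symmetric], subst lborel.emeasure_pair_measure_Times) (auto simp: ennreal_mult)

text \<open>The step function that takes on each cell the value of \<open>w\<close> at the lower left grid point. Outside the
  grid, the nearest cell is used.\<close>

definition grid_interpolant ::
  "(real \<times> real \<Rightarrow> real) \<Rightarrow> real \<Rightarrow> real \<Rightarrow> nat \<Rightarrow> real \<Rightarrow> real \<Rightarrow> nat \<Rightarrow> real \<times> real \<Rightarrow> real" where
  "grid_interpolant w A a N B b M x =
     w (A + real (grid_index A a N (fst x)) * a, B + real (grid_index B b M (snd x)) * b)"

lemma grid_interpolant_measurable:
  "grid_interpolant w A a N B b M \<in> borel_measurable borel"
proof -
  have [measurable]: "grid_index A a N \<in> measurable borel (count_space UNIV)"
    "grid_index B b M \<in> measurable borel (count_space UNIV)"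
    by (intro mono_nat_measurable grid_index_props)+
  have [measurable]: "(\<lambda>x::real \<times> real. grid_index A a N (fst x)) \<in> measurable borel (count_space UNIV)"
      "(\<lambda>x::real \<times> real. grid_index B b M (snd x)) \<in> measurable borel (count_space UNIV)"
    by (simp_all add: borel_prod[symmetric])
  show ?thesis
    unfolding grid_interpolant_def[abs_def]
    by (rule measurable_compose_countable[where f = "\<lambda>k x. w (A + real k * a, B + real (grid_index B b M (snd x)) * b)"])
       measurable
qed

lemma grid_interpolant_distance:
  fixes w :: "real \<times> real \<Rightarrow> real"
  assumes [measurable]: "w \<in> borel_measurable borel" and a: "a > 0" "b > 0"
  shows "(\<integral>\<^sup>+ x. ennreal \<bar>grid_interpolant w A a N B b M x - w x\<bar> * indicator ({A..<A + real (Suc N) * a} \<times> {B..<B + real (Suc M) * b}) x \<partial>lborel)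
    = (\<integral>\<^sup>+ z. (\<Sum>k\<le>N. \<Sum>l\<le>M. ennreal \<bar>w ((A + real k * a, B + real l * b) + z) - w (A + real k * a, B + real l * b)\<bar>)
         * indicator ({0..<a} \<times> {0..<b}) z \<partial>lborel)"
proof -
  have [measurable]: "grid_interpolant w A a N B b M \<in> borel_measurable borel"
    by (rule grid_interpolant_measurable)
  show ?thesis
  proof (subst nn_integral_unfold_grid_pair[symmetric], measurable, rule a, rule a, intro nn_integral_cong)
    fix z :: "real \<times> real"
    show "(\<Sum>k\<le>N. \<Sum>l\<le>M. ennreal \<bar>grid_interpolant w A a N B b M (A + fst z + real k * a, B + snd z + real l * b)
           - w (A + fst z + real k * a, B + snd z + real l * b)\<bar>) * indicator ({0..<a} \<times> {0..<b}) z =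
        (\<Sum>k\<le>N. \<Sum>l\<le>M. ennreal \<bar>w ((A + real k * a, B + real l * b) + z) - w (A + real k * a, B + real l * b)\<bar>)
         * indicator ({0..<a} \<times> {0..<b}) z"
    proof (cases "z \<in> {0..<a} \<times> {0..<b}")
      case True
      have "\<bar>grid_interpolant w A a N B b M (A + fst z + real k * a, B + snd z + real l * b)
           - w (A + fst z + real k * a, B + snd z + real l * b)\<bar>
          = \<bar>w ((A + real k * a, B + real l * b) + z) - w (A + real k * a, B + real l * b)\<bar>"
        if "k \<le> N" "l \<le> M" for k l
      proof -
        have "(A + real k * a, B + real l * b) + z = (A + fst z + real k * a, B + snd z + real l * b)"
          by (cases z) (simp add: algebra_simps)
        then show ?thesis
          using that True a unfolding grid_interpolant_def
          by (simp add: grid_index_props(3) mem_Times_iff abs_minus_commute)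
      qed
      then show ?thesis by (auto intro!: sum.cong arg_cong2[where f = "(*)"])
    qed simp
  qed
qed

text \<open>The averages over the offset \<open>(\<sigma>, \<tau>)\<close> of the two sums are at most \<open>\<Lambda>\<close> and \<open>\<eta>\<close>, hence some offset keeps both below
  three times that.\<close>

lemma exists_good_grid:
  fixes w :: "real \<times> real \<Rightarrow> real"
  assumes wm[measurable]: "w \<in> borel_measurable borel"
    and a: "a > 0" "b > 0" and \<Lambda>: "\<Lambda> > 0" and \<eta>: "\<eta> > 0"
    and \<psi>m[measurable]: "\<psi> \<in> borel_measurable borel"
    and E: "(\<integral>\<^sup>+ x. \<psi> x * indicator ({A..<A + real (Suc N) * a} \<times> {B..<B + real (Suc M) * b}) x \<partial>lborel) \<le> ennreal (\<Lambda> * a * b)"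
    and T: "\<And>z. z \<in> {0..<a} \<times> {0..<b} \<Longrightarrow> (\<integral>\<^sup>+ x. ennreal \<bar>w (x + z) - w x\<bar> \<partial>lborel) \<le> ennreal \<eta>"
  obtains \<sigma> \<tau> where "0 \<le> \<sigma>" "\<sigma> < a" "0 \<le> \<tau>" "\<tau> < b"
    "(\<Sum>k\<le>N. \<Sum>l\<le>M. \<psi> (A + \<sigma> + real k * a, B + \<tau> + real l * b)) \<le> ennreal (3 * \<Lambda>)"
    "(\<integral>\<^sup>+ z. (\<Sum>k\<le>N. \<Sum>l\<le>M. ennreal \<bar>w ((A + \<sigma> + real k * a, B + \<tau> + real l * b) + z) - w (A + \<sigma> + real k * a, B + \<tau> + real l * b)\<bar>)
         * indicator ({0..<a} \<times> {0..<b}) z \<partial>lborel) \<le> ennreal (3 * \<eta>)"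
proof (rule ccontr)
  assume contra: "\<not> thesis"
  note select = that
  let ?q = "\<lambda>k l p. (A + fst p + real k * a, B + snd p + real l * b)"
  let ?Box = "{0..<a} \<times> {0..<b}"
  define e where "e p = (\<Sum>k\<le>N. \<Sum>l\<le>M. \<psi> (?q k l p))" for p
  define h where "h p z = (\<Sum>k\<le>N. \<Sum>l\<le>M. ennreal \<bar>w (?q k l p + z) - w (?q k l p)\<bar>)" for p z
  define d where "d p = (\<integral>\<^sup>+ z. h p z * indicator ?Box z \<partial>lborel)" for p
  have [measurable]: "\<psi> \<in> borel_measurable (borel \<Otimes>\<^sub>M borel)" "w \<in> borel_measurable (borel \<Otimes>\<^sub>M borel)"
    by (simp_all add: borel_prod)
  have em[measurable]: "e \<in> borel_measurable borel"
    unfolding e_def[abs_def] borel_prod[symmetric] by measurable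
  have hm0: "(\<lambda>(p, z). h p z) \<in> borel_measurable ((borel \<Otimes>\<^sub>M borel) \<Otimes>\<^sub>M (borel \<Otimes>\<^sub>M borel))"
  proof -
    have eq: "?q k l p + z = (A + fst p + real k * a + fst z, B + snd p + real l * b + snd z)" for k l p z
      by (cases z) simp
    show ?thesis unfolding h_def eq by measurable
  qed
  then have hm[measurable]: "(\<lambda>(p, z). h p z) \<in> borel_measurable (borel \<Otimes>\<^sub>M borel)" by (simp add: borel_prod)
  have dm[measurable]: "d \<in> borel_measurable borel" unfolding d_def[abs_def] by measurable
  \<comment> \<open>Without such an offset the sum of the two normalised quantities would be at least 1 everywhere, while its average is at most 2/3.\<close>
  have bad: "1 \<le> ennreal (1 / (3 * \<Lambda>)) * e p + ennreal (1 / (3 * \<eta>)) * d p" if p: "p \<in> ?Box" for p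
  proof -
    have *: "1 \<le> ennreal (1 / c) * x" if "c > 0" "\<not> x \<le> ennreal c" for c x
    proof -
      have "1 = ennreal (1 / c) * ennreal c" using that by (simp add: ennreal_mult[symmetric])
      also have "\<dots> \<le> ennreal (1 / c) * x" using that by (intro mult_left_mono) auto
      finally show ?thesis .
    qed
    have "\<not> e p \<le> ennreal (3 * \<Lambda>) \<or> \<not> d p \<le> ennreal (3 * \<eta>)"
      using contra select[of "fst p" "snd p"] p by (auto simp: e_def d_def h_def mem_Times_iff)
    then show ?thesis
      using *[of "3 * \<Lambda>" "e p"] *[of "3 * \<eta>" "d p"] \<Lambda> \<eta> by (auto intro: add_increasing add_increasing2)
  qed
  have ie: "(\<integral>\<^sup>+ p. e p * indicator ?Box p \<partial>lborel) \<le> ennreal (\<Lambda> * a * b)"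
    unfolding e_def using E by (subst nn_integral_unfold_grid_pair[OF \<psi>m a])
  have "(\<integral>\<^sup>+ p. d p * indicator ?Box p \<partial>lborel) = (\<integral>\<^sup>+ p. \<integral>\<^sup>+ z. h p z * indicator ?Box z * indicator ?Box p \<partial>lborel \<partial>lborel)"
    unfolding d_def by (intro nn_integral_cong nn_integral_multc[symmetric]) measurable
  also have "\<dots> = (\<integral>\<^sup>+ z. \<integral>\<^sup>+ p. h p z * indicator ?Box z * indicator ?Box p \<partial>lborel \<partial>lborel)"
    by (rule lborel_pair.Fubini') measurable
  also have "\<dots> = (\<integral>\<^sup>+ z. (\<integral>\<^sup>+ p. h p z * indicator ?Box p \<partial>lborel) * indicator ?Box z \<partial>lborel)"
    by (intro nn_integral_cong, subst nn_integral_multc[symmetric]) (auto simp: ac_simps intro!: nn_integral_cong)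
  also have "\<dots> \<le> (\<integral>\<^sup>+ z. ennreal \<eta> * indicator ?Box z \<partial>lborel)"
  proof (rule nn_integral_mono)
    fix z
    show "(\<integral>\<^sup>+ p. h p z * indicator ?Box p \<partial>lborel) * indicator ?Box z \<le> ennreal \<eta> * indicator ?Box z"
    proof (cases "z \<in> ?Box")
      case True
      have "(\<integral>\<^sup>+ p. h p z * indicator ?Box p \<partial>lborel)
        = (\<integral>\<^sup>+ x. ennreal \<bar>w (x + z) - w x\<bar> * indicator ({A..<A + real (Suc N) * a} \<times> {B..<B + real (Suc M) * b}) x \<partial>lborel)"
        unfolding h_def by (rule nn_integral_unfold_grid_pair[OF _ a]) measurable
      also have "\<dots> \<le> (\<integral>\<^sup>+ x. ennreal \<bar>w (x + z) - w x\<bar> \<partial>lborel)"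
        by (intro nn_integral_mono) (auto simp: indicator_def)
      also have "\<dots> \<le> ennreal \<eta>" by (rule T[OF True])
      finally show ?thesis using True by simp
    qed simp
  qed
  also have "\<dots> = ennreal (\<eta> * (a * b))"
    using \<eta> a by (simp add: nn_integral_cmult_indicator emeasure_box_half_open ennreal_mult)
  finally have id: "(\<integral>\<^sup>+ p. d p * indicator ?Box p \<partial>lborel) \<le> ennreal (\<eta> * (a * b))" .
  have "ennreal (a * b) = (\<integral>\<^sup>+ p. 1 * indicator ?Box p \<partial>lborel)"
    using a by (simp add: emeasure_box_half_open)
  also have "\<dots> \<le> (\<integral>\<^sup>+ p. (ennreal (1 / (3 * \<Lambda>)) * e p + ennreal (1 / (3 * \<eta>)) * d p) * indicator ?Box p \<partial>lborel)"
    using bad by (intro nn_integral_mono) (auto simp: indicator_def)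
  also have "\<dots> = (\<integral>\<^sup>+ p. ennreal (1 / (3 * \<Lambda>)) * (e p * indicator ?Box p) + ennreal (1 / (3 * \<eta>)) * (d p * indicator ?Box p) \<partial>lborel)"
    by (intro nn_integral_cong) (simp add: algebra_simps)
  also have "\<dots> = ennreal (1 / (3 * \<Lambda>)) * (\<integral>\<^sup>+ p. e p * indicator ?Box p \<partial>lborel) + ennreal (1 / (3 * \<eta>)) * (\<integral>\<^sup>+ p. d p * indicator ?Box p \<partial>lborel)"
    by (simp add: nn_integral_add nn_integral_cmult)
  also have "\<dots> \<le> ennreal (1 / (3 * \<Lambda>)) * ennreal (\<Lambda> * a * b) + ennreal (1 / (3 * \<eta>)) * ennreal (\<eta> * (a * b))"
    by (intro add_mono mult_left_mono ie id) auto
  also have "\<dots> = ennreal (2 / 3 * (a * b))"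
    using \<Lambda> \<eta> a by (simp add: ennreal_mult[symmetric] ennreal_plus[symmetric] del: ennreal_plus)
  finally show False using mult_pos_pos[OF a] by (simp add: ennreal_le_iff2)
qed

lemma exists_grid_count:
  fixes L a :: real
  assumes "0 < a" "a \<le> L"
  obtains N where "real (Suc N) * a \<le> L" "L < real (Suc N) * a + a"
proof -
  have f: "1 \<le> \<lfloor>L / a\<rfloor>" using assms by (simp add: le_floor_iff)
  have n: "real (nat \<lfloor>L / a\<rfloor>) = of_int \<lfloor>L / a\<rfloor>" using f by simp
  have "Suc (nat \<lfloor>L / a\<rfloor> - 1) = nat \<lfloor>L / a\<rfloor>" using f by linarith
  then have S: "real (Suc (nat \<lfloor>L / a\<rfloor> - 1)) = of_int \<lfloor>L / a\<rfloor>" using n by metis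
  have "of_int \<lfloor>L / a\<rfloor> * a \<le> L / a * a" using assms by (intro mult_right_mono) auto
  moreover have "L / a * a < (of_int \<lfloor>L / a\<rfloor> + 1) * a" using assms by (intro mult_strict_right_mono) linarith+
  ultimately show ?thesis using assms by (intro that[of "nat \<lfloor>L / a\<rfloor> - 1"]) (auto simp only: S algebra_simps; simp)+
qed


text \<open>The part of the rectangle that the grid misses lies in four strips of width \<open>2 r\<close>.\<close>

lemma nn_integral_rectangle_le_core:
  fixes f :: "real \<times> real \<Rightarrow> real"
  assumes [measurable]: "f \<in> borel_measurable borel" and f: "\<And>x. 0 \<le> f x" "\<And>x. f x \<le> 2"
    and i: "i0 < i1" and j: "j0 < j1" and r: "r > 0"
    and A: "A \<le> i0 + 2 * r" "i1 - 2 * r \<le> A'" and B: "B \<le> j0 + 2 * r" "j1 - 2 * r \<le> B'"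
  shows "(\<integral>\<^sup>+ x. ennreal (f x) * indicator ({i0<..<i1} \<times> {j0<..<j1}) x \<partial>lborel)
    \<le> (\<integral>\<^sup>+ x. ennreal (f x) * indicator ({A..<A'} \<times> {B..<B'}) x \<partial>lborel)
       + ennreal (8 * r * ((i1 - i0) + (j1 - j0)))"
proof -
  have m[measurable]: "{a..b} \<times> {c..d} \<in> sets (borel :: (real \<times> real) measure)" for a b c d
    unfolding borel_prod[symmetric] by measurable
  let ?S1 = "{i0..i0 + 2 * r} \<times> {j0..j1}" and ?S2 = "{i1 - 2 * r..i1} \<times> {j0..j1}"
  let ?S3 = "{i0..i1} \<times> {j0..j0 + 2 * r}" and ?S4 = "{i0..i1} \<times> {j1 - 2 * r..j1}"
  have em: "emeasure lborel ({a..b} \<times> {c..d} :: (real \<times> real) set) = ennreal ((b - a) * (d - c))" if "a \<le> b" "c \<le> d" for a b c d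
    using that by (subst lborel_prod[symmetric], subst lborel.emeasure_pair_measure_Times) (auto simp: ennreal_mult)
  define v1 where "v1 = 2 * r * (j1 - j0)"
  define v2 where "v2 = 2 * r * (i1 - i0)"
  have v: "0 \<le> v1" "0 \<le> v2" using i j r by (auto simp: v1_def v2_def)
  let ?D = "(?S1 \<union> ?S2) \<union> (?S3 \<union> ?S4)"
  have Dm: "?D \<in> sets lborel" by simp
  have "emeasure lborel ?D \<le> (emeasure lborel ?S1 + emeasure lborel ?S2) + (emeasure lborel ?S3 + emeasure lborel ?S4)"
    by (intro order_trans[OF emeasure_subadditive] add_mono emeasure_subadditive sets.Un) simp_all
  also have "\<dots> = (ennreal v1 + ennreal v1) + (ennreal v2 + ennreal v2)"
    using i j r by (simp add: em v1_def v2_def algebra_simps)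
  also have "\<dots> = ennreal (2 * v1 + 2 * v2)"
    using v by (simp add: ennreal_plus[symmetric] del: ennreal_plus)
  finally have D: "emeasure lborel ?D \<le> ennreal (2 * v1 + 2 * v2)" .
  have "(\<integral>\<^sup>+ x. ennreal (f x) * indicator ({i0<..<i1} \<times> {j0<..<j1}) x \<partial>lborel)
    \<le> (\<integral>\<^sup>+ x. ennreal (f x) * indicator ({A..<A'} \<times> {B..<B'}) x + ennreal 2 * indicator ?D x \<partial>lborel)"
  proof (rule nn_integral_mono)
    fix x :: "real \<times> real"
    have le: "ennreal (f x) \<le> ennreal 2" by (intro ennreal_leI f)
    have "x \<in> ?D \<or> x \<in> {A..<A'} \<times> {B..<B'}" if "x \<in> {i0<..<i1} \<times> {j0<..<j1}"
      using that A B by (auto simp: mem_Times_iff)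
    then show "ennreal (f x) * indicator ({i0<..<i1} \<times> {j0<..<j1}) x
        \<le> ennreal (f x) * indicator ({A..<A'} \<times> {B..<B'}) x + ennreal 2 * indicator ?D x"
      using le by (cases "x \<in> ?D"; cases "x \<in> {A..<A'} \<times> {B..<B'}"; cases "x \<in> {i0<..<i1} \<times> {j0<..<j1}")
        (simp_all add: add_increasing)
  qed
  also have "\<dots> = (\<integral>\<^sup>+ x. ennreal (f x) * indicator ({A..<A'} \<times> {B..<B'}) x \<partial>lborel) + ennreal 2 * emeasure lborel ?D"
    by (subst nn_integral_add) (simp_all add: nn_integral_cmult_indicator)
  also have "\<dots> \<le> (\<integral>\<^sup>+ x. ennreal (f x) * indicator ({A..<A'} \<times> {B..<B'}) x \<partial>lborel) + ennreal 2 * ennreal (2 * v1 + 2 * v2)"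
    by (intro add_left_mono mult_left_mono D) auto
  also have "ennreal 2 * ennreal (2 * v1 + 2 * v2) = ennreal (8 * r * ((i1 - i0) + (j1 - j0)))"
    using v by (subst ennreal_mult[symmetric]) (auto simp: v1_def v2_def algebra_simps)
  finally show ?thesis .
qed

text \<open>Good increments at arbitrarily small scale \<open>\<epsilon>\<close> yield step functions that are arbitrarily close to \<open>w\<close> in the
  mean and, possibly after exchanging the variables, are nearly column functions with a
  constant independent of the scale.\<close>

lemma exists_step_approximation:
  fixes w :: "real \<times> real \<Rightarrow> real"
  assumes i: "i0 < i1" and j: "j0 < j1" and wm[measurable]: "w \<in> borel_measurable borel"
    and wb: "\<And>x. \<bar>w x\<bar> \<le> 1" and supp: "\<And>x. x \<notin> {i0<..<i1} \<times> {j0<..<j1} \<Longrightarrow> w x = 0"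
    and th: "\<theta>1 > 0" "\<theta>2 > 0" "\<theta>1 + \<theta>2 \<le> 1" and \<Lambda>: "\<Lambda> > 0"
    and small: "\<And>r. r > 0 \<Longrightarrow> \<exists>\<epsilon> a b. 0 < \<epsilon> \<and> \<epsilon> < r \<and> 0 < a \<and> a < \<epsilon> \<and> 0 < b \<and> b < \<epsilon> \<and>
       (\<integral>\<^sup>+ x. ennreal (corner_density \<theta>1 \<theta>2 w a b x) * indicator ({i0 + \<epsilon>..i1 - \<epsilon>} \<times> {j0 + \<epsilon>..j1 - \<epsilon>}) x \<partial>lborel)
         \<le> ennreal (\<Lambda> * a * b)"
    and \<delta>: "\<delta> > 0"
  shows "\<exists>g. (\<integral>\<^sup>+ x. ennreal \<bar>g x - w x\<bar> * indicator ({i0<..<i1} \<times> {j0<..<j1}) x \<partial>lborel) \<le> ennreal \<delta> \<and>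
     (nearly_column (144 * \<Lambda> + sqrt (12 * \<Lambda>)) g \<or> nearly_column (144 * \<Lambda> + sqrt (12 * \<Lambda>)) (\<lambda>x. g (prod.swap x)))"
proof -
  let ?R = "{i0<..<i1} \<times> {j0<..<j1}"
  define S where "S = (i1 - i0) + (j1 - j0)"
  have S: "S > 0" using i j by (simp add: S_def)
  have "bounded ?R" by (intro bounded_Times) auto
  then obtain Q where Q: "Q > 0" "\<And>x. x \<in> ?R \<Longrightarrow> norm x \<le> Q" by (auto simp: bounded_pos)
  have "w x = 0" if "x \<notin> cball 0 Q" for x using that Q(2)[of x] supp[of x] by (cases "x \<in> ?R") auto
  then obtain d where d: "d > 0"
    "\<And>z. norm z < d \<Longrightarrow> (\<integral>\<^sup>+ x. ennreal \<bar>w (x + z) - w x\<bar> \<partial>lborel) \<le> ennreal (\<delta> / 6)"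
    using nn_integral_abs_diff_translate_small[OF wm wb, of Q "\<delta> / 6"] Q(1) \<delta> by auto
  \<comment> \<open>The scale is small against the sides of the rectangle, the modulus of continuity of translations and the area of the boundary strips.\<close>
  define r where "r = min (min ((i1 - i0) / 4) ((j1 - j0) / 4)) (min (d / 2) (\<delta> / (16 * S)))"
  have r: "r > 0" using i j d \<delta> S by (simp add: r_def)
  obtain \<epsilon> a b where e: "0 < \<epsilon>" "\<epsilon> < r" and a: "0 < a" "a < \<epsilon>" and b: "0 < b" "b < \<epsilon>"
    and E: "(\<integral>\<^sup>+ x. ennreal (corner_density \<theta>1 \<theta>2 w a b x) * indicator ({i0 + \<epsilon>..i1 - \<epsilon>} \<times> {j0 + \<epsilon>..j1 - \<epsilon>}) x \<partial>lborel)
         \<le> ennreal (\<Lambda> * a * b)"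
    using small[OF r] by blast
  have er: "4 * \<epsilon> < i1 - i0" "4 * \<epsilon> < j1 - j0" "2 * \<epsilon> < d" "\<epsilon> < \<delta> / (16 * S)"
    using e by (auto simp: r_def)
  have e8: "8 * \<epsilon> * S \<le> \<delta> / 2" using er(4) S by (simp add: field_simps)
  have ae: "a \<le> i1 - i0 - 2 * \<epsilon>" and be: "b \<le> j1 - j0 - 2 * \<epsilon>" using er a b e by linarith+
  obtain N where N: "real (Suc N) * a \<le> i1 - i0 - 2 * \<epsilon>" "i1 - i0 - 2 * \<epsilon> < real (Suc N) * a + a"
    using exists_grid_count[of a "i1 - i0 - 2 * \<epsilon>"] a(1) ae by auto
  obtain M where M: "real (Suc M) * b \<le> j1 - j0 - 2 * \<epsilon>" "j1 - j0 - 2 * \<epsilon> < real (Suc M) * b + b"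
    using exists_grid_count[of b "j1 - j0 - 2 * \<epsilon>"] b(1) be by auto
  let ?A = "i0 + \<epsilon>" and ?B = "j0 + \<epsilon>"
  let ?\<psi> = "\<lambda>x. ennreal (corner_density \<theta>1 \<theta>2 w a b x)"
  have [measurable]: "w \<in> borel_measurable (borel \<Otimes>\<^sub>M borel)" by (simp add: borel_prod)
  have \<psi>m: "?\<psi> \<in> borel_measurable borel"
    unfolding corner_density_def[abs_def] borel_prod[symmetric] by measurable
  have E': "(\<integral>\<^sup>+ x. ?\<psi> x * indicator ({?A..<?A + real (Suc N) * a} \<times> {?B..<?B + real (Suc M) * b}) x \<partial>lborel) \<le> ennreal (\<Lambda> * a * b)"
    by (rule order_trans[OF nn_integral_mono E]) (use N(1) M(1) in \<open>auto simp: indicator_def\<close>)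
  have T: "(\<integral>\<^sup>+ x. ennreal \<bar>w (x + z) - w x\<bar> \<partial>lborel) \<le> ennreal (\<delta> / 6)" if "z \<in> {0..<a} \<times> {0..<b}" for z
  proof (rule d(2))
    have "norm z \<le> norm (fst z) + norm (snd z)" using norm_Pair_le[of "fst z" "snd z"] by simp
    also have "\<dots> < d" using that a b er(3) by (auto simp: mem_Times_iff)
    finally show "norm z < d" .
  qed
  obtain \<sigma> \<tau> where st: "0 \<le> \<sigma>" "\<sigma> < a" "0 \<le> \<tau>" "\<tau> < b"
    and st1: "(\<Sum>k\<le>N. \<Sum>l\<le>M. ?\<psi> (?A + \<sigma> + real k * a, ?B + \<tau> + real l * b)) \<le> ennreal (3 * \<Lambda>)"
    and st2: "(\<integral>\<^sup>+ z. (\<Sum>k\<le>N. \<Sum>l\<le>M. ennreal \<bar>w ((?A + \<sigma> + real k * a, ?B + \<tau> + real l * b) + z) - w (?A + \<sigma> + real k * a, ?B + \<tau> + real l * b)\<bar>)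
         * indicator ({0..<a} \<times> {0..<b}) z \<partial>lborel) \<le> ennreal (3 * (\<delta> / 6))"
    using \<delta> by (rule_tac exists_good_grid[OF wm a(1) b(1) \<Lambda> _ \<psi>m E' T]) auto
  let ?A' = "?A + \<sigma>" and ?B' = "?B + \<tau>"
  define g where "g = grid_interpolant w ?A' a N ?B' b M"
  have gm[measurable]: "g \<in> borel_measurable borel" unfolding g_def by (rule grid_interpolant_measurable)
  have gb: "\<bar>g x\<bar> \<le> 1" for x by (simp add: g_def grid_interpolant_def wb)
  have dist: "(\<integral>\<^sup>+ x. ennreal \<bar>g x - w x\<bar> * indicator ?R x \<partial>lborel) \<le> ennreal \<delta>"
  proof -
    have "(\<integral>\<^sup>+ x. ennreal \<bar>g x - w x\<bar> * indicator ?R x \<partial>lborel) \<le>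
       (\<integral>\<^sup>+ x. ennreal \<bar>g x - w x\<bar> * indicator ({?A'..<?A' + real (Suc N) * a} \<times> {?B'..<?B' + real (Suc M) * b}) x \<partial>lborel)
        + ennreal (8 * \<epsilon> * S)"
      unfolding S_def
    proof (rule nn_integral_rectangle_le_core[OF _ _ _ i j e(1)])
      show "\<bar>g x - w x\<bar> \<le> 2" for x using gb[of x] wb[of x] by linarith
    qed (use st N M a b in auto)
    also have "\<dots> \<le> ennreal (3 * (\<delta> / 6)) + ennreal (\<delta> / 2)"
      unfolding g_def grid_interpolant_distance[OF wm a(1) b(1)] by (intro add_mono st2 ennreal_leI e8)
    also have "\<dots> = ennreal \<delta>" using \<delta> by (simp add: ennreal_plus[symmetric] del: ennreal_plus)
    finally show ?thesis .
  qed
  define U where "U k l = w (?A' + real k * a, ?B' + real l * b)" for k l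
  have U: "\<bar>U k l\<bar> \<le> 1" for k l by (simp add: U_def wb)
  have "ennreal (\<Sum>k\<le>N. \<Sum>l\<le>M. corner_density \<theta>1 \<theta>2 w a b (?A' + real k * a, ?B' + real l * b)) \<le> ennreal (3 * \<Lambda>)"
    using st1 by (simp add: sum_ennreal corner_density_def sum_nonneg)
  then have "(\<Sum>k\<le>N. \<Sum>l\<le>M. corner_density \<theta>1 \<theta>2 w a b (?A' + real k * a, ?B' + real l * b)) \<le> 3 * \<Lambda>"
    using \<Lambda> by (simp add: ennreal_le_iff)
  then have e12: "(\<Sum>k<N. \<Sum>l<M. cell_energy \<theta>1 \<theta>2 U k l) \<le> 12 * \<Lambda>"
    using sum_cell_energy_le_corner_density[where w = w and A = ?A' and B = ?B' and a = a and b = b and N = N and M = M and ?\<theta>1.0 = \<theta>1 and ?\<theta>2.0 = \<theta>2]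
    unfolding U_def[abs_def] by linarith
  define K where "K = 144 * \<Lambda> + sqrt (12 * \<Lambda>)"
  have K: "12 * (12 * \<Lambda>) + sqrt (12 * \<Lambda>) = K" by (simp add: K_def)
  have "(\<Sum>k<N. \<Sum>l<M. \<bar>mixed_diff U k l\<bar>) \<le> 48 * \<Lambda>"
    using sum_mixed_diff_le[where U = U and N = N and M = M, OF th U] e12 by linarith
  also have "\<dots> \<le> K" using \<Lambda> by (simp add: K_def)
  finally have mix: "(\<Sum>k<N. \<Sum>l<M. \<bar>mixed_diff U k l\<bar>) \<le> K" .
  have gU: "g = (\<lambda>x. U (grid_index ?A' a N (fst x)) (grid_index ?B' b M (snd x)))"
    by (auto simp: g_def grid_interpolant_def U_def)
  from discrete_dichotomy[OF th U e12, unfolded K]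
  have "nearly_column K g \<or> nearly_column K (\<lambda>x. g (prod.swap x))"
  proof
    assume "\<forall>l\<le>M. (\<Sum>k<N. \<bar>U (Suc k) l - U k l\<bar>) \<le> K"
    then have "nearly_column K g"
      unfolding gU by (rule nearly_column_step[OF U grid_index_props(1,2) grid_index_props(1,2) _ mix])
    then show ?thesis ..
  next
    assume *: "\<forall>k\<le>N. (\<Sum>l<M. \<bar>U k (Suc l) - U k l\<bar>) \<le> K"
    have "(\<Sum>l<M. \<Sum>k<N. \<bar>mixed_diff (\<lambda>l k. U k l) l k\<bar>) \<le> K"
      using mix by (subst sum.swap) (simp add: mixed_diff_swap[of U])
    then have "nearly_column K (\<lambda>x. U (grid_index ?A' a N (snd x)) (grid_index ?B' b M (fst x)))"
      using * by (intro nearly_column_step[where U = "\<lambda>l k. U k l", OF U grid_index_props(1,2) grid_index_props(1,2)])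
    then have "nearly_column K (\<lambda>x. g (prod.swap x))" by (simp add: gU)
    then show ?thesis ..
  qed
  with dist show ?thesis unfolding K_def by blast
qed

section \<open>Alternative in the limit\<close>

lemma nearly_column_mono:
  assumes "nearly_column K g" "K \<le> K'"
  shows "nearly_column K' g"
proof -
  have "ennreal (K * h) \<le> ennreal (K' * h)" if "h > 0" for h
    using assms(2) that by (intro ennreal_leI mult_right_mono) auto
  then show ?thesis
    using assms unfolding nearly_column_def by (meson order_trans)
qed

text \<open>The alternative may depend on the approximating step function. Since both alternatives become weaker as
  \<open>\<delta>\<close> grows, one of them holds for all \<open>\<delta>\<close>.\<close>

lemma column_or_row_limit:
  fixes w :: "real \<times> real \<Rightarrow> real"
  assumes i: "i0 < i1" and j: "j0 < j1" and wm[measurable]: "w \<in> borel_measurable borel"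
    and wb: "\<And>x. \<bar>w x\<bar> \<le> 1" and supp: "\<And>x. x \<notin> {i0<..<i1} \<times> {j0<..<j1} \<Longrightarrow> w x = 0"
    and th: "\<theta>1 > 0" "\<theta>2 > 0" "\<theta>1 + \<theta>2 \<le> 1" and c: "c > 0" and E: "0 \<le> E"
    and small: "\<And>r \<eta>. r > 0 \<Longrightarrow> \<eta> > 0 \<Longrightarrow> \<exists>\<epsilon> a b. 0 < \<epsilon> \<and> \<epsilon> < r \<and> 0 < a \<and> a < \<epsilon> \<and> 0 < b \<and> b < \<epsilon> \<and>
       (\<integral>\<^sup>+ x. ennreal (corner_density \<theta>1 \<theta>2 w a b x) * indicator ({i0 + \<epsilon>..i1 - \<epsilon>} \<times> {j0 + \<epsilon>..j1 - \<epsilon>}) x \<partial>lborel)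
         \<le> ennreal (c * (E + \<eta>) * a * b)"
  defines "K \<equiv> 144 * c * E + sqrt (12 * c * E)"
  shows "(\<forall>\<delta>>0. \<exists>g. nearly_column (K + \<delta>) g \<and>
            (\<integral>\<^sup>+ x. ennreal \<bar>g x - w x\<bar> * indicator ({i0<..<i1} \<times> {j0<..<j1}) x \<partial>lborel) \<le> ennreal \<delta>) \<or>
         (\<forall>\<delta>>0. \<exists>g. nearly_column (K + \<delta>) g \<and>
            (\<integral>\<^sup>+ x. ennreal \<bar>g x - w (prod.swap x)\<bar> * indicator ({j0<..<j1} \<times> {i0<..<i1}) x \<partial>lborel) \<le> ennreal \<delta>)"
proof -
  let ?C = "\<lambda>\<delta> g. (\<integral>\<^sup>+ x. ennreal \<bar>g x - w x\<bar> * indicator ({i0<..<i1} \<times> {j0<..<j1}) x \<partial>lborel) \<le> ennreal \<delta>"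
  have both: "\<exists>g. ?C \<delta> g \<and> (nearly_column (K + \<delta>) g \<or> nearly_column (K + \<delta>) (\<lambda>x. g (prod.swap x)))" if \<delta>: "\<delta> > 0" for \<delta>
  proof -
    \<comment> \<open>Chosen such that replacing \<open>E\<close> by \<open>E + \<eta>\<close> increases the constant by at most \<open>\<delta>\<close>.\<close>
    define \<eta> where "\<eta> = min (\<delta> / (2 * (144 * c))) (\<delta>\<^sup>2 / (4 * (12 * c)))"
    have \<eta>: "\<eta> > 0" using \<delta> c by (simp add: \<eta>_def)
    have "144 * c * \<eta> \<le> \<delta> / 2"
      using mult_left_mono[of \<eta> "\<delta> / (2 * (144 * c))" "144 * c"] c by (simp add: \<eta>_def)
    moreover have "sqrt (12 * c * \<eta>) \<le> \<delta> / 2"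
    proof (rule real_le_lsqrt)
      show "12 * c * \<eta> \<le> (\<delta> / 2)\<^sup>2"
        using mult_left_mono[of \<eta> "\<delta>\<^sup>2 / (4 * (12 * c))" "12 * c"] c by (simp add: \<eta>_def power_divide)
    qed (use \<delta> in simp)
    moreover have "sqrt (12 * (c * (E + \<eta>))) \<le> sqrt (12 * c * E) + sqrt (12 * c * \<eta>)"
      using sqrt_add_le_add_sqrt[of "12 * c * E" "12 * c * \<eta>"] c E \<eta> by (simp add: algebra_simps)
    ultimately have K: "144 * (c * (E + \<eta>)) + sqrt (12 * (c * (E + \<eta>))) \<le> K + \<delta>"
      unfolding K_def by (simp add: algebra_simps)
    have pos: "c * (E + \<eta>) > 0" using c E \<eta> by simp
    obtain g where "?C \<delta> g" "nearly_column (144 * (c * (E + \<eta>)) + sqrt (12 * (c * (E + \<eta>)))) g \<or>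
       nearly_column (144 * (c * (E + \<eta>)) + sqrt (12 * (c * (E + \<eta>)))) (\<lambda>x. g (prod.swap x))"
      using exists_step_approximation[OF i j wm wb supp th pos small[OF _ \<eta>] \<delta>] by blast
    then show ?thesis using nearly_column_mono[OF _ K] by blast
  qed
  have sw: "(\<integral>\<^sup>+ x. ennreal \<bar>g (prod.swap x) - w (prod.swap x)\<bar> * indicator ({j0<..<j1} \<times> {i0<..<i1}) x \<partial>lborel)
     = (\<integral>\<^sup>+ x. ennreal \<bar>g x - w x\<bar> * indicator ({i0<..<i1} \<times> {j0<..<j1}) x \<partial>lborel)"
    if g: "(\<lambda>x. g (prod.swap x)) \<in> borel_measurable borel" for g
  proof -
    have sm: "(\<lambda>x::real \<times> real. prod.swap x) \<in> borel_measurable borel"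
      by (intro borel_measurable_continuous_onI) (auto simp: prod.swap_def intro!: continuous_intros)
    have [measurable]: "g \<in> borel_measurable borel"
      using measurable_compose[OF sm g] by simp
    have [measurable]: "g \<in> borel_measurable (borel \<Otimes>\<^sub>M borel)" "w \<in> borel_measurable (borel \<Otimes>\<^sub>M borel)"
      by (simp_all add: borel_prod)
    have m1: "(\<lambda>x. ennreal \<bar>g x - w x\<bar> * indicator ({i0<..<i1} \<times> {j0<..<j1}) x) \<in> borel_measurable borel"
      unfolding borel_prod[symmetric] by measurable
    have m2: "(\<lambda>x. ennreal \<bar>g (prod.swap x) - w (prod.swap x)\<bar> * indicator ({j0<..<j1} \<times> {i0<..<i1}) x) \<in> borel_measurable borel"
      unfolding borel_prod[symmetric] prod.swap_def by measurable
    show ?thesis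
      unfolding nn_integral_lborel_pair(2)[OF m1] nn_integral_lborel_pair(1)[OF m2]
      by (intro nn_integral_cong) (auto simp: indicator_def)
  qed
  show ?thesis
  proof (rule ccontr)
    assume "\<not> ?thesis"
    then obtain d1 d2 where d: "d1 > 0" "d2 > 0"
      and n1: "\<And>g. \<not> (nearly_column (K + d1) g \<and> ?C d1 g)"
      and n2: "\<And>g. \<not> (nearly_column (K + d2) g \<and>
            (\<integral>\<^sup>+ x. ennreal \<bar>g x - w (prod.swap x)\<bar> * indicator ({j0<..<j1} \<times> {i0<..<i1}) x \<partial>lborel) \<le> ennreal d2)"
      by blast
    obtain g where g: "?C (min d1 d2) g"
      "nearly_column (K + min d1 d2) g \<or> nearly_column (K + min d1 d2) (\<lambda>x. g (prod.swap x))"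
      using both[of "min d1 d2"] d by auto
    have C: "?C d1 g" "?C d2 g"
      by (rule order_trans[OF g(1)], simp add: ennreal_leI)+
    show False
      using g(2)
    proof
      assume "nearly_column (K + min d1 d2) g"
      then have "nearly_column (K + d1) g" by (rule nearly_column_mono) simp
      then show False using n1 C(1) by blast
    next
      assume *: "nearly_column (K + min d1 d2) (\<lambda>x. g (prod.swap x))"
      then have "nearly_column (K + d2) (\<lambda>x. g (prod.swap x))" by (rule nearly_column_mono) simp
      moreover have "(\<lambda>x. g (prod.swap x)) \<in> borel_measurable borel" using * by (simp add: nearly_column_def)
      ultimately show False using n2[of "\<lambda>x. g (prod.swap x)"] C(2) sw[of g] by simp
    qed
  qed
qed

section \<open>Positive variation through difference quotients\<close>

text \<open>\<open>1/h\<close> times the integral of the positive part of \<open>v(\<sigma> + h) - v \<sigma>\<close> over those \<open>\<sigma>\<close> for which both points lie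
  between \<open>i0\<close> and \<open>s\<close>. The positive part is implicit in \<open>ennreal\<close>.\<close>

definition upward_quotient :: "real \<Rightarrow> (real \<Rightarrow> real) \<Rightarrow> real \<Rightarrow> real \<Rightarrow> ennreal" where
  "upward_quotient i0 v h s =
     ennreal (1 / h) * (\<integral>\<^sup>+ \<sigma>. ennreal (v (\<sigma> + h) - v \<sigma>) * indicator {i0<..<s - h} \<sigma> \<partial>lborel)"

text \<open>The positive variation of \<open>v\<close> between \<open>i0\<close> and \<open>s\<close>. It does not change if \<open>v\<close> is modified on a null set. The
  negative variation is the positive variation of \<open>- v\<close>.\<close>

definition positive_variation :: "real \<Rightarrow> (real \<Rightarrow> real) \<Rightarrow> real \<Rightarrow> ennreal" where
  "positive_variation i0 v s = (SUP k. upward_quotient i0 v (1 / 2 ^ k) s)"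

lemma ennreal_add_le: "ennreal (x + y) \<le> ennreal x + ennreal y"
proof -
  have "ennreal (x + y) \<le> ennreal (max 0 x + max 0 y)" by (intro ennreal_leI) auto
  also have "\<dots> = ennreal x + ennreal y" by (simp add: max_def ennreal_neg)
  finally show ?thesis .
qed

text \<open>Monotonicity under halving of the step: write a difference over \<open>2 h\<close> as a sum of two differences over \<open>h\<close>.\<close>

lemma upward_quotient_double_le:
  assumes [measurable]: "v \<in> borel_measurable borel" and h: "h > 0"
  shows "upward_quotient i0 v (2 * h) s \<le> upward_quotient i0 v h s"
proof -
  let ?I = "\<integral>\<^sup>+ \<sigma>. ennreal (v (\<sigma> + h) - v \<sigma>) * indicator {i0<..<s - h} \<sigma> \<partial>lborel"
  have "(\<integral>\<^sup>+ \<sigma>. ennreal (v (\<sigma> + 2 * h) - v \<sigma>) * indicator {i0<..<s - 2 * h} \<sigma> \<partial>lborel) \<le>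
     (\<integral>\<^sup>+ \<sigma>. ennreal (v (\<sigma> + h + h) - v (\<sigma> + h)) * indicator {i0<..<s - h} (\<sigma> + h)
        + ennreal (v (\<sigma> + h) - v \<sigma>) * indicator {i0<..<s - h} \<sigma> \<partial>lborel)"
  proof (rule nn_integral_mono)
    fix \<sigma> :: real
    have e: "v (\<sigma> + 2 * h) - v \<sigma> = (v (\<sigma> + h + h) - v (\<sigma> + h)) + (v (\<sigma> + h) - v \<sigma>)"
      by (simp add: algebra_simps)
    show "ennreal (v (\<sigma> + 2 * h) - v \<sigma>) * indicator {i0<..<s - 2 * h} \<sigma>
       \<le> ennreal (v (\<sigma> + h + h) - v (\<sigma> + h)) * indicator {i0<..<s - h} (\<sigma> + h)
        + ennreal (v (\<sigma> + h) - v \<sigma>) * indicator {i0<..<s - h} \<sigma>"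
      using h ennreal_add_le[of "v (\<sigma> + h + h) - v (\<sigma> + h)" "v (\<sigma> + h) - v \<sigma>"]
      unfolding e by (auto simp: indicator_def)
  qed
  also have "\<dots> = (\<integral>\<^sup>+ \<sigma>. ennreal (v (\<sigma> + h + h) - v (\<sigma> + h)) * indicator {i0<..<s - h} (\<sigma> + h) \<partial>lborel) + ?I"
    by (rule nn_integral_add) measurable
  also have "(\<integral>\<^sup>+ \<sigma>. ennreal (v (\<sigma> + h + h) - v (\<sigma> + h)) * indicator {i0<..<s - h} (\<sigma> + h) \<partial>lborel) = ?I"
    by (rule nn_integral_lborel_translate[of "\<lambda>\<sigma>. ennreal (v (\<sigma> + h) - v \<sigma>) * indicator {i0<..<s - h} \<sigma>"]) measurable
  also have "?I + ?I = ennreal 2 * ?I" by (simp add: mult_2)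
  finally have "upward_quotient i0 v (2 * h) s \<le> ennreal (1 / (2 * h)) * (ennreal 2 * ?I)"
    unfolding upward_quotient_def by (rule mult_left_mono) simp
  also have "\<dots> = upward_quotient i0 v h s"
    unfolding upward_quotient_def mult.assoc[symmetric] using h by (subst ennreal_mult[symmetric]) auto
  finally show ?thesis .
qed

lemma upward_quotient_incseq:
  assumes "v \<in> borel_measurable borel"
  shows "incseq (\<lambda>k. upward_quotient i0 v (1 / 2 ^ k) s)"
  by (rule incseq_SucI) (use upward_quotient_double_le[OF assms, of "1 / 2 ^ Suc _"] in simp)

lemma upward_quotient_mono: "s \<le> s' \<Longrightarrow> upward_quotient i0 v h s \<le> upward_quotient i0 v h s'"
  unfolding upward_quotient_def
  by (intro mult_left_mono nn_integral_mono) (auto simp: indicator_def)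

lemma positive_variation_mono: "s \<le> s' \<Longrightarrow> positive_variation i0 v s \<le> positive_variation i0 v s'"
  unfolding positive_variation_def by (intro SUP_mono) (auto intro: upward_quotient_mono)

lemma upward_quotient_le_i0: "s \<le> i0 \<Longrightarrow> h > 0 \<Longrightarrow> upward_quotient i0 v h s = 0"
  by (simp add: upward_quotient_def)

lemma positive_variation_le_i0: "s \<le> i0 \<Longrightarrow> positive_variation i0 v s = 0"
  by (simp add: positive_variation_def upward_quotient_le_i0)

lemma positive_variation_left_continuous:
  assumes [measurable]: "v \<in> borel_measurable borel" and y: "y < positive_variation i0 v s"
  shows "\<exists>r<s. y < positive_variation i0 v r"
proof -
  obtain k where k: "y < upward_quotient i0 v (1 / 2 ^ k) s"
    using y by (auto simp: positive_variation_def less_SUP_iff)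
  define h where "h = (1 / 2 ^ k :: real)"
  let ?f = "\<lambda>n \<sigma>. ennreal (v (\<sigma> + h) - v \<sigma>) * indicator {i0<..<s - 1 / real (Suc n) - h} \<sigma>"
  have inc: "incseq ?f"
  proof (intro incseq_SucI le_funI mult_left_mono)
    fix n \<sigma>
    have "1 / real (Suc (Suc n)) \<le> 1 / real (Suc n)" by (simp add: field_simps)
    then show "indicator {i0<..<s - 1 / real (Suc n) - h} \<sigma> \<le> (indicator {i0<..<s - 1 / real (Suc (Suc n)) - h} \<sigma> :: ennreal)"
      by (auto simp: indicator_def)
  qed simp
  have sup: "(SUP n. ?f n \<sigma>) = ennreal (v (\<sigma> + h) - v \<sigma>) * indicator {i0<..<s - h} \<sigma>" for \<sigma>
  proof (cases "\<sigma> \<in> {i0<..<s - h}")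
    case True
    then obtain n where n: "1 / real (Suc n) < s - h - \<sigma>"
      using reals_Archimedean[of "s - h - \<sigma>"] by (auto simp: inverse_eq_divide)
    show ?thesis
    proof (rule antisym)
      have "?f n \<sigma> \<le> (SUP n. ?f n \<sigma>)" by (rule SUP_upper) simp
      then show "ennreal (v (\<sigma> + h) - v \<sigma>) * indicator {i0<..<s - h} \<sigma> \<le> (SUP n. ?f n \<sigma>)"
        using True n by (simp add: indicator_def)
      show "(SUP n. ?f n \<sigma>) \<le> ennreal (v (\<sigma> + h) - v \<sigma>) * indicator {i0<..<s - h} \<sigma>"
        by (rule SUP_least) (use True in \<open>auto simp: indicator_def\<close>)
    qed
  next
    case False
    have "\<sigma> \<notin> {i0<..<s - 1 / real (Suc n) - h}" for n
    proof -
      have "0 < 1 / real (Suc n)" by simp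
      then have "s - 1 / real (Suc n) - h < s - h" by linarith
      then show ?thesis using False by (meson greaterThanLessThan_iff less_trans)
    qed
    then show ?thesis using False by (simp del: of_nat_Suc)
  qed
  have "(SUP n. upward_quotient i0 v h (s - 1 / real (Suc n))) = upward_quotient i0 v h s"
    unfolding upward_quotient_def
    by (subst SUP_mult_left_ennreal[symmetric], subst nn_integral_monotone_convergence_SUP[symmetric, OF inc])
       (simp_all only: sup, measurable)
  then have "y < (SUP n. upward_quotient i0 v h (s - 1 / real (Suc n)))"
    using k by (simp only: h_def)
  then obtain n where "y < upward_quotient i0 v h (s - 1 / real (Suc n))"
    unfolding less_SUP_iff by blast
  also have "\<dots> \<le> positive_variation i0 v (s - 1 / real (Suc n))"
    unfolding positive_variation_def h_def by (rule SUP_upper) simp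
  finally show ?thesis by (intro exI[of _ "s - 1 / real (Suc n)"]) auto
qed

section \<open>One-dimensional weak derivatives\<close>

lemma indicator_less_if: "indicator {i0<..<s - h} \<sigma> = (if i0 < \<sigma> \<and> \<sigma> < s - h then 1 else (0::'a::zero_neq_one))"
  for s :: real
  by (auto simp: indicator_def)

lemma upward_quotient_measurable_pair:
  assumes [measurable]: "v \<in> borel_measurable borel"
  shows "(\<lambda>x::real \<times> real. upward_quotient i0 (\<lambda>\<sigma>. v (\<sigma>, snd x)) h (fst x)) \<in> borel_measurable borel"
proof -
  have [measurable]: "v \<in> borel_measurable (borel \<Otimes>\<^sub>M borel)" by (simp add: borel_prod)
  show ?thesis
    unfolding upward_quotient_def borel_prod[symmetric] indicator_less_if by measurable
qed

lemma positive_variation_measurable_pair: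
  assumes "v \<in> borel_measurable borel"
  shows "(\<lambda>x::real \<times> real. positive_variation i0 (\<lambda>\<sigma>. v (\<sigma>, snd x)) (fst x)) \<in> borel_measurable borel"
  unfolding positive_variation_def
  by (intro borel_measurable_SUP upward_quotient_measurable_pair assms) auto

lemma upward_quotient_measurable:
  assumes [measurable]: "v \<in> borel_measurable borel"
  shows "upward_quotient i0 v h \<in> borel_measurable borel"
  unfolding upward_quotient_def[abs_def] indicator_less_if by measurable

lemma positive_variation_measurable:
  assumes "v \<in> borel_measurable borel"
  shows "positive_variation i0 v \<in> borel_measurable borel"
  unfolding positive_variation_def[abs_def]
  by (intro borel_measurable_SUP upward_quotient_measurable assms) auto

text \<open>\<open>f\<close> is continuously differentiable with derivative \<open>f'\<close> and has compact support strictly between \<open>i0\<close> and \<open>i1\<close>.\<close>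

definition compact_profile :: "real \<Rightarrow> real \<Rightarrow> (real \<Rightarrow> real) \<Rightarrow> (real \<Rightarrow> real) \<Rightarrow> bool" where
  "compact_profile i0 i1 f f' \<longleftrightarrow> (\<forall>s. (f has_real_derivative f' s) (at s)) \<and> (\<forall>s. isCont f' s) \<and>
     (\<exists>\<eta>>0. \<forall>s. s \<le> i0 + \<eta> \<or> i1 - \<eta> \<le> s \<longrightarrow> f s = 0)"

lemma compact_profile_props:
  assumes f: "compact_profile i0 i1 f f'" and i: "i0 < i1"
  shows "f \<in> borel_measurable borel" "f' \<in> borel_measurable borel"
    and "s \<le> i0 \<or> i1 \<le> s \<Longrightarrow> f s = 0" and "s \<le> i0 \<or> i1 \<le> s \<Longrightarrow> f' s = 0"
    and "\<exists>D\<ge>0. (\<forall>s. \<bar>f' s\<bar> \<le> D) \<and> (\<forall>s. \<bar>f s\<bar> \<le> D) \<and> (\<forall>s s'. \<bar>f s - f s'\<bar> \<le> D * \<bar>s - s'\<bar>)"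
    and "i0 \<le> q \<Longrightarrow> (\<integral>s. indicator {q<..<i1} s * f' s \<partial>lborel) = - f q"
proof -
  have d: "\<And>s. (f has_real_derivative f' s) (at s)" and c: "\<And>s. isCont f' s"
    using f by (auto simp: compact_profile_def)
  obtain \<eta> where \<eta>: "\<eta> > 0" "\<And>s. s \<le> i0 + \<eta> \<or> i1 - \<eta> \<le> s \<Longrightarrow> f s = 0"
    using f by (auto simp: compact_profile_def)
  have cf: "continuous_on UNIV f" by (intro continuous_at_imp_continuous_on ballI DERIV_isCont[OF d])
  have cf': "continuous_on UNIV f'" using c by (simp add: continuous_at_imp_continuous_on)
  show fm[measurable]: "f \<in> borel_measurable borel" and f'm[measurable]: "f' \<in> borel_measurable borel"
    using cf cf' by (auto intro: borel_measurable_continuous_onI)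
  show f0: "f s = 0" if "s \<le> i0 \<or> i1 \<le> s" for s using \<eta> that by auto
  show f'0: "f' s = 0" if s: "s \<le> i0 \<or> i1 \<le> s" for s
  proof -
    have "eventually (\<lambda>x. x \<in> ball s \<eta>) (nhds s)" using \<eta>(1) by (intro eventually_nhds_in_open) auto
    then have "eventually (\<lambda>x. f x = 0) (nhds s)"
    proof (rule eventually_mono)
      fix x assume "x \<in> ball s \<eta>"
      then have "x \<le> i0 + \<eta> \<or> i1 - \<eta> \<le> x" using s by (auto simp: dist_real_def abs_less_iff)
      then show "f x = 0" by (rule \<eta>(2))
    qed
    then have "(f has_real_derivative 0) (at s)"
      by (subst DERIV_cong_ev[OF refl _ refl, of f "\<lambda>_. 0"]) auto
    then show ?thesis using d DERIV_unique by blast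
  qed
  have "compact (f' ` {i0..i1})"
    by (intro compact_continuous_image continuous_on_subset[OF cf']) auto
  then have "bounded (f' ` {i0..i1})" by (rule compact_imp_bounded)
  then obtain D1 where D1: "D1 > 0" "\<And>s. s \<in> {i0..i1} \<Longrightarrow> \<bar>f' s\<bar> \<le> D1" by (auto simp: bounded_pos)
  have D1': "\<bar>f' s\<bar> \<le> D1" for s
  proof (cases "s \<in> {i0..i1}")
    case False
    then have "f' s = 0" by (intro f'0) auto
    then show ?thesis using D1(1) by simp
  qed (use D1 in auto)
  have lip: "\<bar>f s - f s'\<bar> \<le> D1 * \<bar>s - s'\<bar>" for s s'
    using field_differentiable_bound[of UNIV f f' D1 s s'] d D1' by (simp add: has_field_derivative_at_within)
  have "\<bar>f s\<bar> \<le> D1 * (i1 - i0)" for s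
  proof (cases "s \<in> {i0..i1}")
    case True
    have "\<bar>f s\<bar> \<le> D1 * \<bar>s - i0\<bar>" using lip[of s i0] f0[of i0] by simp
    also have "\<dots> \<le> D1 * (i1 - i0)" using True D1 by (intro mult_left_mono) auto
    finally show ?thesis .
  next
    case False
    then have "f s = 0" by (intro f0) auto
    then show ?thesis using D1(1) i by simp
  qed
  then show "\<exists>D\<ge>0. (\<forall>s. \<bar>f' s\<bar> \<le> D) \<and> (\<forall>s. \<bar>f s\<bar> \<le> D) \<and> (\<forall>s s'. \<bar>f s - f s'\<bar> \<le> D * \<bar>s - s'\<bar>)"
  proof (intro exI[of _ "max D1 (D1 * (i1 - i0))"] conjI allI)
    fix s s'
    show "\<bar>f s - f s'\<bar> \<le> max D1 (D1 * (i1 - i0)) * \<bar>s - s'\<bar>"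
      by (rule order_trans[OF lip]) (intro mult_right_mono, auto)
  qed (use D1(1) D1' in \<open>auto intro: max.coboundedI1 max.coboundedI2\<close>)
  show "(\<integral>s. indicator {q<..<i1} s * f' s \<partial>lborel) = - f q" if q: "i0 \<le> q"
  proof (cases "q \<le> i1")
    case True
    have "(\<integral>s. indicator {q<..<i1} s * f' s \<partial>lborel) = (\<integral>s. f' s * indicator {q..i1} s \<partial>lborel)"
    proof (rule integral_cong_AE)
      show "AE s in lborel. indicator {q<..<i1} s * f' s = f' s * indicator {q..i1} s"
        using AE_lborel_singleton[of q] AE_lborel_singleton[of i1]
        by eventually_elim (auto simp: indicator_def)
    qed measurable
    also have "\<dots> = f i1 - f q"
      by (rule integral_FTC_Icc_real[OF True]) (use d c in auto)
    finally show ?thesis using f0[of i1] by simp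
  next
    case False
    then have "{q<..<i1} = {}" "f q = 0" using f0[of q] by auto
    then show ?thesis by simp
  qed
qed

lemma integral_lborel_translate_real:
  fixes f :: "real \<Rightarrow> real"
  shows "(\<integral>x. f (x + h) \<partial>lborel) = (\<integral>x. f x \<partial>lborel)"
  using lborel_integral_real_affine[of 1 f h] by (simp add: add.commute)

lemma upward_quotient_diff:
  assumes [measurable]: "v \<in> borel_measurable borel" and B: "\<And>s. \<bar>v s\<bar> \<le> B" and h: "h > 0"
  shows "enn2real (upward_quotient i0 v h s) - enn2real (upward_quotient i0 (\<lambda>s. - v s) h s)
     = (1 / h) * (\<integral>\<sigma>. indicator {i0<..<s - h} \<sigma> * (v (\<sigma> + h) - v \<sigma>) \<partial>lborel)"
proof -
  have "integrable lborel (\<lambda>\<sigma>. indicator {i0<..<s - h} \<sigma> * (v (\<sigma> + h) - v \<sigma>))"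
  proof (rule integrable_indicator_bounded)
    fix \<sigma> show "\<bar>v (\<sigma> + h) - v \<sigma>\<bar> \<le> 2 * B" using B[of "\<sigma> + h"] B[of \<sigma>] by linarith
  qed measurable
  from real_lebesgue_integral_def[OF this]
  have "(\<integral>\<sigma>. indicator {i0<..<s - h} \<sigma> * (v (\<sigma> + h) - v \<sigma>) \<partial>lborel) =
    enn2real (\<integral>\<^sup>+ \<sigma>. ennreal (v (\<sigma> + h) - v \<sigma>) * indicator {i0<..<s - h} \<sigma> \<partial>lborel) -
    enn2real (\<integral>\<^sup>+ \<sigma>. ennreal (- v (\<sigma> + h) - - v \<sigma>) * indicator {i0<..<s - h} \<sigma> \<partial>lborel)"
    by (simp, intro arg_cong2[where f = "(-)"] arg_cong[where f = enn2real] nn_integral_cong) (auto simp: indicator_def)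
  then show ?thesis
    using h by (simp add: upward_quotient_def enn2real_mult right_diff_distrib)
qed

text \<open>Discrete integration by parts, by Fubini's theorem.\<close>

lemma upward_quotient_weak_derivative:
  assumes vm[measurable]: "v \<in> borel_measurable borel" and B: "\<And>s. \<bar>v s\<bar> \<le> B" and h: "0 < h" "h \<le> \<eta>"
    and i: "i0 < i1" and f: "compact_profile i0 i1 f f'" and \<eta>: "\<And>s. s \<le> i0 + \<eta> \<or> i1 - \<eta> \<le> s \<Longrightarrow> f s = 0"
  shows "(\<integral>s. indicator {i0<..<i1} s * (f' s * (enn2real (upward_quotient i0 v h s) - enn2real (upward_quotient i0 (\<lambda>s. - v s) h s))) \<partial>lborel)
     = (\<integral>\<sigma>. v \<sigma> * ((f (\<sigma> + h) - f \<sigma>) / h) \<partial>lborel)"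
proof -
  have [measurable]: "f \<in> borel_measurable borel" "f' \<in> borel_measurable borel"
    using compact_profile_props[OF f i] by auto
  obtain D where D: "D \<ge> 0" "\<And>s. \<bar>f' s\<bar> \<le> D" "\<And>s. \<bar>f s\<bar> \<le> D"
    using compact_profile_props(5)[OF f i] by blast
  have f0: "f s = 0" if "s \<le> i0 \<or> i1 \<le> s" for s using compact_profile_props(3)[OF f i that] .
  let ?d = "\<lambda>\<sigma>. v (\<sigma> + h) - v \<sigma>"
  have db: "\<bar>?d \<sigma>\<bar> \<le> 2 * B" for \<sigma> using B[of "\<sigma> + h"] B[of \<sigma>] by linarith
  have B0: "0 \<le> B" using B[of 0] by linarith
  let ?F = "\<lambda>s \<sigma>. indicator {i0<..<i1} s * f' s * (indicator {i0<..<s - h} \<sigma> * ?d \<sigma>)"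
  have Fm: "(\<lambda>(s, \<sigma>). ?F s \<sigma>) \<in> borel_measurable (lborel \<Otimes>\<^sub>M lborel)"
    unfolding indicator_less_if by measurable
  have Fint: "integrable (lborel \<Otimes>\<^sub>M lborel) (\<lambda>(s, \<sigma>). ?F s \<sigma>)"
  proof (rule Bochner_Integration.integrable_bound[where f = "\<lambda>x. indicator ({i0<..<i1} \<times> {i0<..<i1}) x * (D * (2 * B))"])
    have "emeasure (lborel \<Otimes>\<^sub>M lborel) ({i0<..<i1} \<times> {i0<..<i1}) < \<infinity>"
      by (subst lborel.emeasure_pair_measure_Times) (use i in \<open>auto simp: ennreal_mult_less_top\<close>)
    then show "integrable (lborel \<Otimes>\<^sub>M lborel) (\<lambda>x. indicator ({i0<..<i1} \<times> {i0<..<i1}) x * (D * (2 * B)))"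
      by (intro integrable_mult_left integrable_real_indicator) auto
    have "\<bar>?F s \<sigma>\<bar> \<le> indicator ({i0<..<i1} \<times> {i0<..<i1}) (s, \<sigma>) * (D * (2 * B))" for s \<sigma>
    proof -
      have "\<bar>f' s * ?d \<sigma>\<bar> \<le> D * (2 * B)" unfolding abs_mult using D db by (intro mult_mono) auto
      then show ?thesis using h D B0 by (auto simp: indicator_def)
    qed
    then show "AE x in lborel \<Otimes>\<^sub>M lborel. norm (case x of (s, \<sigma>) \<Rightarrow> ?F s \<sigma>) \<le> norm (indicator ({i0<..<i1} \<times> {i0<..<i1}) x * (D * (2 * B)))"
      using D B0 by (auto simp: abs_mult split: prod.splits)
  qed (rule Fm)
  have fint: "integrable lborel (\<lambda>\<sigma>. u \<sigma> * f (\<sigma> + k))" if [measurable]: "u \<in> borel_measurable borel" and u: "\<And>s. \<bar>u s\<bar> \<le> B" for u k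
  proof (rule Bochner_Integration.integrable_bound[where f = "\<lambda>x. indicator {i0 - k..i1 - k} x * (B * D)"])
    show "integrable lborel (\<lambda>x. indicator {i0 - k..i1 - k} x * (B * D))"
      using emeasure_bounded_finite[of "{i0-k..i1-k}"]
      by (intro integrable_mult_left integrable_real_indicator) auto
    have "\<bar>u x * f (x + k)\<bar> \<le> indicator {i0 - k..i1 - k} x * (B * D)" for x
    proof (cases "x \<in> {i0 - k..i1 - k}")
      case True
      then show ?thesis unfolding abs_mult using u D B0 by (auto intro!: mult_mono)
    next
      case False
      then have "f (x + k) = 0" by (intro f0) auto
      then show ?thesis using D B0 by simp
    qed
    then show "AE x in lborel. norm (u x * f (x + k)) \<le> norm (indicator {i0 - k..i1 - k} x * (B * D))"
      using D B0 by (auto simp: abs_mult)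
  qed measurable
  have "(\<integral>s. indicator {i0<..<i1} s * (f' s * (enn2real (upward_quotient i0 v h s) - enn2real (upward_quotient i0 (\<lambda>s. - v s) h s))) \<partial>lborel)
      = (1 / h) * (\<integral>s. \<integral>\<sigma>. ?F s \<sigma> \<partial>lborel \<partial>lborel)"
    unfolding upward_quotient_diff[OF vm B h(1)] integral_mult_right_zero[symmetric]
    by (intro Bochner_Integration.integral_cong) (auto simp: mult_ac integral_mult_right_zero[symmetric] simp del: integral_mult_right_zero)
  also have "(\<integral>s. \<integral>\<sigma>. ?F s \<sigma> \<partial>lborel \<partial>lborel) = (\<integral>\<sigma>. \<integral>s. ?F s \<sigma> \<partial>lborel \<partial>lborel)"
    using lborel_pair.Fubini_integral[OF Fint] by simp
  also have "\<dots> = (\<integral>\<sigma>. v \<sigma> * f (\<sigma> + h) - v (\<sigma> + h) * f (\<sigma> + h) \<partial>lborel)"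
  proof (intro Bochner_Integration.integral_cong refl)
    fix \<sigma>
    show "(\<integral>s. ?F s \<sigma> \<partial>lborel) = v \<sigma> * f (\<sigma> + h) - v (\<sigma> + h) * f (\<sigma> + h)"
    proof (cases "i0 < \<sigma>")
      case True
      have "(\<integral>s. ?F s \<sigma> \<partial>lborel) = (\<integral>s. ?d \<sigma> * (indicator {\<sigma> + h<..<i1} s * f' s) \<partial>lborel)"
        using True h by (intro Bochner_Integration.integral_cong) (auto simp: indicator_def)
      also have "\<dots> = ?d \<sigma> * (- f (\<sigma> + h))"
        using compact_profile_props(6)[OF f i, of "\<sigma> + h"] True h by simp
      finally show ?thesis by (simp add: algebra_simps)
    next
      case False
      then have "f (\<sigma> + h) = 0" using \<eta> h by auto
      then show ?thesis using False by simp
    qed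
  qed
  also have "\<dots> = (\<integral>\<sigma>. v \<sigma> * f (\<sigma> + h) \<partial>lborel) - (\<integral>\<sigma>. v (\<sigma> + h) * f (\<sigma> + h) \<partial>lborel)"
    by (intro Bochner_Integration.integral_diff fint B) measurable
  also have "(\<integral>\<sigma>. v (\<sigma> + h) * f (\<sigma> + h) \<partial>lborel) = (\<integral>\<sigma>. v \<sigma> * f \<sigma> \<partial>lborel)"
    by (rule integral_lborel_translate_real)
  also have "(\<integral>\<sigma>. v \<sigma> * f (\<sigma> + h) \<partial>lborel) - (\<integral>\<sigma>. v \<sigma> * f \<sigma> \<partial>lborel) = (\<integral>\<sigma>. v \<sigma> * f (\<sigma> + h) - v \<sigma> * f \<sigma> \<partial>lborel)"
    using fint[OF vm B, of h] fint[OF vm B, of 0] by (intro Bochner_Integration.integral_diff[symmetric]) auto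
  also have "(1 / h) * \<dots> = (\<integral>\<sigma>. v \<sigma> * ((f (\<sigma> + h) - f \<sigma>) / h) \<partial>lborel)"
    unfolding integral_mult_right_zero[symmetric] by (intro Bochner_Integration.integral_cong) (auto simp: field_simps)
  finally show ?thesis .
qed

text \<open>The derivative of \<open>v\<close> in the sense of distributions is the derivative of its positive minus its negative
  variation. Let \<open>h = 1/2^k\<close> tend to 0 on both sides of the preceding identity.\<close>

lemma positive_variation_weak_derivative:
  assumes vm[measurable]: "v \<in> borel_measurable borel" and B: "\<And>s. \<bar>v s\<bar> \<le> B"
    and i: "i0 < i1" and f: "compact_profile i0 i1 f f'"
    and fin: "positive_variation i0 v i1 < \<infinity>" "positive_variation i0 (\<lambda>s. - v s) i1 < \<infinity>"
  shows "(\<integral>s. indicator {i0<..<i1} s * (v s * f' s) \<partial>lborel) =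
    (\<integral>s. indicator {i0<..<i1} s * (f' s * (enn2real (positive_variation i0 v s) - enn2real (positive_variation i0 (\<lambda>s. - v s) s))) \<partial>lborel)"
proof -
  have fm[measurable]: "f \<in> borel_measurable borel" "f' \<in> borel_measurable borel"
    using compact_profile_props[OF f i] by auto
  obtain D where D: "D \<ge> 0" "\<And>s. \<bar>f' s\<bar> \<le> D" "\<And>s. \<bar>f s\<bar> \<le> D" "\<And>s s'. \<bar>f s - f s'\<bar> \<le> D * \<bar>s - s'\<bar>"
    using compact_profile_props(5)[OF f i] by blast
  obtain \<eta> where \<eta>: "\<eta> > 0" "\<And>s. s \<le> i0 + \<eta> \<or> i1 - \<eta> \<le> s \<Longrightarrow> f s = 0"
    using f by (auto simp: compact_profile_def)
  have f0: "f s = 0" if "s \<le> i0 \<or> i1 \<le> s" for s using compact_profile_props(3)[OF f i that] .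
  have f'0: "f' s = 0" if "s \<le> i0 \<or> i1 \<le> s" for s using compact_profile_props(4)[OF f i that] .
  have B0: "0 \<le> B" using B[of 0] by linarith
  let ?v = "\<lambda>s. - v s"
  have vm'[measurable]: "?v \<in> borel_measurable borel" by measurable
  note [measurable] = upward_quotient_measurable positive_variation_measurable
  define h where "h k = (1 / 2 ^ k :: real)" for k :: nat
  have h: "h k > 0" "h k \<le> 1" for k by (auto simp: h_def field_simps)
  have hlim: "h \<longlonglongrightarrow> 0" unfolding h_def by real_asymp
  have conv: "(\<lambda>k. enn2real (upward_quotient i0 u (h k) s)) \<longlonglongrightarrow> enn2real (positive_variation i0 u s)"
    and le: "enn2real (upward_quotient i0 u (h k) s) \<le> enn2real (positive_variation i0 u i1)"
    if um: "u \<in> borel_measurable borel" and fin: "positive_variation i0 u i1 < \<infinity>" and s: "s < i1" for u s k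
  proof -
    have "positive_variation i0 u s < \<infinity>"
      using positive_variation_mono[of s i1 i0 u] s fin by (simp add: le_less_trans)
    then have e: "ennreal (enn2real (positive_variation i0 u s)) = positive_variation i0 u s" by simp
    have "(\<lambda>k. upward_quotient i0 u (h k) s) \<longlonglongrightarrow> positive_variation i0 u s"
      unfolding positive_variation_def h_def by (intro LIMSEQ_SUP upward_quotient_incseq um)
    then show "(\<lambda>k. enn2real (upward_quotient i0 u (h k) s)) \<longlonglongrightarrow> enn2real (positive_variation i0 u s)"
      by (intro tendsto_enn2real) (simp_all add: e)
    have "upward_quotient i0 u (h k) s \<le> positive_variation i0 u s"
      unfolding positive_variation_def h_def by (rule SUP_upper) simp
    also have "\<dots> \<le> positive_variation i0 u i1" using s by (intro positive_variation_mono) simp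
    finally show "enn2real (upward_quotient i0 u (h k) s) \<le> enn2real (positive_variation i0 u i1)"
      using fin by (intro enn2real_mono) auto
  qed
  define W where "W = enn2real (positive_variation i0 v i1) + enn2real (positive_variation i0 ?v i1)"
  have W0: "0 \<le> W" by (simp add: W_def)
  let ?G = "\<lambda>k s. indicator {i0<..<i1} s * (f' s * (enn2real (upward_quotient i0 v (h k) s) - enn2real (upward_quotient i0 ?v (h k) s)))"
  have 1: "(\<lambda>k. \<integral>s. ?G k s \<partial>lborel) \<longlonglongrightarrow>
    (\<integral>s. indicator {i0<..<i1} s * (f' s * (enn2real (positive_variation i0 v s) - enn2real (positive_variation i0 ?v s))) \<partial>lborel)"
  proof (rule integral_dominated_convergence[where w = "\<lambda>s. indicator {i0<..<i1} s * (D * W)"])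
    show "integrable lborel (\<lambda>s. indicator {i0<..<i1} s * (D * W))"
      by (rule integrable_indicator_bounded[where B = "\<bar>D * W\<bar>"]) auto
    show "AE s in lborel. (\<lambda>k. ?G k s) \<longlonglongrightarrow> indicator {i0<..<i1} s * (f' s * (enn2real (positive_variation i0 v s) - enn2real (positive_variation i0 ?v s)))"
    proof (rule AE_I2)
      fix s show "(\<lambda>k. ?G k s) \<longlonglongrightarrow> indicator {i0<..<i1} s * (f' s * (enn2real (positive_variation i0 v s) - enn2real (positive_variation i0 ?v s)))"
        by (cases "s \<in> {i0<..<i1}") (auto intro!: tendsto_mult tendsto_diff tendsto_const conv vm vm' fin)
    qed
    show "AE s in lborel. norm (?G k s) \<le> indicator {i0<..<i1} s * (D * W)" for k
    proof (rule AE_I2)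
      fix s show "norm (?G k s) \<le> indicator {i0<..<i1} s * (D * W)"
      proof (cases "s \<in> {i0<..<i1}")
        case True
        then have s1: "s < i1" by simp
        have "\<bar>enn2real (upward_quotient i0 v (h k) s) - enn2real (upward_quotient i0 ?v (h k) s)\<bar> \<le> W"
          using le[OF vm fin(1) s1, of k] le[OF vm' fin(2) s1, of k]
            enn2real_nonneg[of "upward_quotient i0 v (h k) s"] enn2real_nonneg[of "upward_quotient i0 ?v (h k) s"]
          unfolding W_def by linarith
        then have "\<bar>f' s\<bar> * \<bar>enn2real (upward_quotient i0 v (h k) s) - enn2real (upward_quotient i0 ?v (h k) s)\<bar> \<le> D * W"
          using D by (intro mult_mono) auto
        then show ?thesis using True by (simp add: abs_mult)
      qed simp
    qed
  qed measurable
  let ?H = "\<lambda>k s. v s * ((f (s + h k) - f s) / h k)"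
  have 2: "(\<lambda>k. \<integral>s. ?H k s \<partial>lborel) \<longlonglongrightarrow> (\<integral>s. v s * f' s \<partial>lborel)"
  proof (rule integral_dominated_convergence[where w = "\<lambda>s. indicator {i0 - 2<..<i1 + 1} s * (B * D)"])
    show "integrable lborel (\<lambda>s. indicator {i0 - 2<..<i1 + 1} s * (B * D))"
      by (rule integrable_indicator_bounded[where B = "\<bar>B * D\<bar>"]) auto
    show "AE s in lborel. (\<lambda>k. ?H k s) \<longlonglongrightarrow> v s * f' s"
    proof (rule AE_I2, intro tendsto_intros)
      fix s
      have "((\<lambda>h. (f (s + h) - f s) / h) \<longlongrightarrow> f' s) (at 0)"
        using f by (simp add: compact_profile_def DERIV_def)
      moreover have "filterlim h (at 0) sequentially"
        using hlim h by (auto simp: filterlim_at less_imp_neq[symmetric] intro!: always_eventually)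
      ultimately show "(\<lambda>k. (f (s + h k) - f s) / h k) \<longlonglongrightarrow> f' s" by (rule filterlim_compose)
    qed
    show "AE s in lborel. norm (?H k s) \<le> indicator {i0 - 2<..<i1 + 1} s * (B * D)" for k
    proof (rule AE_I2)
      fix s show "norm (?H k s) \<le> indicator {i0 - 2<..<i1 + 1} s * (B * D)"
      proof (cases "s \<in> {i0 - 2<..<i1 + 1}")
        case True
        have "\<bar>f (s + h k) - f s\<bar> / h k \<le> D" using D(4)[of "s + h k" s] h[of k] by (simp add: divide_le_eq)
        then have "\<bar>v s\<bar> * (\<bar>f (s + h k) - f s\<bar> / h k) \<le> B * D"
          using B D h[of k] B0 by (intro mult_mono) auto
        then show ?thesis using True h[of k] by (simp add: abs_mult)
      next
        case False
        then have "f s = 0" "f (s + h k) = 0" using h[of k] by (auto intro!: f0)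
        then show ?thesis using B0 D by simp
      qed
    qed
  qed measurable
  have "eventually (\<lambda>k. h k < \<eta>) sequentially" using hlim \<eta>(1) by (rule order_tendstoD)
  then have "eventually (\<lambda>k. (\<integral>s. ?G k s \<partial>lborel) = (\<integral>s. ?H k s \<partial>lborel)) sequentially"
    by eventually_elim (intro upward_quotient_weak_derivative[OF vm B h(1) _ i f \<eta>(2)], auto)
  then have "(\<lambda>k. \<integral>s. ?H k s \<partial>lborel) \<longlonglongrightarrow>
    (\<integral>s. indicator {i0<..<i1} s * (f' s * (enn2real (positive_variation i0 v s) - enn2real (positive_variation i0 ?v s))) \<partial>lborel)"
    using 1 by (rule Lim_transform_eventually[rotated])
  from LIMSEQ_unique[OF 2 this]
  have "(\<integral>s. v s * f' s \<partial>lborel) =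
    (\<integral>s. indicator {i0<..<i1} s * (f' s * (enn2real (positive_variation i0 v s) - enn2real (positive_variation i0 ?v s))) \<partial>lborel)" .
  moreover have "indicator {i0<..<i1} s * (v s * f' s) = v s * f' s" for s
    using f'0[of s] by (cases "s \<in> {i0<..<i1}") auto
  ultimately show ?thesis by (simp only:)
qed

section \<open>Measures with prescribed monotone sections\<close>

lemma emeasure_below_ennreal: "emeasure lborel {y. 0 \<le> y \<and> ennreal y < a} = a"
proof (cases a)
  case (real r)
  have "{y. 0 \<le> y \<and> ennreal y < a} = {0..<r}"
    using real by (auto simp: ennreal_less_iff)
  then show ?thesis using real by simp
next
  case top
  have "{y. 0 \<le> y \<and> ennreal y < a} = {0::real..}" using top by (auto simp: less_top[symmetric])
  moreover have "emeasure lborel {0::real..} = \<infinity>"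
  proof (rule ccontr)
    assume "emeasure lborel {0::real..} \<noteq> \<infinity>"
    then obtain n where n: "emeasure lborel {0::real..} < of_nat n"
      using ennreal_Ex_less_of_nat[of "emeasure lborel {0::real..}"] by (auto simp: less_top)
    have "of_nat n = emeasure lborel {0..real n}" by (simp add: ennreal_of_nat_eq_real_of_nat)
    also have "\<dots> \<le> emeasure lborel {0::real..}" by (rule emeasure_mono) auto
    finally show False using n by simp
  qed
  ultimately show ?thesis using top by simp
qed

lemma nn_integral_below_ennreal:
  "(\<integral>\<^sup>+ y. c * indicator {y. 0 \<le> y \<and> ennreal y < a} y \<partial>lborel) = c * a"
proof -
  have "{y. 0 \<le> y \<and> ennreal y < a} \<in> sets lborel" by measurable
  then show ?thesis by (simp add: nn_integral_cmult_indicator emeasure_below_ennreal)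
qed

text \<open>For \<open>p = (t, y)\<close>, the infimum of the points \<open>r\<close> at which \<open>A(\<cdot>, t)\<close> exceeds \<open>y\<close>. Restricting \<open>r\<close> to rationals makes
  the map measurable; the value \<open>i1\<close> stands for the empty set.\<close>

definition section_quantile :: "real \<Rightarrow> real \<Rightarrow> (real \<times> real \<Rightarrow> ennreal) \<Rightarrow> real \<times> real \<Rightarrow> real" where
  "section_quantile i0 i1 A p = (INF r\<in>\<rat> \<inter> {i0<..<i1}. if ennreal (snd p) < A (r, fst p) then r else i1)"

context
  fixes A :: "real \<times> real \<Rightarrow> ennreal" and i0 i1 :: real
  assumes i: "i0 < i1" and Am[measurable]: "A \<in> borel_measurable borel"
    and mono: "\<And>s s' t. s \<le> s' \<Longrightarrow> A (s, t) \<le> A (s', t)"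
    and zero: "\<And>s t. s \<le> i0 \<Longrightarrow> A (s, t) = 0"
    and lc: "\<And>y s t. y < A (s, t) \<Longrightarrow> \<exists>r<s. y < A (r, t)"
begin

lemma section_quantile_bounds:
  shows "bdd_below ((\<lambda>r. if ennreal (snd p) < A (r, fst p) then r else i1) ` (\<rat> \<inter> {i0<..<i1}))"
    and "\<rat> \<inter> {i0<..<i1} \<noteq> {}"
    and "i0 \<le> section_quantile i0 i1 A p"
proof -
  show b: "bdd_below ((\<lambda>r. if ennreal (snd p) < A (r, fst p) then r else i1) ` (\<rat> \<inter> {i0<..<i1}))"
    using i by (intro bdd_belowI2[of _ i0]) auto
  obtain r where "r \<in> \<rat>" "i0 < r" "r < i1" using Rats_dense_in_real[OF i] by auto
  then show n: "\<rat> \<inter> {i0<..<i1} \<noteq> {}" by auto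
  show "i0 \<le> section_quantile i0 i1 A p"
    unfolding section_quantile_def using n i by (intro cINF_greatest) auto
qed

text \<open>Left continuity and monotonicity of the sections make the quantile map a generalised inverse.\<close>

lemma section_quantile_less_iff:
  assumes s: "i0 < s" "s \<le> i1"
  shows "section_quantile i0 i1 A p < s \<longleftrightarrow> ennreal (snd p) < A (s, fst p)"
proof
  assume "section_quantile i0 i1 A p < s"
  then obtain r where "r \<in> \<rat> \<inter> {i0<..<i1}" "(if ennreal (snd p) < A (r, fst p) then r else i1) < s"
    unfolding section_quantile_def using cINF_less_iff[OF section_quantile_bounds(2,1)] by blast
  then have "ennreal (snd p) < A (r, fst p)" "r < s" using s by (auto split: if_splits)
  then show "ennreal (snd p) < A (s, fst p)" using mono[of r s "fst p"] by (simp add: less_le_trans)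
next
  assume "ennreal (snd p) < A (s, fst p)"
  then obtain r' where r': "r' < s" "ennreal (snd p) < A (r', fst p)" using lc by blast
  then have "i0 < r'" using zero[of r' "fst p"] by (cases "r' \<le> i0") auto
  obtain r where r: "r \<in> \<rat>" "r' < r" "r < s" using Rats_dense_in_real[OF r'(1)] by auto
  have "ennreal (snd p) < A (r, fst p)" using r'(2) mono[of r' r "fst p"] r by (simp add: less_le_trans)
  moreover have "r \<in> \<rat> \<inter> {i0<..<i1}" using r \<open>i0 < r'\<close> s by auto
  ultimately show "section_quantile i0 i1 A p < s"
    unfolding section_quantile_def using r(3)
    by (subst cINF_less_iff[OF section_quantile_bounds(2,1)]) (auto intro!: bexI[of _ r])
qed

lemma section_quantile_measurable [measurable]: "section_quantile i0 i1 A \<in> borel_measurable borel"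
proof -
  have [measurable]: "A \<in> borel_measurable (borel \<Otimes>\<^sub>M borel)" by (simp add: borel_prod)
  have "(\<lambda>p. if ennreal (snd p) < A (r, fst p) then r else i1) \<in> borel_measurable (borel \<Otimes>\<^sub>M borel)" for r
    by measurable
  then show ?thesis
    unfolding section_quantile_def[abs_def] borel_prod[symmetric]
    by (intro borel_measurable_cINF section_quantile_bounds countable_Int1 countable_rat)
       (auto simp: borel_prod)
qed

text \<open>By Fubini's theorem: for fixed \<open>s\<close> and \<open>t\<close>, the set of \<open>y \<ge> 0\<close> whose quantile is less than \<open>s\<close> is the interval from 0 to
  \<open>A(s, t)\<close>.\<close>

lemma nn_integral_section_quantile:
  fixes \<phi> :: "real \<times> real \<Rightarrow> ennreal"
  assumes [measurable]: "\<phi> \<in> borel_measurable borel"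
  shows "(\<integral>\<^sup>+ p. (\<integral>\<^sup>+ s. \<phi> (s, fst p) * indicator {section_quantile i0 i1 A p<..<i1} s \<partial>lborel)
             * indicator ({j0<..<j1} \<times> {0..}) p \<partial>lborel)
     = (\<integral>\<^sup>+ x. \<phi> x * A x * indicator ({i0<..<i1} \<times> {j0<..<j1}) x \<partial>lborel)"
proof -
  let ?q = "section_quantile i0 i1 A"
  have [measurable]: "\<phi> \<in> borel_measurable (borel \<Otimes>\<^sub>M borel)" "A \<in> borel_measurable (borel \<Otimes>\<^sub>M borel)"
    "?q \<in> borel_measurable (borel \<Otimes>\<^sub>M borel)"
    by (simp_all add: borel_prod)
  have S[measurable]: "{j0<..<j1} \<times> {0::real..} \<in> sets (borel \<Otimes>\<^sub>M borel)" by (intro pair_measureI) auto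
  let ?F = "\<lambda>p s. \<phi> (s, fst p) * (if ?q p < s \<and> s < i1 then 1 else 0) * indicator ({j0<..<j1} \<times> {0..}) p"
  have "(\<lambda>(s, p). ?F p s) \<in> borel_measurable (borel \<Otimes>\<^sub>M (borel \<Otimes>\<^sub>M borel))" by measurable
  then have m: "(\<lambda>(s, p). ?F p s) \<in> borel_measurable (lborel \<Otimes>\<^sub>M lborel)"
    unfolding borel_prod by (subst measurable_cong_sets[OF sets_pair_measure_cong[OF sets_lborel sets_lborel] refl])
      (simp add: borel_prod)
  have ind: "indicator {?q p<..<i1} s = (if ?q p < s \<and> s < i1 then 1 else (0::ennreal))" for p s
    by (auto simp: indicator_def)
  have "(\<integral>\<^sup>+ p. (\<integral>\<^sup>+ s. \<phi> (s, fst p) * indicator {?q p<..<i1} s \<partial>lborel) * indicator ({j0<..<j1} \<times> {0..}) p \<partial>lborel)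
     = (\<integral>\<^sup>+ p. \<integral>\<^sup>+ s. ?F p s \<partial>lborel \<partial>lborel)"
    unfolding ind by (intro nn_integral_cong nn_integral_multc[symmetric]) measurable
  also have "\<dots> = (\<integral>\<^sup>+ s. \<integral>\<^sup>+ p. ?F p s \<partial>lborel \<partial>lborel)"
    by (rule lborel_pair.Fubini'[OF m])
  also have "\<dots> = (\<integral>\<^sup>+ s. \<integral>\<^sup>+ t. \<phi> (s, t) * A (s, t) * indicator ({i0<..<i1} \<times> {j0<..<j1}) (s, t) \<partial>lborel \<partial>lborel)"
  proof (rule nn_integral_cong)
    fix s
    have ms: "(\<lambda>p. ?F p s) \<in> borel_measurable borel" unfolding borel_prod[symmetric] by measurable
    have "(\<integral>\<^sup>+ p. ?F p s \<partial>lborel) = (\<integral>\<^sup>+ t. \<integral>\<^sup>+ y. ?F (t, y) s \<partial>lborel \<partial>lborel)"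
      by (rule nn_integral_lborel_pair(1)[OF ms])
    also have "\<dots> = (\<integral>\<^sup>+ t. \<phi> (s, t) * A (s, t) * indicator ({i0<..<i1} \<times> {j0<..<j1}) (s, t) \<partial>lborel)"
    proof (rule nn_integral_cong)
      fix t
      have "?F (t, y) s = \<phi> (s, t) * indicator ({i0<..<i1} \<times> {j0<..<j1}) (s, t) * indicator {y. 0 \<le> y \<and> ennreal y < A (s, t)} y" for y
      proof (cases "i0 < s \<and> s < i1")
        case True
        then show ?thesis using section_quantile_less_iff[of s "(t, y)"] by (auto simp: indicator_def)
      next
        case False
        then show ?thesis using section_quantile_bounds(3)[of "(t, y)"] by (auto simp: indicator_def)
      qed
      then have "(\<integral>\<^sup>+ y. ?F (t, y) s \<partial>lborel) = \<phi> (s, t) * indicator ({i0<..<i1} \<times> {j0<..<j1}) (s, t) * A (s, t)"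
        by (simp only: nn_integral_below_ennreal)
      then show "(\<integral>\<^sup>+ y. ?F (t, y) s \<partial>lborel) = \<phi> (s, t) * A (s, t) * indicator ({i0<..<i1} \<times> {j0<..<j1}) (s, t)"
        by (simp only: mult_ac)
    qed
    finally show "(\<integral>\<^sup>+ p. ?F p s \<partial>lborel) = (\<integral>\<^sup>+ t. \<phi> (s, t) * A (s, t) * indicator ({i0<..<i1} \<times> {j0<..<j1}) (s, t) \<partial>lborel)" .
  qed
  also have "\<dots> = (\<integral>\<^sup>+ x. \<phi> x * A x * indicator ({i0<..<i1} \<times> {j0<..<j1}) x \<partial>lborel)"
  proof (rule nn_integral_lborel_pair(1)[symmetric])
    show "(\<lambda>x. \<phi> x * A x * indicator ({i0<..<i1} \<times> {j0<..<j1}) x) \<in> borel_measurable borel"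
      unfolding borel_prod[symmetric] by measurable
  qed
  finally show ?thesis .
qed

lemma nn_integral_monotone_sections_le:
  assumes fin: "(\<integral>\<^sup>+ t. A (i1, t) * indicator {j0<..<j1} t \<partial>lborel) \<le> ennreal m"
  shows "(\<integral>\<^sup>+ x. A x * indicator ({i0<..<i1} \<times> {j0<..<j1}) x \<partial>lborel) \<le> ennreal m * ennreal (i1 - i0)"
proof -
  let ?R = "{i0<..<i1} \<times> {j0<..<j1}"
  have R[measurable]: "?R \<in> sets borel" unfolding borel_prod[symmetric] by measurable
    have "(\<integral>\<^sup>+ x. A x * indicator ?R x \<partial>lborel) = (\<integral>\<^sup>+ s. \<integral>\<^sup>+ t. A (s, t) * indicator ?R (s, t) \<partial>lborel \<partial>lborel)"
      using R by (intro nn_integral_lborel_pair(1)) measurable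
    also have "\<dots> \<le> (\<integral>\<^sup>+ s. (\<integral>\<^sup>+ t. A (i1, t) * indicator {j0<..<j1} t \<partial>lborel) * indicator {i0<..<i1} s \<partial>lborel)"
    proof (rule nn_integral_mono)
      fix s show "(\<integral>\<^sup>+ t. A (s, t) * indicator ?R (s, t) \<partial>lborel) \<le> (\<integral>\<^sup>+ t. A (i1, t) * indicator {j0<..<j1} t \<partial>lborel) * indicator {i0<..<i1} s"
        by (cases "s \<in> {i0<..<i1}") (auto intro!: nn_integral_mono mult_mono mono simp: indicator_def)
    qed
    also have "\<dots> \<le> (\<integral>\<^sup>+ s. ennreal m * indicator {i0<..<i1} s \<partial>lborel)"
      by (intro nn_integral_mono mult_right_mono fin) auto
    also have "\<dots> = ennreal m * ennreal (i1 - i0)" using i by (simp add: nn_integral_cmult_indicator)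
    finally show ?thesis .
qed

text \<open>The measure on the rectangle with distribution function \<open>A(\<cdot>, t)\<close> on the line through \<open>t\<close>, integrated over \<open>t\<close>. It is the
  image of Lebesgue measure under the quantile map.\<close>

lemma monotone_sections_measure:
  assumes fin: "(\<integral>\<^sup>+ t. A (i1, t) * indicator {j0<..<j1} t \<partial>lborel) \<le> ennreal m"
  shows "\<exists>P. finite_measure P \<and> sets P = sets (restrict_space borel ({i0<..<i1} \<times> {j0<..<j1})) \<and>
    emeasure P ({i0<..<i1} \<times> {j0<..<j1}) \<le> ennreal m \<and>
    (\<forall>f f' D. f \<in> borel_measurable borel \<longrightarrow> f' \<in> borel_measurable borel \<longrightarrow> (\<forall>x. \<bar>f' x\<bar> \<le> D) \<longrightarrow>
      (\<forall>t. compact_profile i0 i1 (\<lambda>s. f (s, t)) (\<lambda>s. f' (s, t))) \<longrightarrow>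
      (\<integral>x. f x \<partial>P) = - (\<integral>x. indicator ({i0<..<i1} \<times> {j0<..<j1}) x * (f' x * enn2real (A x)) \<partial>lborel))"
proof -
  let ?q = "section_quantile i0 i1 A" and ?R = "{i0<..<i1} \<times> {j0<..<j1}"
  have R[measurable]: "?R \<in> sets borel" unfolding borel_prod[symmetric] by measurable
  \<comment> \<open>Quantiles equal to \<open>i0\<close> are left out; the functions \<open>f\<close> below vanish there.\<close>
  define Z where "Z = {p. j0 < fst p \<and> fst p < j1 \<and> 0 \<le> snd p \<and> i0 < ?q p \<and> ?q p < i1}"
  define T where "T p = (?q p, fst p)" for p :: "real \<times> real"
  have qm[measurable]: "?q \<in> borel_measurable (borel \<Otimes>\<^sub>M borel)" by (simp add: borel_prod)
  have Am'[measurable]: "A \<in> borel_measurable (borel \<Otimes>\<^sub>M borel)" by (simp add: borel_prod)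
  have "{p \<in> space (borel \<Otimes>\<^sub>M borel). j0 < fst p \<and> fst p < j1 \<and> 0 \<le> snd p \<and> i0 < ?q p \<and> ?q p < i1} \<in> sets (borel \<Otimes>\<^sub>M borel)"
    by measurable
  then have Z[measurable]: "Z \<in> sets borel" unfolding borel_prod by (simp add: Z_def)
  have "T \<in> measurable (borel \<Otimes>\<^sub>M borel) (borel \<Otimes>\<^sub>M borel)" unfolding T_def by measurable
  then have Tm[measurable]: "T \<in> measurable borel borel" by (simp add: borel_prod)
  have TR: "T \<in> measurable (restrict_space lborel Z) (restrict_space borel ?R)"
    by (intro measurable_restrict_space2 measurable_restrict_space1) (auto simp: T_def Z_def space_restrict_space)
  define P where "P = distr (restrict_space lborel Z) (restrict_space borel ?R) T"
  have sP: "sets P = sets (restrict_space borel ?R)" by (simp add: P_def)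
  have spP: "space P = ?R" by (simp add: P_def space_restrict_space)
  have pre: "T -` ?R \<inter> Z = Z" by (auto simp: T_def Z_def)
  have "emeasure P ?R = emeasure lborel Z"
    unfolding P_def by (subst emeasure_distr[OF TR])
      (auto simp: sets_restrict_space R emeasure_restrict_space space_restrict_space pre)
  also have "\<dots> = (\<integral>\<^sup>+ p. indicator Z p \<partial>lborel)" by simp
  also have "\<dots> = (\<integral>\<^sup>+ t. \<integral>\<^sup>+ y. indicator Z (t, y) \<partial>lborel \<partial>lborel)"
    by (rule nn_integral_lborel_pair(1)) measurable
  also have "\<dots> \<le> (\<integral>\<^sup>+ t. A (i1, t) * indicator {j0<..<j1} t \<partial>lborel)"
  proof (rule nn_integral_mono)
    fix t
    have "(\<integral>\<^sup>+ y. indicator Z (t, y) \<partial>lborel) \<le> (\<integral>\<^sup>+ y. indicator {j0<..<j1} t * indicator {y. 0 \<le> y \<and> ennreal y < A (i1, t)} y \<partial>lborel)"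
      using section_quantile_less_iff[of i1 "(t, _)"] i
      by (intro nn_integral_mono) (auto simp: Z_def indicator_def)
    then show "(\<integral>\<^sup>+ y. indicator Z (t, y) \<partial>lborel) \<le> A (i1, t) * indicator {j0<..<j1} t"
      by (simp only: nn_integral_below_ennreal mult.commute)
  qed
  also note fin
  finally have mass: "emeasure P ?R \<le> ennreal m" .
  then have "emeasure P (space P) \<noteq> \<infinity>" unfolding spP using ennreal_less_top[of m] by (auto simp: top_unique)
  then have finP: "finite_measure P" by (rule finite_measureI)
  note XA = nn_integral_monotone_sections_le[OF fin]
  have AEfin: "AE x in lborel. A x * indicator ?R x \<noteq> \<infinity>"
  proof (rule nn_integral_PInf_AE)
    show "(\<lambda>x. A x * indicator ?R x) \<in> borel_measurable lborel" using R by measurable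
    show "(\<integral>\<^sup>+ x. A x * indicator ?R x \<partial>lborel) \<noteq> \<infinity>"
      using XA by (auto simp: ennreal_mult_eq_top_iff top_unique)
  qed
  have "(\<integral>x. f x \<partial>P) = - (\<integral>x. indicator ?R x * (f' x * enn2real (A x)) \<partial>lborel)"
    if fm[measurable]: "f \<in> borel_measurable borel" and f'm[measurable]: "f' \<in> borel_measurable borel"
      and D: "\<And>x. \<bar>f' x\<bar> \<le> D" and cp: "\<And>t. compact_profile i0 i1 (\<lambda>s. f (s, t)) (\<lambda>s. f' (s, t))" for f f' D
  proof -
    have [measurable]: "f' \<in> borel_measurable (borel \<Otimes>\<^sub>M borel)" by (simp add: borel_prod)
    define G where "G \<phi> p = (\<integral>\<^sup>+ s. ennreal (\<phi> (s, fst p)) * indicator {?q p<..<i1} s \<partial>lborel)" for \<phi> p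
    define X where "X \<phi> = (\<integral>\<^sup>+ x. ennreal (\<phi> x) * A x * indicator ?R x \<partial>lborel)" for \<phi>
    let ?S = "{j0<..<j1} \<times> {0::real..}"
    have S[measurable]: "?S \<in> sets borel" unfolding borel_prod[symmetric] by measurable
    have key: "integrable lborel (\<lambda>p. enn2real (G \<phi> p) * indicator ?S p)"
      "(\<integral>p. enn2real (G \<phi> p) * indicator ?S p \<partial>lborel) = enn2real (X \<phi>)"
      "X \<phi> < \<infinity>" "G \<phi> p < \<infinity>"
      if \<phi>[measurable]: "\<phi> \<in> borel_measurable borel" and b: "\<And>x. \<bar>\<phi> x\<bar> \<le> D" for \<phi> p
    proof -
      have [measurable]: "\<phi> \<in> borel_measurable (borel \<Otimes>\<^sub>M borel)" by (simp add: borel_prod)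
      have ind: "indicator {?q p<..<i1} s = (if ?q p < s \<and> s < i1 then 1 else (0::ennreal))" for p s
        by (auto simp: indicator_def)
      have Gm[measurable]: "G \<phi> \<in> borel_measurable borel"
        unfolding G_def[abs_def] ind borel_prod[symmetric] by measurable
      have Gf: "G \<phi> p < \<infinity>" for p
      proof -
        have "G \<phi> p \<le> (\<integral>\<^sup>+ s. ennreal D * indicator {?q p<..<i1} s \<partial>lborel)"
          unfolding G_def by (intro nn_integral_mono mult_right_mono ennreal_leI) (use b in \<open>auto simp: abs_le_iff\<close>)
        also have "\<dots> = ennreal D * emeasure lborel {?q p<..<i1}" by (simp add: nn_integral_cmult_indicator)
        also have "\<dots> < \<infinity>" using emeasure_bounded_finite[of "{?q p<..<i1}"] by (simp add: ennreal_mult_less_top)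
        finally show ?thesis .
      qed
      then show "G \<phi> p < \<infinity>" .
      have "X \<phi> \<le> (\<integral>\<^sup>+ x. ennreal D * (A x * indicator ?R x) \<partial>lborel)"
        unfolding X_def mult.assoc by (intro nn_integral_mono mult_right_mono ennreal_leI) (use b in \<open>auto simp: abs_le_iff\<close>)
      also have "\<dots> = ennreal D * (\<integral>\<^sup>+ x. A x * indicator ?R x \<partial>lborel)"
        using R by (intro nn_integral_cmult) measurable
      also have "\<dots> \<le> ennreal D * (ennreal m * ennreal (i1 - i0))" by (intro mult_left_mono XA) auto
      also have "\<dots> < \<infinity>" by (simp add: ennreal_mult_less_top)
      finally show Xf: "X \<phi> < \<infinity>" .
      have eq: "(\<integral>\<^sup>+ p. ennreal (enn2real (G \<phi> p) * indicator ?S p) \<partial>lborel) = X \<phi>"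
      proof -
        have "ennreal (enn2real (G \<phi> p) * indicator ?S p) = G \<phi> p * indicator ?S p" for p
          using Gf[of p] by (auto simp: indicator_def)
        then have "(\<integral>\<^sup>+ p. ennreal (enn2real (G \<phi> p) * indicator ?S p) \<partial>lborel) = (\<integral>\<^sup>+ p. G \<phi> p * indicator ?S p \<partial>lborel)"
          by simp
        also have "\<dots> = X \<phi>" unfolding G_def X_def
          by (rule nn_integral_section_quantile) measurable
        finally show ?thesis .
      qed
      show "integrable lborel (\<lambda>p. enn2real (G \<phi> p) * indicator ?S p)"
        by (rule integrableI_nonneg) (use eq Xf in auto)
      show "(\<integral>p. enn2real (G \<phi> p) * indicator ?S p \<partial>lborel) = enn2real (X \<phi>)"
        by (subst integral_eq_nn_integral) (auto simp: eq)
    qed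
    have mneg: "(\<lambda>x. - f' x) \<in> borel_measurable borel" by measurable
    have bneg: "\<bar>- f' x\<bar> \<le> D" for x using D by simp
    have pw: "indicator Z p *\<^sub>R f (T p) = enn2real (G (\<lambda>x. - f' x) p) * indicator ?S p - enn2real (G f' p) * indicator ?S p" for p
    proof -
      have q0: "i0 \<le> ?q p" by (rule section_quantile_bounds)
      have fs: "indicator Z p *\<^sub>R f (T p) = indicator ?S p * f (?q p, fst p)"
      proof (cases "i0 < ?q p \<and> ?q p < i1")
        case True
        then show ?thesis by (auto simp: indicator_def Z_def T_def mem_Times_iff)
      next
        case False
        then have "f (?q p, fst p) = 0"
          using q0 by (intro compact_profile_props(3)[OF cp i]) auto
        then show ?thesis by (simp add: T_def)
      qed
      have "integrable lborel (\<lambda>s. indicator {?q p<..<i1} s * f' (s, fst p))"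
        by (rule integrable_indicator_bounded[OF _ D]) measurable
      from real_lebesgue_integral_def[OF this]
      have "(\<integral>s. indicator {?q p<..<i1} s * f' (s, fst p) \<partial>lborel) = enn2real (G f' p) - enn2real (G (\<lambda>x. - f' x) p)"
        unfolding G_def by (simp, intro arg_cong2[where f = "(-)"] arg_cong[where f = enn2real] nn_integral_cong) (auto simp: indicator_def)
      then have "f (?q p, fst p) = enn2real (G (\<lambda>x. - f' x) p) - enn2real (G f' p)"
        using compact_profile_props(6)[OF cp i q0, of "fst p"] by simp
      then show ?thesis unfolding fs by (cases "p \<in> ?S") simp_all
    qed
    have "(\<integral>x. f x \<partial>P) = (\<integral>p. f (T p) \<partial>restrict_space lborel Z)"
      unfolding P_def by (rule integral_distr[OF TR]) (auto intro: measurable_restrict_space1)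
    also have "\<dots> = (\<integral>p. indicator Z p *\<^sub>R f (T p) \<partial>lborel)"
      by (subst integral_restrict_space) auto
    also have "\<dots> = enn2real (X (\<lambda>x. - f' x)) - enn2real (X f')"
      unfolding pw using key(1,2)[OF mneg bneg] key(1,2)[OF f'm D] by simp
    also have "\<dots> = - (\<integral>x. indicator ?R x * (f' x * enn2real (A x)) \<partial>lborel)"
    proof -
      let ?g = "\<lambda>x. indicator ?R x * (f' x * enn2real (A x))"
      have gm[measurable]: "?g \<in> borel_measurable borel" using R by measurable
      have e1: "(\<integral>\<^sup>+ x. ennreal (?g x) \<partial>lborel) = X f'" unfolding X_def
        by (intro nn_integral_cong_AE, use AEfin in eventually_elim)
           (auto simp: indicator_def ennreal_mult'' less_top[symmetric])
      have neg: "ennreal (- (f' x * enn2real a)) = ennreal (- f' x) * ennreal (enn2real a)" for x a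
        using ennreal_mult''[of "enn2real a" "- f' x"] by simp
      have e2: "(\<integral>\<^sup>+ x. ennreal (- ?g x) \<partial>lborel) = X (\<lambda>x. - f' x)" unfolding X_def
        by (intro nn_integral_cong_AE, use AEfin in eventually_elim)
           (auto simp: indicator_def neg less_top[symmetric])
      have "integrable lborel ?g"
        unfolding real_integrable_def using e1 e2 key(3)[OF mneg bneg] key(3)[OF f'm D] gm
        by (simp add: less_top)
      from real_lebesgue_integral_def[OF this] show ?thesis unfolding e1 e2 by simp
    qed
    finally show ?thesis .
  qed
  then show ?thesis using finP sP mass by blast
qed

end

section \<open>From difference bounds to derivative measures\<close>

text \<open>By monotone convergence in \<open>h = 1/2^k\<close>.\<close>

lemma difference_bound_imp_variation_bound:
  fixes v :: "real \<times> real \<Rightarrow> real"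
  assumes vm[measurable]: "v \<in> borel_measurable borel" and L: "0 \<le> L"
    and H: "\<And>h. h > 0 \<Longrightarrow> (\<integral>\<^sup>+ x. ennreal \<bar>v (x + (h, 0)) - v x\<bar> * indicator ({i0<..<i1-h} \<times> {j0<..<j1}) x \<partial>lborel)
       \<le> ennreal (L * h)"
  shows "(\<integral>\<^sup>+ t. positive_variation i0 (\<lambda>s. v (s, t)) i1 * indicator {j0<..<j1} t \<partial>lborel)
    + (\<integral>\<^sup>+ t. positive_variation i0 (\<lambda>s. - v (s, t)) i1 * indicator {j0<..<j1} t \<partial>lborel) \<le> ennreal L"
proof -
  note [measurable] = section_measurable
  have vm'[measurable]: "v \<in> borel_measurable (borel \<Otimes>\<^sub>M borel)" by (simp add: borel_prod)
  define h where "h k = (1 / 2 ^ k :: real)" for k :: nat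
  have h: "h k > 0" for k by (simp add: h_def)
  define J where "J u k = (\<integral>\<^sup>+ t. upward_quotient i0 (\<lambda>s. u (s, t)) (h k) i1 * indicator {j0<..<j1} t \<partial>lborel)"
    for u :: "real \<times> real \<Rightarrow> real" and k
  have uqm: "(\<lambda>t. upward_quotient i0 (\<lambda>s. u (s, t)) c i1) \<in> borel_measurable borel"
    if "u \<in> borel_measurable borel" for u :: "real \<times> real \<Rightarrow> real" and c
  proof -
    have "(\<lambda>t. (i1, t)) \<in> measurable borel (borel :: (real \<times> real) measure)"
      by (intro borel_measurable_continuous_onI) (auto intro!: continuous_intros)
    from measurable_compose[OF this upward_quotient_measurable_pair[OF that]] show ?thesis by simp
  qed
  have sec: "(\<lambda>s. u (s, t)) \<in> borel_measurable borel" if "u \<in> borel_measurable borel" for u :: "real \<times> real \<Rightarrow> real" and t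
    using section_measurable(1)[OF that] .
  have SUP: "(\<integral>\<^sup>+ t. positive_variation i0 (\<lambda>s. u (s, t)) i1 * indicator {j0<..<j1} t \<partial>lborel) = (SUP k. J u k)"
    and inc: "incseq (J u)" if um: "u \<in> borel_measurable borel" for u :: "real \<times> real \<Rightarrow> real"
  proof -
    let ?f = "\<lambda>k t. upward_quotient i0 (\<lambda>s. u (s, t)) (h k) i1 * indicator {j0<..<j1} t"
    have inc: "incseq ?f"
      using upward_quotient_incseq[OF sec[OF um]]
      by (auto simp: incseq_def le_fun_def h_def intro!: mult_right_mono)
    have "(\<integral>\<^sup>+ t. positive_variation i0 (\<lambda>s. u (s, t)) i1 * indicator {j0<..<j1} t \<partial>lborel) = (\<integral>\<^sup>+ t. (SUP k. ?f k t) \<partial>lborel)"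
      unfolding positive_variation_def h_def by (intro nn_integral_cong) (simp add: SUP_mult_right_ennreal)
    also have "\<dots> = (SUP k. J u k)"
      unfolding J_def using uqm[OF um] by (intro nn_integral_monotone_convergence_SUP inc) simp
    finally show "(\<integral>\<^sup>+ t. positive_variation i0 (\<lambda>s. u (s, t)) i1 * indicator {j0<..<j1} t \<partial>lborel) = (SUP k. J u k)" .
    show "incseq (J u)"
      unfolding J_def incseq_def using inc by (auto simp: incseq_def le_fun_def intro!: nn_integral_mono)
  qed
  have vneg: "(\<lambda>x. - v x) \<in> borel_measurable borel" by measurable
  have le: "J v k + J (\<lambda>x. - v x) k \<le> ennreal L" for k
  proof -
    let ?d = "\<lambda>\<sigma> t. v (\<sigma> + h k, t) - v (\<sigma>, t)"
    have pm: "ennreal x + ennreal (- x) = ennreal \<bar>x\<bar>" for x :: real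
      by (cases "0 \<le> x") (auto simp: ennreal_neg)
    have m1: "(\<lambda>x. ennreal \<bar>v (x + (h k, 0)) - v x\<bar> * indicator ({i0<..<i1 - h k} \<times> {j0<..<j1}) x) \<in> borel_measurable borel"
    proof -
      have [measurable]: "{i0<..<i1 - h k} \<times> {j0<..<j1} \<in> sets borel" unfolding borel_prod[symmetric] by measurable
      show ?thesis by measurable
    qed
    have "J v k + J (\<lambda>x. - v x) k = (\<integral>\<^sup>+ t. (upward_quotient i0 (\<lambda>s. v (s, t)) (h k) i1 + upward_quotient i0 (\<lambda>s. - v (s, t)) (h k) i1) * indicator {j0<..<j1} t \<partial>lborel)"
      unfolding J_def using uqm[OF vm] uqm[OF vneg] by (subst nn_integral_add[symmetric]) (auto simp: distrib_right)
    also have "\<dots> = (\<integral>\<^sup>+ t. ennreal (1 / h k) * (\<integral>\<^sup>+ \<sigma>. ennreal \<bar>?d \<sigma> t\<bar> * indicator ({i0<..<i1 - h k} \<times> {j0<..<j1}) (\<sigma>, t) \<partial>lborel) \<partial>lborel)"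
    proof (rule nn_integral_cong)
      fix t
      let ?I = "indicator {i0<..<i1 - h k} :: real \<Rightarrow> ennreal"
      have "upward_quotient i0 (\<lambda>s. v (s, t)) (h k) i1 + upward_quotient i0 (\<lambda>s. - v (s, t)) (h k) i1
         = ennreal (1 / h k) * ((\<integral>\<^sup>+ \<sigma>. ennreal (?d \<sigma> t) * ?I \<sigma> \<partial>lborel) + (\<integral>\<^sup>+ \<sigma>. ennreal (- ?d \<sigma> t) * ?I \<sigma> \<partial>lborel))"
        unfolding upward_quotient_def by (simp add: distrib_left)
      also have "(\<integral>\<^sup>+ \<sigma>. ennreal (?d \<sigma> t) * ?I \<sigma> \<partial>lborel) + (\<integral>\<^sup>+ \<sigma>. ennreal (- ?d \<sigma> t) * ?I \<sigma> \<partial>lborel)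
         = (\<integral>\<^sup>+ \<sigma>. ennreal (?d \<sigma> t) * ?I \<sigma> + ennreal (- ?d \<sigma> t) * ?I \<sigma> \<partial>lborel)"
        by (rule nn_integral_add[symmetric]) measurable
      also have "\<dots> = (\<integral>\<^sup>+ \<sigma>. ennreal \<bar>?d \<sigma> t\<bar> * ?I \<sigma> \<partial>lborel)"
        by (simp only: distrib_right[symmetric] pm)
      finally have eq: "upward_quotient i0 (\<lambda>s. v (s, t)) (h k) i1 + upward_quotient i0 (\<lambda>s. - v (s, t)) (h k) i1
         = ennreal (1 / h k) * (\<integral>\<^sup>+ \<sigma>. ennreal \<bar>?d \<sigma> t\<bar> * ?I \<sigma> \<partial>lborel)" .
      show "(upward_quotient i0 (\<lambda>s. v (s, t)) (h k) i1 + upward_quotient i0 (\<lambda>s. - v (s, t)) (h k) i1) * indicator {j0<..<j1} t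
        = ennreal (1 / h k) * (\<integral>\<^sup>+ \<sigma>. ennreal \<bar>?d \<sigma> t\<bar> * indicator ({i0<..<i1 - h k} \<times> {j0<..<j1}) (\<sigma>, t) \<partial>lborel)"
        unfolding eq by (cases "t \<in> {j0<..<j1}") (auto simp: indicator_def)
    qed
    also have "\<dots> = ennreal (1 / h k) * (\<integral>\<^sup>+ t. \<integral>\<^sup>+ \<sigma>. ennreal \<bar>?d \<sigma> t\<bar> * indicator ({i0<..<i1 - h k} \<times> {j0<..<j1}) (\<sigma>, t) \<partial>lborel \<partial>lborel)"
      by (rule nn_integral_cmult) measurable
    also have "\<dots> = ennreal (1 / h k) * (\<integral>\<^sup>+ x. ennreal \<bar>v (x + (h k, 0)) - v x\<bar> * indicator ({i0<..<i1 - h k} \<times> {j0<..<j1}) x \<partial>lborel)"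
      unfolding nn_integral_lborel_pair(2)[OF m1] by simp
    also have "\<dots> \<le> ennreal (1 / h k) * ennreal (L * h k)" by (intro mult_left_mono H h) auto
    also have "\<dots> = ennreal L" using h[of k] L by (subst ennreal_mult[symmetric]) auto
    finally show ?thesis .
  qed
  show ?thesis
    unfolding SUP[OF vm] SUP[OF vneg] ennreal_SUP_add[OF inc[OF vm] inc[OF vneg], symmetric]
    by (intro SUP_least le)
qed

text \<open>A difference bound in the first variable makes the distributional derivative in that variable a difference of
  two finite measures, whose total mass is at most \<open>L\<close>.\<close>

lemma difference_bound_imp_derivative_measures:
  fixes v :: "real \<times> real \<Rightarrow> real"
  assumes vm[measurable]: "v \<in> borel_measurable borel" and B: "\<And>x. \<bar>v x\<bar> \<le> B" and i: "i0 < i1" and L: "0 \<le> L"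
    and H: "\<And>h. h > 0 \<Longrightarrow> (\<integral>\<^sup>+ x. ennreal \<bar>v (x + (h, 0)) - v x\<bar> * indicator ({i0<..<i1-h} \<times> {j0<..<j1}) x \<partial>lborel)
       \<le> ennreal (L * h)"
  shows "\<exists>P N. finite_measure P \<and> sets P = sets (restrict_space borel ({i0<..<i1} \<times> {j0<..<j1})) \<and>
     finite_measure N \<and> sets N = sets (restrict_space borel ({i0<..<i1} \<times> {j0<..<j1})) \<and>
     emeasure P ({i0<..<i1} \<times> {j0<..<j1}) + emeasure N ({i0<..<i1} \<times> {j0<..<j1}) \<le> ennreal L \<and>
     (\<forall>f f' D. f \<in> borel_measurable borel \<longrightarrow> f' \<in> borel_measurable borel \<longrightarrow> (\<forall>x. \<bar>f' x\<bar> \<le> D) \<longrightarrow>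
      (\<forall>t. compact_profile i0 i1 (\<lambda>s. f (s, t)) (\<lambda>s. f' (s, t))) \<longrightarrow>
      (\<integral>x. indicator ({i0<..<i1} \<times> {j0<..<j1}) x * (v x * f' x) \<partial>lborel) = - ((\<integral>x. f x \<partial>P) - (\<integral>x. f x \<partial>N)))"
proof -
  let ?R = "{i0<..<i1} \<times> {j0<..<j1}"
  have R[measurable]: "?R \<in> sets borel" unfolding borel_prod[symmetric] by measurable
  have B0: "0 \<le> B" using B[of 0] by linarith
  define A where "A u x = positive_variation i0 (\<lambda>s. u (s, snd x)) (fst x)" for u :: "real \<times> real \<Rightarrow> real" and x :: "real \<times> real"
  define n where "n = (\<lambda>x. - v x)"
  have nm[measurable]: "n \<in> borel_measurable borel" by (simp add: n_def)
  have Am: "A u \<in> borel_measurable borel" if "u \<in> borel_measurable borel" for u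
    unfolding A_def[abs_def] by (rule positive_variation_measurable_pair[OF that])
  define I where "I u = (\<integral>\<^sup>+ t. A u (i1, t) * indicator {j0<..<j1} t \<partial>lborel)" for u
  have sum: "I v + I n \<le> ennreal L"
    using difference_bound_imp_variation_bound[OF vm L H] by (simp add: I_def A_def n_def)
  have "I v \<le> I v + I n" "I n \<le> I v + I n" by (auto simp: add_increasing add_increasing2)
  then have fin: "I v < \<infinity>" "I n < \<infinity>"
    using le_less_trans[OF order_trans[OF _ sum] ennreal_less_top] by simp_all
  have ctx: "A u (s, t) \<le> A u (s', t)" if "s \<le> s'" for u s s' t
    using that by (simp add: A_def positive_variation_mono)
  have ctx2: "A u (s, t) = 0" if "s \<le> i0" for u s t using that by (simp add: A_def positive_variation_le_i0)
  have ctx3: "\<exists>r<s. y < A u (r, t)" if "u \<in> borel_measurable borel" "y < A u (s, t)" for u y s t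
    using that positive_variation_left_continuous[OF section_measurable(1)[OF that(1)]] by (simp add: A_def)
  have ex: "\<exists>P. finite_measure P \<and> sets P = sets (restrict_space borel ?R) \<and>
    emeasure P ?R \<le> I u \<and>
    (\<forall>f f' D. f \<in> borel_measurable borel \<longrightarrow> f' \<in> borel_measurable borel \<longrightarrow> (\<forall>x. \<bar>f' x\<bar> \<le> D) \<longrightarrow>
      (\<forall>t. compact_profile i0 i1 (\<lambda>s. f (s, t)) (\<lambda>s. f' (s, t))) \<longrightarrow>
      (\<integral>x. f x \<partial>P) = - (\<integral>x. indicator ?R x * (f' x * enn2real (A u x)) \<partial>lborel))"
    if um: "u \<in> borel_measurable borel" and "I u < \<infinity>" for u
  proof -
    have e: "ennreal (enn2real (I u)) = I u" using that(2) by simp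
    show ?thesis
      using monotone_sections_measure[OF i Am[OF um] ctx ctx2 ctx3[OF um], where m = "enn2real (I u)" and ?j0.0 = j0 and ?j1.0 = j1]
      unfolding e by (simp add: I_def)
  qed
  have Aint: "integrable lborel (\<lambda>x. indicator ?R x * (f' x * enn2real (A u x)))"
    if um: "u \<in> borel_measurable borel" and If: "I u < \<infinity>" and [measurable]: "f' \<in> borel_measurable borel" and D: "\<And>x. \<bar>f' x\<bar> \<le> D" for u f' D
  proof (rule integrableI_bounded)
    note [measurable] = Am[OF um]
    have D0: "0 \<le> D" using D[of 0] by linarith
    have "(\<integral>\<^sup>+ x. ennreal (norm (indicator ?R x * (f' x * enn2real (A u x)))) \<partial>lborel) \<le> (\<integral>\<^sup>+ x. ennreal D * (A u x * indicator ?R x) \<partial>lborel)"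
    proof (rule nn_integral_mono)
      fix x
      have "ennreal (norm (f' x * enn2real (A u x))) \<le> ennreal D * ennreal (enn2real (A u x))"
        using D[of x] D0 by (subst ennreal_mult[symmetric]) (auto simp: abs_mult intro!: ennreal_leI mult_right_mono)
      also have "\<dots> \<le> ennreal D * A u x"
        by (intro mult_left_mono) (auto simp: ennreal_enn2real_if)
      finally show "ennreal (norm (indicator ?R x * (f' x * enn2real (A u x)))) \<le> ennreal D * (A u x * indicator ?R x)"
        by (cases "x \<in> ?R") auto
    qed
    also have "\<dots> = ennreal D * (\<integral>\<^sup>+ x. A u x * indicator ?R x \<partial>lborel)" by (rule nn_integral_cmult) measurable
    also have "\<dots> \<le> ennreal D * (ennreal (enn2real (I u)) * ennreal (i1 - i0))"
      using If by (intro mult_left_mono nn_integral_monotone_sections_le[OF i Am[OF um] ctx ctx2 ctx3[OF um]]) (auto simp: I_def)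
    also have "\<dots> < \<infinity>" by (simp add: ennreal_mult_less_top)
    finally show "(\<integral>\<^sup>+ x. ennreal (norm (indicator ?R x * (f' x * enn2real (A u x)))) \<partial>lborel) < \<infinity>" .
  qed (use Am[OF um] in measurable)
  have AEfin: "AE t in lborel. t \<in> {j0<..<j1} \<longrightarrow> positive_variation i0 (\<lambda>s. u (s, t)) i1 < \<infinity>"
    if um: "u \<in> borel_measurable borel" and If: "I u < \<infinity>" for u
  proof -
    have "(\<lambda>t. (i1, t)) \<in> measurable borel (borel :: (real \<times> real) measure)"
      by (intro borel_measurable_continuous_onI) (auto intro!: continuous_intros)
    from measurable_compose[OF this Am[OF um]]
    have "AE t in lborel. A u (i1, t) * indicator {j0<..<j1} t \<noteq> \<infinity>"
      using If by (intro nn_integral_PInf_AE) (auto simp: I_def)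
    then show ?thesis by eventually_elim (auto simp: A_def less_top)
  qed
  obtain P where P: "finite_measure P" "sets P = sets (restrict_space borel ?R)" "emeasure P ?R \<le> I v"
    and Pi: "\<And>f f' D. f \<in> borel_measurable borel \<Longrightarrow> f' \<in> borel_measurable borel \<Longrightarrow> (\<And>x. \<bar>f' x\<bar> \<le> D) \<Longrightarrow>
      (\<And>t. compact_profile i0 i1 (\<lambda>s. f (s, t)) (\<lambda>s. f' (s, t))) \<Longrightarrow>
      (\<integral>x. f x \<partial>P) = - (\<integral>x. indicator ?R x * (f' x * enn2real (A v x)) \<partial>lborel)"
    using ex[OF vm fin(1)] by blast
  obtain N where N: "finite_measure N" "sets N = sets (restrict_space borel ?R)" "emeasure N ?R \<le> I n"
    and Ni: "\<And>f f' D. f \<in> borel_measurable borel \<Longrightarrow> f' \<in> borel_measurable borel \<Longrightarrow> (\<And>x. \<bar>f' x\<bar> \<le> D) \<Longrightarrow>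
      (\<And>t. compact_profile i0 i1 (\<lambda>s. f (s, t)) (\<lambda>s. f' (s, t))) \<Longrightarrow>
      (\<integral>x. f x \<partial>N) = - (\<integral>x. indicator ?R x * (f' x * enn2real (A n x)) \<partial>lborel)"
    using ex[OF nm fin(2)] by blast
  have "(\<integral>x. indicator ?R x * (v x * f' x) \<partial>lborel) = - ((\<integral>x. f x \<partial>P) - (\<integral>x. f x \<partial>N))"
    if fm: "f \<in> borel_measurable borel" and f'm[measurable]: "f' \<in> borel_measurable borel" and D: "\<And>x. \<bar>f' x\<bar> \<le> D"
      and cp: "\<And>t. compact_profile i0 i1 (\<lambda>s. f (s, t)) (\<lambda>s. f' (s, t))" for f f' D
  proof -
    have D0: "0 \<le> D" using D[of 0] by linarith
    let ?a = "\<lambda>x. indicator ?R x * (f' x * enn2real (A v x)) - indicator ?R x * (f' x * enn2real (A n x))"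
    let ?b = "\<lambda>x. indicator ?R x * (v x * f' x)"
    have sw: "integral\<^sup>L lborel g = (\<integral>t. \<integral>s. g (s, t) \<partial>lborel \<partial>lborel)" if "integrable lborel g" for g :: "real \<times> real \<Rightarrow> real"
      using lborel_pair.integral_snd[of "\<lambda>s t. g (s, t)"] that by (simp add: lborel_prod)
    have bi: "integrable lborel ?b"
    proof (rule integrableI_bounded_set[where A = ?R and B = "B * D"])
      have "bounded ?R" by (intro bounded_Times) auto
      then show "emeasure lborel ?R < \<infinity>" by (rule emeasure_bounded_finite)
      have "\<bar>v x * f' x\<bar> \<le> B * D" for x unfolding abs_mult using B D B0 by (intro mult_mono) auto
      then show "AE x in lborel. x \<in> ?R \<longrightarrow> norm (?b x) \<le> B * D" by auto
    qed auto
    have ai1: "integrable lborel (\<lambda>x. indicator ?R x * (f' x * enn2real (A v x)))" by (rule Aint[OF vm fin(1) f'm D])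
    have ai2: "integrable lborel (\<lambda>x. indicator ?R x * (f' x * enn2real (A n x)))" by (rule Aint[OF nm fin(2) f'm D])
    have ai: "integrable lborel ?a" using ai1 ai2 by (rule Bochner_Integration.integrable_diff)
    have "integral\<^sup>L lborel ?b = (\<integral>t. \<integral>s. ?b (s, t) \<partial>lborel \<partial>lborel)" by (rule sw[OF bi])
    also have "\<dots> = (\<integral>t. \<integral>s. ?a (s, t) \<partial>lborel \<partial>lborel)"
    proof (rule integral_cong_AE)
      have bm: "?b \<in> borel_measurable (borel \<Otimes>\<^sub>M borel)" and am: "?a \<in> borel_measurable (borel \<Otimes>\<^sub>M borel)"
        using borel_measurable_integrable[OF ai] borel_measurable_integrable[OF bi] by (simp_all add: borel_prod)
      show "(\<lambda>t. \<integral>s. ?b (s, t) \<partial>lborel) \<in> borel_measurable lborel"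
        unfolding measurable_lborel2 by (rule lborel.borel_measurable_lebesgue_integral) (use bm in measurable)
      show "(\<lambda>t. \<integral>s. ?a (s, t) \<partial>lborel) \<in> borel_measurable lborel"
        unfolding measurable_lborel2 by (rule lborel.borel_measurable_lebesgue_integral) (use am in measurable)
      show "AE t in lborel. (\<integral>s. ?b (s, t) \<partial>lborel) = (\<integral>s. ?a (s, t) \<partial>lborel)"
        using AEfin[OF vm fin(1)] AEfin[OF nm fin(2)]
      proof eventually_elim
        fix t
        assume t: "t \<in> {j0<..<j1} \<longrightarrow> positive_variation i0 (\<lambda>s. v (s, t)) i1 < \<infinity>"
          "t \<in> {j0<..<j1} \<longrightarrow> positive_variation i0 (\<lambda>s. n (s, t)) i1 < \<infinity>"
        show "(\<integral>s. ?b (s, t) \<partial>lborel) = (\<integral>s. ?a (s, t) \<partial>lborel)"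
        proof (cases "t \<in> {j0<..<j1}")
          case True
          have e: "indicator ?R (s, t) = (indicator {i0<..<i1} s :: real)" for s using True by (auto simp: indicator_def)
          have "(\<integral>s. indicator {i0<..<i1} s * (v (s, t) * f' (s, t)) \<partial>lborel) =
            (\<integral>s. indicator {i0<..<i1} s * (f' (s, t) * (enn2real (positive_variation i0 (\<lambda>s. v (s, t)) s) - enn2real (positive_variation i0 (\<lambda>s. - v (s, t)) s))) \<partial>lborel)"
            using t True by (intro positive_variation_weak_derivative[OF section_measurable(1)[OF vm] B i cp]) (auto simp: n_def)
          then show ?thesis unfolding e A_def n_def by (simp add: algebra_simps)
        next
          case False
          then have e: "indicator ?R (s, t) = (0::real)" for s by simp
          show ?thesis unfolding e by simp
        qed
      qed
    qed
    also have "\<dots> = integral\<^sup>L lborel ?a" by (rule sw[OF ai, symmetric])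
    also have "\<dots> = - ((\<integral>x. f x \<partial>P) - (\<integral>x. f x \<partial>N))"
      using Bochner_Integration.integral_diff[OF ai1 ai2] Pi[OF fm f'm D cp] Ni[OF fm f'm D cp] by simp
    finally show ?thesis .
  qed
  moreover have "emeasure P ?R + emeasure N ?R \<le> ennreal L"
    using P(3) N(3) sum by (meson add_mono order_trans)
  ultimately show ?thesis using P(1,2) N(1,2) by blast
qed

section \<open>Weighted sums of two measures\<close>

text \<open>The measure \<open>a M + b N\<close>, for two measures on the same \<open>\<sigma>\<close>-algebra. Negative weights count as 0, because
  \<open>ennreal\<close> truncates.\<close>

definition weighted_sum_measure :: "real \<Rightarrow> 'a measure \<Rightarrow> real \<Rightarrow> 'a measure \<Rightarrow> 'a measure" where
  "weighted_sum_measure a M b N =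
     measure_of (space M) (sets M) (\<lambda>A. ennreal a * emeasure M A + ennreal b * emeasure N A)"

lemma sets_weighted_sum_measure [simp, measurable_cong]:
  "sets (weighted_sum_measure a M b N) = sets M"
  by (simp add: weighted_sum_measure_def)

lemma space_weighted_sum_measure [simp]:
  "space (weighted_sum_measure a M b N) = space M"
  by (simp add: weighted_sum_measure_def)

lemma emeasure_weighted_sum_measure:
  assumes eq: "sets N = sets M" and A: "A \<in> sets M"
  shows "emeasure (weighted_sum_measure a M b N) A = ennreal a * emeasure M A + ennreal b * emeasure N A"
  unfolding weighted_sum_measure_def
proof (rule emeasure_measure_of_sigma[OF sets.sigma_algebra_axioms _ _ A])
  show "positive (sets M) (\<lambda>A. ennreal a * emeasure M A + ennreal b * emeasure N A)"
    by (simp add: positive_def)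
  show "countably_additive (sets M) (\<lambda>A. ennreal a * emeasure M A + ennreal b * emeasure N A)"
  proof (rule countably_additiveI)
    fix F :: "nat \<Rightarrow> 'a set" assume F: "range F \<subseteq> sets M" "disjoint_family F"
    have "(\<Sum>i. ennreal a * emeasure M (F i) + ennreal b * emeasure N (F i))
       = (\<Sum>i. ennreal a * emeasure M (F i)) + (\<Sum>i. ennreal b * emeasure N (F i))"
      by (rule suminf_add[symmetric]) auto
    also have "\<dots> = ennreal a * (\<Sum>i. emeasure M (F i)) + ennreal b * (\<Sum>i. emeasure N (F i))"
      by simp
    also have "\<dots> = ennreal a * emeasure M (\<Union>i. F i) + ennreal b * emeasure N (\<Union>i. F i)"
      using F eq by (simp add: suminf_emeasure)
    finally show "(\<Sum>i. ennreal a * emeasure M (F i) + ennreal b * emeasure N (F i))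
       = ennreal a * emeasure M (\<Union>i. F i) + ennreal b * emeasure N (\<Union>i. F i)" .
  qed
qed

lemma nn_integral_weighted_sum_measure:
  assumes eq: "sets N = sets M" and f: "f \<in> borel_measurable M"
  shows "(\<integral>\<^sup>+ x. f x \<partial>weighted_sum_measure a M b N) = ennreal a * (\<integral>\<^sup>+ x. f x \<partial>M) + ennreal b * (\<integral>\<^sup>+ x. f x \<partial>N)"
  using f
proof (induction rule: borel_measurable_induct)
  case (cong f g)
  have "space N = space M" using eq by (rule sets_eq_imp_space_eq)
  then have "(\<integral>\<^sup>+ x. f x \<partial>weighted_sum_measure a M b N) = (\<integral>\<^sup>+ x. g x \<partial>weighted_sum_measure a M b N)"
    "(\<integral>\<^sup>+ x. f x \<partial>M) = (\<integral>\<^sup>+ x. g x \<partial>M)" "(\<integral>\<^sup>+ x. f x \<partial>N) = (\<integral>\<^sup>+ x. g x \<partial>N)"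
    using cong(3) by (auto intro!: nn_integral_cong)
  then show ?case using cong by simp
next
  case (set A)
  then show ?case using eq by (simp add: emeasure_weighted_sum_measure)
next
  case (mult u c)
  have "u \<in> borel_measurable N" using mult(2) eq by (simp cong: measurable_cong_sets)
  then show ?case using mult by (simp add: nn_integral_cmult distrib_left ac_simps)
next
  case (add u v)
  have "u \<in> borel_measurable N" "v \<in> borel_measurable N" using add(1,3) eq by (simp_all cong: measurable_cong_sets)
  then show ?case using add by (simp add: nn_integral_add distrib_left ac_simps)
next
  case (seq U)
  have UN: "U i \<in> borel_measurable N" for i using seq(1)[of i] eq by (simp cong: measurable_cong_sets)
  have inc: "incseq (\<lambda>i. ennreal c * (\<integral>\<^sup>+ x. U i x \<partial>K))" for c K
    using seq(3) by (auto simp: incseq_def le_fun_def intro!: mult_left_mono nn_integral_mono)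
  have e: "(SUP i. U i) x = (SUP i. U i x)" for x by (rule SUP_apply)
  have "(\<integral>\<^sup>+ x. (SUP i. U i) x \<partial>weighted_sum_measure a M b N) = (SUP i. \<integral>\<^sup>+ x. U i x \<partial>weighted_sum_measure a M b N)"
    unfolding e using seq(1,3) by (intro nn_integral_monotone_convergence_SUP) auto
  also have "\<dots> = (SUP i. ennreal a * (\<integral>\<^sup>+ x. U i x \<partial>M) + ennreal b * (\<integral>\<^sup>+ x. U i x \<partial>N))"
    using seq by simp
  also have "\<dots> = (SUP i. ennreal a * (\<integral>\<^sup>+ x. U i x \<partial>M)) + (SUP i. ennreal b * (\<integral>\<^sup>+ x. U i x \<partial>N))"
    by (rule ennreal_SUP_add[OF inc inc])
  also have "\<dots> = ennreal a * (SUP i. \<integral>\<^sup>+ x. U i x \<partial>M) + ennreal b * (SUP i. \<integral>\<^sup>+ x. U i x \<partial>N)"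
    by (simp add: SUP_mult_left_ennreal)
  also have "\<dots> = ennreal a * (\<integral>\<^sup>+ x. (SUP i. U i) x \<partial>M) + ennreal b * (\<integral>\<^sup>+ x. (SUP i. U i) x \<partial>N)"
    unfolding e using seq(1,3) UN by (simp add: nn_integral_monotone_convergence_SUP)
  finally show ?case .
qed

lemma finite_measure_weighted_sum:
  assumes "finite_measure M" "finite_measure N" "sets N = sets M"
  shows "finite_measure (weighted_sum_measure a M b N)"
proof (rule finite_measureI)
  have "emeasure M (space M) \<noteq> \<infinity>" "emeasure N (space M) \<noteq> \<infinity>"
    using assms finite_measure.emeasure_finite by auto
  then show "emeasure (weighted_sum_measure a M b N) (space (weighted_sum_measure a M b N)) \<noteq> \<infinity>"
    using assms(3) by (simp add: emeasure_weighted_sum_measure ennreal_mult_eq_top_iff)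
qed

lemma measure_weighted_sum:
  assumes "finite_measure M" "finite_measure N" "sets N = sets M" "A \<in> sets M"
  shows "measure (weighted_sum_measure a M b N) A = max 0 a * measure M A + max 0 b * measure N A"
proof -
  have "emeasure M A < \<infinity>" "emeasure N A < \<infinity>"
    using assms finite_measure.emeasure_finite by (auto simp: less_top)
  then have "ennreal a * emeasure M A < \<infinity>" "ennreal b * emeasure N A < \<infinity>"
    by (simp_all add: ennreal_mult_less_top)
  moreover have "enn2real (ennreal c) = max 0 c" for c by (auto simp: max_def ennreal_neg)
  ultimately show ?thesis using assms(3,4)
    by (simp add: measure_def emeasure_weighted_sum_measure enn2real_plus enn2real_mult)
qed

lemma integral_weighted_sum_measure:
  fixes f :: "'a \<Rightarrow> real"
  assumes eq: "sets N = sets M" and M: "integrable M f" and N: "integrable N f"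
  shows "integrable (weighted_sum_measure a M b N) f"
    and "(\<integral>x. f x \<partial>weighted_sum_measure a M b N) = max 0 a * (\<integral>x. f x \<partial>M) + max 0 b * (\<integral>x. f x \<partial>N)"
proof -
  have fm[measurable]: "f \<in> borel_measurable M" using M by simp
  note M' = M[unfolded real_integrable_def] and N' = N[unfolded real_integrable_def]
  have e: "(\<integral>\<^sup>+ x. ennreal (g x) \<partial>weighted_sum_measure a M b N) = ennreal a * (\<integral>\<^sup>+ x. ennreal (g x) \<partial>M) + ennreal b * (\<integral>\<^sup>+ x. ennreal (g x) \<partial>N)"
    if "g \<in> borel_measurable M" for g :: "'a \<Rightarrow> real"
    using that by (intro nn_integral_weighted_sum_measure[OF eq]) auto
  have e1: "(\<integral>\<^sup>+ x. ennreal (f x) \<partial>weighted_sum_measure a M b N) = ennreal a * (\<integral>\<^sup>+ x. ennreal (f x) \<partial>M) + ennreal b * (\<integral>\<^sup>+ x. ennreal (f x) \<partial>N)"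
    by (rule e) measurable
  have e2: "(\<integral>\<^sup>+ x. ennreal (- f x) \<partial>weighted_sum_measure a M b N) = ennreal a * (\<integral>\<^sup>+ x. ennreal (- f x) \<partial>M) + ennreal b * (\<integral>\<^sup>+ x. ennreal (- f x) \<partial>N)"
    by (rule e) measurable
  have fin: "ennreal c * (\<integral>\<^sup>+ x. ennreal (f x) \<partial>M) < \<infinity>" "ennreal c * (\<integral>\<^sup>+ x. ennreal (f x) \<partial>N) < \<infinity>"
    "ennreal c * (\<integral>\<^sup>+ x. ennreal (- f x) \<partial>M) < \<infinity>" "ennreal c * (\<integral>\<^sup>+ x. ennreal (- f x) \<partial>N) < \<infinity>" for c
    using M' N' by (auto simp: ennreal_mult_less_top less_top)
  show int: "integrable (weighted_sum_measure a M b N) f"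
    unfolding real_integrable_def e1 e2 using fin[of a] fin[of b] by (auto simp: less_top cong: measurable_cong_sets)
  have c: "enn2real (ennreal a) = max 0 a" "enn2real (ennreal b) = max 0 b"
    by (auto simp: max_def ennreal_neg)
  show "(\<integral>x. f x \<partial>weighted_sum_measure a M b N) = max 0 a * (\<integral>x. f x \<partial>M) + max 0 b * (\<integral>x. f x \<partial>N)"
    unfolding real_lebesgue_integral_def[OF int] real_lebesgue_integral_def[OF M] real_lebesgue_integral_def[OF N] e1 e2
    using fin[of a] fin[of b] by (simp add: enn2real_plus enn2real_mult c algebra_simps)
qed

section \<open>Rotated coordinates in the plane\<close>

text \<open>The point with coordinates \<open>x\<close> with respect to \<open>e1\<close>, \<open>e2\<close>.\<close>

definition frame :: "real^2 \<Rightarrow> real^2 \<Rightarrow> real \<times> real \<Rightarrow> real^2" where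
  "frame e1 e2 x = fst x *\<^sub>R e1 + snd x *\<^sub>R e2"

text \<open>The vectors \<open>e1\<close>, \<open>e2\<close> form an orthonormal basis of the plane.\<close>

definition orthonormal_frame :: "real^2 \<Rightarrow> real^2 \<Rightarrow> bool" where
  "orthonormal_frame e1 e2 \<longleftrightarrow> e1 \<bullet> e1 = 1 \<and> e2 \<bullet> e2 = 1 \<and> e1 \<bullet> e2 = 0"

lemma frame_continuous: "continuous_on UNIV (frame e1 e2)"
  unfolding frame_def by (intro continuous_intros)

lemma frame_measurable [measurable]: "frame e1 e2 \<in> measurable borel borel"
  by (rule borel_measurable_continuous_onI[OF frame_continuous])

lemma frame_inner:
  assumes "orthonormal_frame e1 e2"
  shows "frame e1 e2 x \<bullet> e1 = fst x" "frame e1 e2 x \<bullet> e2 = snd x"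
  using assms inner_commute[of e1 e2] by (simp_all add: frame_def orthonormal_frame_def inner_add_left)

lemma frame_norm:
  assumes "orthonormal_frame e1 e2"
  shows "norm (frame e1 e2 x) = norm x"
proof -
  have "frame e1 e2 x \<bullet> frame e1 e2 x = x \<bullet> x"
    using frame_inner[OF assms, of x]
    by (subst (2) frame_def) (simp add: inner_add_right inner_prod_def)
  then show ?thesis by (simp add: norm_eq_sqrt_inner)
qed

lemma distr_lborel_vec2: "distr lborel borel (\<lambda>x::real \<times> real. vector [fst x, snd x] :: real^2) = lborel"
proof (rule lborel_eqI[symmetric])
  have cont: "continuous_on UNIV (\<lambda>x::real \<times> real. vector [fst x, snd x] :: real^2)"
  proof -
    have *: "(\<lambda>x::real \<times> real. vector [fst x, snd x] :: real^2) = (\<lambda>x. fst x *\<^sub>R axis 1 1 + snd x *\<^sub>R axis 2 1)"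
      by (auto simp: vec_eq_iff forall_2 axis_def)
    show ?thesis unfolding * by (intro continuous_intros)
  qed
  fix l u :: "real^2" assume lu: "\<And>b. b \<in> Basis \<Longrightarrow> l \<bullet> b \<le> u \<bullet> b"
  have ll: "l $ 1 \<le> u $ 1" "l $ 2 \<le> u $ 2"
    using lu[of "axis 1 1"] lu[of "axis 2 1"] by (auto simp: inner_axis axis_in_Basis_iff)
  have pre: "(\<lambda>x::real \<times> real. vector [fst x, snd x] :: real^2) -` box l u = {l $ 1<..<u $ 1} \<times> {l $ 2<..<u $ 2}"
    by (auto simp: mem_box_cart forall_2)
  have "emeasure (distr lborel borel (\<lambda>x::real \<times> real. vector [fst x, snd x] :: real^2)) (box l u) = emeasure lborel ({l $ 1<..<u $ 1} \<times> {l $ 2<..<u $ 2})"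
    by (subst emeasure_distr) (auto simp: pre intro!: borel_measurable_continuous_onI cont)
  also have "\<dots> = ennreal ((u $ 1 - l $ 1) * (u $ 2 - l $ 2))"
    using ll by (subst lborel_prod[symmetric], subst lborel.emeasure_pair_measure_Times) (auto simp: ennreal_mult)
  also have "(u $ 1 - l $ 1) * (u $ 2 - l $ 2) = (\<Prod>b\<in>Basis. (u - l) \<bullet> b)"
  proof -
    have "(\<Prod>b\<in>Basis. (u - l) \<bullet> b) = (\<Prod>i\<in>UNIV. (u - l) $ i)"
      by (subst Basis_vec_def) (auto simp: inner_axis prod.UNION_disjoint axis_eq_axis)
    then show ?thesis by (simp add: UNIV_2)
  qed
  finally show "emeasure (distr lborel borel (\<lambda>x::real \<times> real. vector [fst x, snd x] :: real^2)) (box l u) = (\<Prod>b\<in>Basis. (u - l) \<bullet> b)" .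
qed simp

lemma distr_lborel_orthogonal:
  fixes T :: "real^2 \<Rightarrow> real^2"
  assumes T: "orthogonal_transformation T"
  shows "distr lborel borel T = lborel"
proof (rule lborel_eqI[symmetric])
  have lin: "linear T" using T by (rule orthogonal_transformation_linear)
  have Tm[measurable]: "T \<in> measurable borel borel"
    using lin by (intro borel_measurable_continuous_onI linear_continuous_on) (simp add: linear_conv_bounded_linear)
  fix l u :: "real^2" assume lu: "\<And>b. b \<in> Basis \<Longrightarrow> l \<bullet> b \<le> u \<bullet> b"
  obtain S where S: "orthogonal_transformation S" "\<And>x. S (T x) = x" "\<And>x. T (S x) = x"
    using orthogonal_transformation_inv[OF T] orthogonal_transformation_bij[OF T]
    by (metis bij_inv_eq_iff)
  have pre: "T -` box l u = S ` box l u"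
  proof (intro set_eqI iffI)
    fix x assume "x \<in> T -` box l u"
    then show "x \<in> S ` box l u" using S(2)[of x] by (metis imageI vimageD)
  qed (use S(3) in auto)
  have "emeasure (distr lborel borel T) (box l u) = emeasure lborel (S ` box l u)"
    by (subst emeasure_distr) (auto simp: pre)
  also have "\<dots> = emeasure lebesgue (S ` box l u)"
  proof -
    have "T -` box l u \<inter> space borel \<in> sets borel" by (rule measurable_sets[OF Tm]) auto
    then show ?thesis by (simp add: pre)
  qed
  also have "\<dots> = ennreal (measure lebesgue (S ` box l u))"
    by (rule emeasure_eq_measure2) (rule measurable_orthogonal_image[OF S(1)], simp)
  also have "\<dots> = ennreal (measure lebesgue (box l u))"
    by (subst measure_orthogonal_image[OF S(1)]) auto
  also have "\<dots> = (\<Prod>b\<in>Basis. (u - l) \<bullet> b)"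
    using lu by (simp add: measure_lborel_box_eq[symmetric] measure_lborel_box)
  finally show "emeasure (distr lborel borel T) (box l u) = (\<Prod>b\<in>Basis. (u - l) \<bullet> b)" .
qed simp

lemma frame_eq_compose:
  assumes "orthonormal_frame e1 e2"
  defines "T \<equiv> \<lambda>v::real^2. (v $ 1) *\<^sub>R e1 + (v $ 2) *\<^sub>R e2"
  shows "orthogonal_transformation T" "frame e1 e2 x = T (vector [fst x, snd x])"
proof -
  show "orthogonal_transformation T"
    unfolding orthogonal_transformation_def
  proof
    show "linear T" unfolding T_def by (intro linearI) (auto simp: algebra_simps)
    show "\<forall>v w. T v \<bullet> T w = v \<bullet> w"
    proof (intro allI)
      fix v w :: "real^2"
      have "v \<bullet> w = v $ 1 * w $ 1 + v $ 2 * w $ 2" by (simp add: inner_vec_def sum_2)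
      then show "T v \<bullet> T w = v \<bullet> w"
        using assms(1) inner_commute[of e1 e2] unfolding T_def orthonormal_frame_def
        by (simp add: inner_add_left inner_add_right)
    qed
  qed
  show "frame e1 e2 x = T (vector [fst x, snd x])" by (simp add: frame_def T_def)
qed

text \<open>An orthonormal frame preserves Lebesgue measure: it is the identification of pairs with vectors, followed by an
  orthogonal transformation.\<close>

lemma distr_lborel_frame:
  assumes e: "orthonormal_frame e1 e2"
  shows "distr lborel borel (frame e1 e2) = lborel"
proof -
  let ?T = "\<lambda>v::real^2. (v $ 1) *\<^sub>R e1 + (v $ 2) *\<^sub>R e2"
  let ?p = "\<lambda>x::real \<times> real. vector [fst x, snd x] :: real^2"
  have p: "?p \<in> measurable borel borel"
  proof -
    have *: "?p = (\<lambda>x. fst x *\<^sub>R axis 1 1 + snd x *\<^sub>R axis 2 1)"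
      by (auto simp: vec_eq_iff forall_2 axis_def)
    show ?thesis unfolding * by (intro borel_measurable_continuous_onI continuous_intros)
  qed
  have T: "?T \<in> measurable borel borel" by (intro borel_measurable_continuous_onI continuous_intros)
  have "distr lborel borel (frame e1 e2) = distr lborel borel (?T \<circ> ?p)"
    by (intro distr_cong) (auto simp: frame_def)
  also have "\<dots> = distr (distr lborel borel ?p) borel ?T"
    using p T by (subst distr_distr) auto
  also have "\<dots> = lborel"
    unfolding distr_lborel_vec2 by (rule distr_lborel_orthogonal[OF frame_eq_compose(1)[OF e]])
  finally show ?thesis .
qed

lemma frame_decompose:
  assumes e: "orthonormal_frame e1 e2"
  shows "frame e1 e2 (z \<bullet> e1, z \<bullet> e2) = z"
proof -
  have "surj (\<lambda>v::real^2. (v $ 1) *\<^sub>R e1 + (v $ 2) *\<^sub>R e2)"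
    by (rule orthogonal_transformation_surj[OF frame_eq_compose(1)[OF e]])
  then obtain v :: "real^2" where "z = (v $ 1) *\<^sub>R e1 + (v $ 2) *\<^sub>R e2" by (auto simp: surj_def)
  then have z: "z = frame e1 e2 (v $ 1, v $ 2)" by (simp add: frame_def)
  then show ?thesis by (simp add: frame_inner[OF e])
qed

section \<open>Test functions in rotated coordinates\<close>

text \<open>A test function is differentiable, and its directional derivatives are continuous and bounded.\<close>

lemma test_function_directional:
  assumes f: "f \<in> test_functions U"
  shows "continuous_on UNIV f" "(f has_derivative frechet_derivative f (at x)) (at x)"
    and "continuous_on UNIV (\<lambda>x. frechet_derivative f (at x) e)"
    and "x \<notin> closure {x. f x \<noteq> 0} \<Longrightarrow> frechet_derivative f (at x) e = 0"
    and "\<exists>D. \<forall>x. \<bar>frechet_derivative f (at x) e\<bar> \<le> D"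
    and "\<exists>D. \<forall>x. \<bar>f x\<bar> \<le> D"
proof -
  have C: "C_k (Suc 0) f" and K: "compact (closure {x. f x \<noteq> 0})" using f unfolding test_functions_def by blast+
  then have diff: "f differentiable at x" and cb: "b \<in> Basis \<Longrightarrow> continuous_on UNIV (\<lambda>x. frechet_derivative f (at x) b)" for x b
    by auto
  show d: "(f has_derivative frechet_derivative f (at x)) (at x)" for x
    using diff frechet_derivative_works by blast
  show c: "continuous_on UNIV f" using diff
    by (intro continuous_at_imp_continuous_on ballI differentiable_imp_continuous_within) auto
  have eq: "frechet_derivative f (at x) e = (\<Sum>b\<in>Basis. (e \<bullet> b) * frechet_derivative f (at x) b)" for x
  proof -
    interpret linear "frechet_derivative f (at x)" using d by (rule has_derivative_linear)
    have "frechet_derivative f (at x) e = frechet_derivative f (at x) (\<Sum>b\<in>Basis. (e \<bullet> b) *\<^sub>R b)"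
      by (simp add: euclidean_representation)
    then show ?thesis by (simp add: sum scale)
  qed
  show cd: "continuous_on UNIV (\<lambda>x. frechet_derivative f (at x) e)"
    unfolding eq by (intro continuous_intros cb)
  have f0: "f x = 0" if "x \<notin> closure {x. f x \<noteq> 0}" for x
    using that closure_subset[of "{x. f x \<noteq> 0}"] by auto
  show z: "frechet_derivative f (at x) e = 0" if "x \<notin> closure {x. f x \<noteq> 0}" for x
  proof -
    have "open (- closure {x. f x \<noteq> 0})" by auto
    then have "(f has_derivative (\<lambda>_. 0)) (at x)"
    proof (rule has_derivative_transform_within_open[OF has_derivative_const])
      show "x \<in> - closure {x. f x \<noteq> 0}" using that by simp
      show "0 = f y" if "y \<in> - closure {x. f x \<noteq> 0}" for y using f0[of y] that by simp
    qed
    then have "frechet_derivative f (at x) = (\<lambda>_. 0)" using d has_derivative_unique by blast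
    then show ?thesis by simp
  qed
  have bd: "\<exists>D. \<forall>x. \<bar>g x\<bar> \<le> D" if g: "continuous_on UNIV g" "\<And>x. x \<notin> closure {x. f x \<noteq> 0} \<Longrightarrow> g x = 0" for g :: "'a \<Rightarrow> real"
  proof -
    have "compact (g ` closure {x. f x \<noteq> 0})"
      by (intro compact_continuous_image continuous_on_subset[OF g(1)] K) auto
    then have "bounded (g ` closure {x. f x \<noteq> 0})" by (rule compact_imp_bounded)
    then obtain D where D: "D > 0" "\<And>x. x \<in> closure {x. f x \<noteq> 0} \<Longrightarrow> \<bar>g x\<bar> \<le> D"
      by (auto simp: bounded_pos)
    have "\<bar>g x\<bar> \<le> D" for x using D g(2)[of x] by (cases "x \<in> closure {x. f x \<noteq> 0}") auto
    then show ?thesis by blast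
  qed
  show "\<exists>D. \<forall>x. \<bar>frechet_derivative f (at x) e\<bar> \<le> D" by (rule bd[OF cd z])
  show "\<exists>D. \<forall>x. \<bar>f x\<bar> \<le> D" by (rule bd[OF c f0])
qed

lemma orthonormal_frame_swap: "orthonormal_frame e1 e2 \<Longrightarrow> orthonormal_frame e2 e1"
  by (simp add: orthonormal_frame_def inner_commute)

lemma test_function_profile:
  assumes e: "orthonormal_frame e1 e2" and f: "f \<in> test_functions (frame e1 e2 ` ({i0<..<i1} \<times> J))"
  shows "compact_profile i0 i1 (\<lambda>s. f (frame e1 e2 (s, t))) (\<lambda>s. frechet_derivative f (at (frame e1 e2 (s, t))) e1)"
  unfolding compact_profile_def
proof (intro conjI allI)
  show "((\<lambda>s. f (frame e1 e2 (s, t))) has_real_derivative frechet_derivative f (at (frame e1 e2 (s, t))) e1) (at s)" for s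
  proof -
    have l: "((\<lambda>s. frame e1 e2 (s, t)) has_derivative (\<lambda>h. h *\<^sub>R e1)) (at s)"
      unfolding frame_def by (auto intro!: derivative_eq_intros)
    have "((\<lambda>s. f (frame e1 e2 (s, t))) has_derivative (\<lambda>h. frechet_derivative f (at (frame e1 e2 (s, t))) (h *\<^sub>R e1))) (at s)"
      using has_derivative_compose[OF l test_function_directional(2)[OF f]] .
    moreover have "frechet_derivative f (at (frame e1 e2 (s, t))) (h *\<^sub>R e1) = frechet_derivative f (at (frame e1 e2 (s, t))) e1 * h" for h
      using linear_scale[OF has_derivative_linear[OF test_function_directional(2)[OF f]]] by simp
    ultimately show ?thesis by (simp add: has_field_derivative_def)
  qed
  show "isCont (\<lambda>s. frechet_derivative f (at (frame e1 e2 (s, t))) e1) s" for s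
  proof -
    have "continuous_on UNIV (\<lambda>s. frechet_derivative f (at (frame e1 e2 (s, t))) e1)"
      by (rule continuous_on_compose2[OF test_function_directional(3)[OF f]])
         (auto simp: frame_def intro!: continuous_intros)
    then show ?thesis by (simp add: continuous_on_eq_continuous_at)
  qed
  let ?K = "closure {x. f x \<noteq> 0}"
  have K: "compact ?K" "?K \<subseteq> frame e1 e2 ` ({i0<..<i1} \<times> J)" using f by (auto simp: test_functions_def)
  define C where "C = (\<lambda>z. z \<bullet> e1) ` ?K"
  have "compact C" unfolding C_def by (intro compact_continuous_image K(1) continuous_intros)
  moreover have CI: "C \<subseteq> {i0<..<i1}"
    using K(2) by (force simp: C_def frame_inner[OF e])
  have nz: "s \<in> C" if "f (frame e1 e2 (s, t)) \<noteq> 0" for s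
  proof -
    have "frame e1 e2 (s, t) \<in> ?K" using that closure_subset[of "{x. f x \<noteq> 0}"] by auto
    then show ?thesis unfolding C_def by (rule rev_image_eqI) (simp add: frame_inner[OF e])
  qed
  show "\<exists>\<eta>>0. \<forall>s. s \<le> i0 + \<eta> \<or> i1 - \<eta> \<le> s \<longrightarrow> f (frame e1 e2 (s, t)) = 0"
  proof (cases "C = {}")
    case True
    then show ?thesis using nz by (intro exI[of _ 1]) auto
  next
    case False
    obtain a where a: "a \<in> C" "\<And>x. x \<in> C \<Longrightarrow> a \<le> x" using compact_attains_inf[OF \<open>compact C\<close> False] by blast
    obtain b where b: "b \<in> C" "\<And>x. x \<in> C \<Longrightarrow> x \<le> b" using compact_attains_sup[OF \<open>compact C\<close> False] by blast
    have "i0 < a" "b < i1" using a b CI by auto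
    define \<eta> where "\<eta> = min (a - i0) (i1 - b) / 2"
    have \<eta>: "\<eta> > 0" "\<eta> < a - i0" "\<eta> < i1 - b" using \<open>i0 < a\<close> \<open>b < i1\<close> by (auto simp: \<eta>_def min_def)
    have "f (frame e1 e2 (s, t)) = 0" if "s \<le> i0 + \<eta> \<or> i1 - \<eta> \<le> s" for s
    proof (rule ccontr)
      assume "f (frame e1 e2 (s, t)) \<noteq> 0"
      then have "a \<le> s" "s \<le> b" using nz a(2) b(2) by auto
      then show False using that \<eta> by linarith
    qed
    then show ?thesis using \<eta>(1) by blast
  qed
qed

lemma frame_image:
  assumes e: "orthonormal_frame e1 e2"
  shows "frame e1 e2 ` S = (\<lambda>z. (z \<bullet> e1, z \<bullet> e2)) -` S"
proof (intro set_eqI iffI)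
  fix z assume "z \<in> (\<lambda>z. (z \<bullet> e1, z \<bullet> e2)) -` S"
  then show "z \<in> frame e1 e2 ` S"
    by (intro image_eqI[of _ _ "(z \<bullet> e1, z \<bullet> e2)"]) (simp_all add: frame_decompose[OF e])
qed (auto simp: frame_inner[OF e])

lemma frame_image_sets:
  assumes e: "orthonormal_frame e1 e2" and S: "S \<in> sets borel"
  shows "frame e1 e2 ` S \<in> sets borel"
proof -
  have "(\<lambda>z. (z \<bullet> e1, z \<bullet> e2)) \<in> measurable borel borel"
    by (intro borel_measurable_continuous_onI continuous_intros)
  from measurable_sets[OF this S] show ?thesis unfolding frame_image[OF e] by simp
qed

lemma integral_frame:
  fixes g :: "real^2 \<Rightarrow> real"
  assumes e: "orthonormal_frame e1 e2" and [measurable]: "g \<in> borel_measurable borel" and S: "S \<in> sets borel"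
  shows "(\<integral>x. g x \<partial>lebesgue_on (frame e1 e2 ` S)) = (\<integral>x. indicator S x * g (frame e1 e2 x) \<partial>lborel)"
proof -
  have m[measurable]: "frame e1 e2 ` S \<in> sets borel" by (rule frame_image_sets[OF e S])
  have "(\<integral>x. g x \<partial>lebesgue_on (frame e1 e2 ` S)) = (\<integral>x. indicator (frame e1 e2 ` S) x *\<^sub>R g x \<partial>lebesgue)"
    by (rule integral_restrict_space) (use m in auto)
  also have "\<dots> = (\<integral>x. indicator (frame e1 e2 ` S) x *\<^sub>R g x \<partial>lborel)"
    by (rule integral_completion) measurable
  also have "\<dots> = (\<integral>x. indicator (frame e1 e2 ` S) x *\<^sub>R g x \<partial>distr lborel borel (frame e1 e2))"
    by (simp add: distr_lborel_frame[OF e])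
  also have "\<dots> = (\<integral>x. indicator (frame e1 e2 ` S) (frame e1 e2 x) *\<^sub>R g (frame e1 e2 x) \<partial>lborel)"
    by (rule integral_distr) measurable
  also have "\<dots> = (\<integral>x. indicator S x * g (frame e1 e2 x) \<partial>lborel)"
    by (intro Bochner_Integration.integral_cong refl) (simp add: frame_image[OF e] frame_inner[OF e] indicator_def)
  finally show "(\<integral>x. g x \<partial>lebesgue_on (frame e1 e2 ` S)) = (\<integral>x. indicator S x * g (frame e1 e2 x) \<partial>lborel)" .
qed

text \<open>The push-forward of the derivative measures under the frame.\<close>

lemma exists_directional_measures:
  fixes v :: "real^2 \<Rightarrow> real"
  assumes e: "orthonormal_frame e1 e2" and vm[measurable]: "v \<in> borel_measurable borel" and B: "\<And>x. \<bar>v x\<bar> \<le> B"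
    and i: "i0 < i1" and L: "0 \<le> L"
    and H: "\<And>h. h > 0 \<Longrightarrow> (\<integral>\<^sup>+ x. ennreal \<bar>v (frame e1 e2 (x + (h, 0))) - v (frame e1 e2 x)\<bar> * indicator ({i0<..<i1-h} \<times> {j0<..<j1}) x \<partial>lborel)
       \<le> ennreal (L * h)"
    and \<Omega>: "\<Omega> = frame e1 e2 ` ({i0<..<i1} \<times> {j0<..<j1})"
  shows "\<exists>P N. finite_measure P \<and> sets P = sets (restrict_space borel \<Omega>) \<and>
     finite_measure N \<and> sets N = sets (restrict_space borel \<Omega>) \<and>
     emeasure P \<Omega> + emeasure N \<Omega> \<le> ennreal L \<and>
     (\<forall>f \<in> test_functions \<Omega>. (\<integral>x. v x * frechet_derivative f (at x) e1 \<partial>lebesgue_on \<Omega>) = - ((\<integral>x. f x \<partial>P) - (\<integral>x. f x \<partial>N)))"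
proof -
  let ?R = "{i0<..<i1} \<times> {j0<..<j1}"
  have R[measurable]: "?R \<in> sets borel" unfolding borel_prod[symmetric] by measurable
  have \<Omega>m[measurable]: "\<Omega> \<in> sets borel" unfolding \<Omega> by (rule frame_image_sets[OF e]) measurable
  have "(\<lambda>x. v (frame e1 e2 x)) \<in> borel_measurable borel" by measurable
  from difference_bound_imp_derivative_measures[OF this B i L H]
  obtain P N where P: "finite_measure P" "sets P = sets (restrict_space borel ?R)"
    and N: "finite_measure N" "sets N = sets (restrict_space borel ?R)"
    and mass: "emeasure P ?R + emeasure N ?R \<le> ennreal L"
    and int: "\<And>f f' D. f \<in> borel_measurable borel \<Longrightarrow> f' \<in> borel_measurable borel \<Longrightarrow> (\<And>x. \<bar>f' x\<bar> \<le> D) \<Longrightarrow>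
      (\<And>t. compact_profile i0 i1 (\<lambda>s. f (s, t)) (\<lambda>s. f' (s, t))) \<Longrightarrow>
      (\<integral>x. indicator ?R x * (v (frame e1 e2 x) * f' x) \<partial>lborel) = - ((\<integral>x. f x \<partial>P) - (\<integral>x. f x \<partial>N))"
    by blast
  have fr: "frame e1 e2 \<in> measurable M (restrict_space borel \<Omega>)" if "sets M = sets (restrict_space borel ?R)" for M
  proof -
    have "frame e1 e2 \<in> measurable (restrict_space borel ?R) (restrict_space borel \<Omega>)"
      by (intro measurable_restrict_space2 measurable_restrict_space1) (auto simp: \<Omega> space_restrict_space)
    then show ?thesis using that by (simp cong: measurable_cong_sets)
  qed
  define d where "d M = distr M (restrict_space borel \<Omega>) (frame e1 e2)" for M
  have d1: "finite_measure (d M)" "sets (d M) = sets (restrict_space borel \<Omega>)" "emeasure (d M) \<Omega> = emeasure M ?R"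
    if M: "finite_measure M" "sets M = sets (restrict_space borel ?R)" for M
  proof -
    show "finite_measure (d M)" unfolding d_def by (rule finite_measure.finite_measure_distr[OF M(1) fr[OF M(2)]])
    show "sets (d M) = sets (restrict_space borel \<Omega>)" by (simp add: d_def)
    have sp: "space M = ?R" using sets_eq_imp_space_eq[OF M(2)] by (simp add: space_restrict_space)
    have "frame e1 e2 -` \<Omega> \<inter> space M = ?R" unfolding sp \<Omega> by auto
    then show "emeasure (d M) \<Omega> = emeasure M ?R"
      unfolding d_def by (subst emeasure_distr[OF fr[OF M(2)]]) (auto simp: sets_restrict_space \<Omega>m)
  qed
  have "(\<integral>x. v x * frechet_derivative f (at x) e1 \<partial>lebesgue_on \<Omega>) = - ((\<integral>x. f x \<partial>d P) - (\<integral>x. f x \<partial>d N))"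
    if f: "f \<in> test_functions \<Omega>" for f
  proof -
    have fm[measurable]: "f \<in> borel_measurable borel"
      using test_function_directional(1)[OF f] by (rule borel_measurable_continuous_onI)
    have dm[measurable]: "(\<lambda>x. frechet_derivative f (at x) e1) \<in> borel_measurable borel"
      using test_function_directional(3)[OF f] by (rule borel_measurable_continuous_onI)
    obtain D where D: "\<And>x. \<bar>frechet_derivative f (at x) e1\<bar> \<le> D" using test_function_directional(5)[OF f] by blast
    have dd: "(\<integral>x. f x \<partial>d M) = (\<integral>x. f (frame e1 e2 x) \<partial>M)" if "sets M = sets (restrict_space borel ?R)" for M
      unfolding d_def by (rule integral_distr[OF fr[OF that]]) (auto intro: measurable_restrict_space1)
    have "(\<integral>x. v x * frechet_derivative f (at x) e1 \<partial>lebesgue_on \<Omega>)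
      = (\<integral>x. indicator ?R x * (v (frame e1 e2 x) * frechet_derivative f (at (frame e1 e2 x)) e1) \<partial>lborel)"
      unfolding \<Omega> by (rule integral_frame[OF e]) measurable
    also have "\<dots> = - ((\<integral>x. f (frame e1 e2 x) \<partial>P) - (\<integral>x. f (frame e1 e2 x) \<partial>N))"
    proof (rule int)
      show "(\<lambda>x. f (frame e1 e2 x)) \<in> borel_measurable borel" by measurable
      show "(\<lambda>x. frechet_derivative f (at (frame e1 e2 x)) e1) \<in> borel_measurable borel"
        by (rule measurable_compose[OF frame_measurable dm])
      show "\<bar>frechet_derivative f (at (frame e1 e2 x)) e1\<bar> \<le> D" for x by (rule D)
      show "compact_profile i0 i1 (\<lambda>s. f (frame e1 e2 (s, t))) (\<lambda>s. frechet_derivative f (at (frame e1 e2 (s, t))) e1)" for t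
        by (rule test_function_profile[OF e f[unfolded \<Omega>]])
    qed
    finally show ?thesis by (simp only: dd[OF P(2)] dd[OF N(2)])
  qed
  moreover have "emeasure (d P) \<Omega> + emeasure (d N) \<Omega> \<le> ennreal L"
    using d1(3)[OF P] d1(3)[OF N] mass by simp
  ultimately show ?thesis using d1(1,2)[OF P] d1(1,2)[OF N] by blast
qed

section \<open>Assembling the gradient measure\<close>

text \<open>The partial derivatives in the directions \<open>e1\<close>, \<open>e2\<close> are differences of measures; those along the coordinate
  axes are linear combinations of them.\<close>

lemma exists_gradient_measure:
  fixes v :: "real^2 \<Rightarrow> real"
  assumes e: "orthonormal_frame e1 e2" and vm[measurable]: "v \<in> borel_measurable borel" and B: "\<And>x. \<bar>v x\<bar> \<le> B"
    and i: "i0 < i1" and j: "j0 < j1" and L: "0 \<le> L1" "0 \<le> L2"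
    and H1: "\<And>h. h > 0 \<Longrightarrow> (\<integral>\<^sup>+ x. ennreal \<bar>v (frame e1 e2 (x + (h, 0))) - v (frame e1 e2 x)\<bar> * indicator ({i0<..<i1-h} \<times> {j0<..<j1}) x \<partial>lborel)
       \<le> ennreal (L1 * h)"
    and H2: "\<And>h. h > 0 \<Longrightarrow> (\<integral>\<^sup>+ x. ennreal \<bar>v (frame e2 e1 (x + (h, 0))) - v (frame e2 e1 x)\<bar> * indicator ({j0<..<j1-h} \<times> {i0<..<i1}) x \<partial>lborel)
       \<le> ennreal (L2 * h)"
    and \<Omega>: "\<Omega> = frame e1 e2 ` ({i0<..<i1} \<times> {j0<..<j1})"
  shows "\<exists>\<nu>. gradient_measure \<Omega> v \<nu> \<and> total_variation \<Omega> \<nu> \<le> ennreal (L1 + L2)"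
proof -
  have \<Omega>m[measurable]: "\<Omega> \<in> sets borel"
  proof -
    have "{i0<..<i1} \<times> {j0<..<j1} \<in> sets borel" unfolding borel_prod[symmetric] by measurable
    then show ?thesis unfolding \<Omega> by (rule frame_image_sets[OF e])
  qed
  have \<Omega>': "\<Omega> = frame e2 e1 ` ({j0<..<j1} \<times> {i0<..<i1})"
    unfolding \<Omega> by (force simp: frame_def image_iff)
  let ?S = "sets (restrict_space borel \<Omega>)"
  obtain P1 N1 where 1: "finite_measure P1" "sets P1 = ?S" "finite_measure N1" "sets N1 = ?S"
    and m1: "emeasure P1 \<Omega> + emeasure N1 \<Omega> \<le> ennreal L1"
    and d1: "\<And>f. f \<in> test_functions \<Omega> \<Longrightarrow> (\<integral>x. v x * frechet_derivative f (at x) e1 \<partial>lebesgue_on \<Omega>) = - ((\<integral>x. f x \<partial>P1) - (\<integral>x. f x \<partial>N1))"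
    using exists_directional_measures[OF e vm B i L(1) H1 \<Omega>] by blast
  obtain P2 N2 where 2: "finite_measure P2" "sets P2 = ?S" "finite_measure N2" "sets N2 = ?S"
    and m2: "emeasure P2 \<Omega> + emeasure N2 \<Omega> \<le> ennreal L2"
    and d2: "\<And>f. f \<in> test_functions \<Omega> \<Longrightarrow> (\<integral>x. v x * frechet_derivative f (at x) e2 \<partial>lebesgue_on \<Omega>) = - ((\<integral>x. f x \<partial>P2) - (\<integral>x. f x \<partial>N2))"
    using exists_directional_measures[OF orthonormal_frame_swap[OF e] vm B j L(2) H2 \<Omega>'] by blast
  \<comment> \<open>Then \<open>c1 (P1 - N1) + c2 (P2 - N2)\<close> is the difference of \<open>W c1 c2\<close> and \<open>W (- c1) (- c2)\<close>, because negative weights count as 0.\<close>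
  define W where "W c1 c2 = weighted_sum_measure 1 (weighted_sum_measure c1 P1 (- c1) N1) 1 (weighted_sum_measure c2 P2 (- c2) N2)" for c1 c2
  have Wf: "finite_measure (W c1 c2)" and Ws: "sets (W c1 c2) = ?S" for c1 c2
    unfolding W_def using 1 2 by (auto intro!: finite_measure_weighted_sum)
  have Wm: "measure (W c1 c2) A = (max 0 c1 * measure P1 A + max 0 (- c1) * measure N1 A) + (max 0 c2 * measure P2 A + max 0 (- c2) * measure N2 A)"
    if "A \<in> ?S" for A c1 c2
    unfolding W_def using 1 2 that by (simp add: measure_weighted_sum finite_measure_weighted_sum)
  have mm: "max 0 c * x - max 0 (- c) * x = c * x" for c x :: real by (simp add: max_def)
  have int: "integrable M f" if M: "finite_measure M" "sets M = ?S" and f: "f \<in> test_functions \<Omega>" for M f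
  proof -
    obtain D where D: "\<And>x. \<bar>f x\<bar> \<le> D" using test_function_directional(6)[OF f] by blast
    have "f \<in> borel_measurable borel"
      using test_function_directional(1)[OF f] by (rule borel_measurable_continuous_onI)
    then have "f \<in> borel_measurable (restrict_space borel \<Omega>)" by (rule measurable_restrict_space1)
    then have "f \<in> borel_measurable M" using M(2) by (simp cong: measurable_cong_sets)
    then show ?thesis using D by (intro finite_measure.integrable_const_bound[OF M(1), where B = D]) auto
  qed
  have Wi: "(\<integral>x. f x \<partial>W c1 c2) = (max 0 c1 * (\<integral>x. f x \<partial>P1) + max 0 (- c1) * (\<integral>x. f x \<partial>N1)) + (max 0 c2 * (\<integral>x. f x \<partial>P2) + max 0 (- c2) * (\<integral>x. f x \<partial>N2))"
    if f: "f \<in> test_functions \<Omega>" for f c1 c2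
    unfolding W_def using 1 2 int[OF _ _ f] by (simp add: integral_weighted_sum_measure)
  have Wd: "(\<integral>x. f x \<partial>W c1 c2) - (\<integral>x. f x \<partial>W (- c1) (- c2)) = c1 * ((\<integral>x. f x \<partial>P1) - (\<integral>x. f x \<partial>N1)) + c2 * ((\<integral>x. f x \<partial>P2) - (\<integral>x. f x \<partial>N2))"
    if f: "f \<in> test_functions \<Omega>" for f c1 c2
    unfolding Wi[OF f] using mm[of c1 "\<integral>x. f x \<partial>P1"] mm[of c1 "\<integral>x. f x \<partial>N1"] mm[of c2 "\<integral>x. f x \<partial>P2"] mm[of c2 "\<integral>x. f x \<partial>N2"]
    by (simp add: algebra_simps)
  define \<nu> where "\<nu> A = (measure P1 A - measure N1 A) *\<^sub>R e1 + (measure P2 A - measure N2 A) *\<^sub>R e2" for A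
  have "gradient_measure \<Omega> v \<nu>"
    unfolding gradient_measure_def
  proof (intro exI ballI conjI)
    fix b :: "real^2" assume "b \<in> Basis"
    let ?c1 = "b \<bullet> e1" and ?c2 = "b \<bullet> e2"
    show "finite_measure (W ?c1 ?c2)" "sets (W ?c1 ?c2) = ?S" "finite_measure (W (- ?c1) (- ?c2))" "sets (W (- ?c1) (- ?c2)) = ?S"
      by (rule Wf Ws)+
    show "\<nu> A \<bullet> b = measure (W ?c1 ?c2) A - measure (W (- ?c1) (- ?c2)) A" if A: "A \<in> ?S" for A
      unfolding Wm[OF A] \<nu>_def using mm[of ?c1 "measure P1 A"] mm[of ?c1 "measure N1 A"] mm[of ?c2 "measure P2 A"] mm[of ?c2 "measure N2 A"]
      by (simp add: inner_add_left inner_commute algebra_simps)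
    fix f assume f: "f \<in> test_functions \<Omega>"
    have b: "b = ?c1 *\<^sub>R e1 + ?c2 *\<^sub>R e2"
      using frame_decompose[OF e, of b] by (simp add: frame_def)
    have lin: "frechet_derivative f (at x) b = ?c1 * frechet_derivative f (at x) e1 + ?c2 * frechet_derivative f (at x) e2" for x
    proof -
      have l: "linear (frechet_derivative f (at x))"
        using test_function_directional(2)[OF f] by (rule has_derivative_linear)
      show ?thesis by (subst (1) b) (simp add: linear_add[OF l] linear_scale[OF l])
    qed
    have vi: "integrable (lebesgue_on \<Omega>) (\<lambda>x. v x * frechet_derivative f (at x) d)" for d
    proof -
      have dm[measurable]: "(\<lambda>x. frechet_derivative f (at x) d) \<in> borel_measurable borel"
        using test_function_directional(3)[OF f] by (rule borel_measurable_continuous_onI)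
      obtain D where D: "\<And>x. \<bar>frechet_derivative f (at x) d\<bar> \<le> D" using test_function_directional(5)[OF f] by blast
      have "bounded \<Omega>"
      proof -
        have "frame e1 e2 ` ({i0<..<i1} \<times> {j0<..<j1}) \<subseteq> frame e1 e2 ` ({i0..i1} \<times> {j0..j1})" by auto
        moreover have "compact (frame e1 e2 ` ({i0..i1} \<times> {j0..j1}))"
          by (intro compact_continuous_image continuous_on_subset[OF frame_continuous] compact_Times) auto
        ultimately show ?thesis unfolding \<Omega> using compact_imp_bounded bounded_subset by blast
      qed
      then have "emeasure (lebesgue_on \<Omega>) (space (lebesgue_on \<Omega>)) < \<infinity>"
        using emeasure_bounded_finite[of \<Omega>] by (simp add: emeasure_restrict_space space_restrict_space)
      then have fm: "finite_measure (lebesgue_on \<Omega>)" by (intro finite_measureI) auto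
      have "(\<lambda>x. v x * frechet_derivative f (at x) d) \<in> borel_measurable lborel" by measurable
      then have mb: "(\<lambda>x. v x * frechet_derivative f (at x) d) \<in> borel_measurable (lebesgue_on \<Omega>)"
        by (intro measurable_restrict_space1 measurable_completion)
      have "\<bar>v x * frechet_derivative f (at x) d\<bar> \<le> B * D" for x
        unfolding abs_mult using B[of x] D[of x] by (intro mult_mono) auto
      then show ?thesis by (intro finite_measure.integrable_const_bound[OF fm _ mb, where B = "B * D"]) auto
    qed
    have "(\<integral>x. v x * frechet_derivative f (at x) b \<partial>lebesgue_on \<Omega>)
      = (\<integral>x. ?c1 * (v x * frechet_derivative f (at x) e1) + ?c2 * (v x * frechet_derivative f (at x) e2) \<partial>lebesgue_on \<Omega>)"
      by (intro Bochner_Integration.integral_cong refl) (simp add: lin algebra_simps)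
    also have "\<dots> = ?c1 * (\<integral>x. v x * frechet_derivative f (at x) e1 \<partial>lebesgue_on \<Omega>) + ?c2 * (\<integral>x. v x * frechet_derivative f (at x) e2 \<partial>lebesgue_on \<Omega>)"
      using vi[of e1] vi[of e2] by simp
    also have "\<dots> = - ((\<integral>x. f x \<partial>W ?c1 ?c2) - (\<integral>x. f x \<partial>W (- ?c1) (- ?c2)))"
      unfolding d1[OF f] d2[OF f] Wd[OF f] by (simp add: algebra_simps)
    finally show "(\<integral>x. v x * frechet_derivative f (at x) b \<partial>lebesgue_on \<Omega>) = - ((\<integral>x. f x \<partial>W ?c1 ?c2) - (\<integral>x. f x \<partial>W (- ?c1) (- ?c2)))" .
  qed
  moreover have "total_variation \<Omega> \<nu> \<le> ennreal (L1 + L2)"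
    unfolding total_variation_def
  proof (rule SUP_least)
    fix A :: "nat \<Rightarrow> (real^2) set"
    assume "A \<in> {A. range A \<subseteq> ?S \<and> disjoint_family A \<and> (\<Union>k. A k) = \<Omega>}"
    then have A: "range A \<subseteq> ?S" "disjoint_family A" "(\<Union>k. A k) = \<Omega>" by auto
    have en: "norm e1 = 1" "norm e2 = 1" using e by (auto simp: orthonormal_frame_def norm_eq_sqrt_inner)
    have "ennreal (norm (\<nu> (A k))) \<le> emeasure P1 (A k) + emeasure N1 (A k) + (emeasure P2 (A k) + emeasure N2 (A k))" for k
    proof -
      have "norm (\<nu> (A k)) \<le> \<bar>measure P1 (A k) - measure N1 (A k)\<bar> + \<bar>measure P2 (A k) - measure N2 (A k)\<bar>"
        unfolding \<nu>_def by (rule order_trans[OF norm_triangle_ineq]) (simp add: en)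
      also have "\<dots> \<le> measure P1 (A k) + measure N1 (A k) + (measure P2 (A k) + measure N2 (A k))"
        using measure_nonneg[of P1 "A k"] measure_nonneg[of N1 "A k"] measure_nonneg[of P2 "A k"] measure_nonneg[of N2 "A k"] by linarith
      finally have "ennreal (norm (\<nu> (A k))) \<le> ennreal (measure P1 (A k) + measure N1 (A k) + (measure P2 (A k) + measure N2 (A k)))"
        by (rule ennreal_leI)
      also have "\<dots> = emeasure P1 (A k) + emeasure N1 (A k) + (emeasure P2 (A k) + emeasure N2 (A k))"
        using 1 2 by (simp add: finite_measure.emeasure_eq_measure)
      finally show ?thesis .
    qed
    then have "(\<Sum>k. ennreal (norm (\<nu> (A k)))) \<le> (\<Sum>k. emeasure P1 (A k) + emeasure N1 (A k) + (emeasure P2 (A k) + emeasure N2 (A k)))"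
      by (intro suminf_le) auto
    also have "\<dots> = ((\<Sum>k. emeasure P1 (A k)) + (\<Sum>k. emeasure N1 (A k))) + ((\<Sum>k. emeasure P2 (A k)) + (\<Sum>k. emeasure N2 (A k)))"
      by (simp add: suminf_add)
    also have "\<dots> = (emeasure P1 \<Omega> + emeasure N1 \<Omega>) + (emeasure P2 \<Omega> + emeasure N2 \<Omega>)"
      using A 1 2 by (simp add: suminf_emeasure)
    also have "\<dots> \<le> ennreal L1 + ennreal L2" by (intro add_mono m1 m2)
    finally show "(\<Sum>k. ennreal (norm (\<nu> (A k)))) \<le> ennreal (L1 + L2)" using L by simp
  qed
  ultimately show ?thesis by blast
qed

section \<open>The kernel\<close>

lemma orthonormal_frame_signs:
  assumes "orthonormal_frame e1 e2" "\<sigma> \<in> {1, -1}" "\<tau> \<in> {1, -1}"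
  shows "orthonormal_frame (\<sigma> *\<^sub>R e1) (\<tau> *\<^sub>R e2)"
  using assms by (auto simp: orthonormal_frame_def)

lemma AE_frame:
  assumes e: "orthonormal_frame e1 e2" and P: "AE z in lborel. P z"
  shows "AE x in lborel. P (frame e1 e2 x)"
proof -
  have m: "frame e1 e2 \<in> measurable lborel borel" by simp
  have "AE z in distr lborel borel (frame e1 e2). P z" unfolding distr_lborel_frame[OF e] by (rule P)
  from AE_distrD[OF m this] show ?thesis .
qed

lemma distr_lborel_frame_inverse:
  assumes e: "orthonormal_frame e1 e2"
  shows "distr lborel borel (\<lambda>z. (z \<bullet> e1, z \<bullet> e2)) = lborel"
proof -
  have m: "(\<lambda>z. (z \<bullet> e1, z \<bullet> e2)) \<in> measurable borel borel"
    by (intro borel_measurable_continuous_onI continuous_intros)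
  have "distr lborel borel (\<lambda>z. (z \<bullet> e1, z \<bullet> e2)) = distr (distr lborel borel (frame e1 e2)) borel (\<lambda>z. (z \<bullet> e1, z \<bullet> e2))"
    by (simp add: distr_lborel_frame[OF e])
  also have "\<dots> = distr lborel borel ((\<lambda>z. (z \<bullet> e1, z \<bullet> e2)) \<circ> frame e1 e2)"
    using m by (intro distr_distr) auto
  also have "(\<lambda>z. (z \<bullet> e1, z \<bullet> e2)) \<circ> frame e1 e2 = (\<lambda>x. x)"
    by (auto simp: frame_inner[OF e])
  also have "distr lborel borel (\<lambda>x. x :: real \<times> real) = lborel"
    by (subst distr_id2) auto
  finally show ?thesis .
qed

lemma AE_frame_inverse:
  assumes e: "orthonormal_frame e1 e2" and P: "AE x in lborel. P x"
  shows "AE z in lborel. P (z \<bullet> e1, z \<bullet> e2)"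
proof -
  have m: "(\<lambda>z. (z \<bullet> e1, z \<bullet> e2)) \<in> measurable lborel borel"
    unfolding measurable_lborel2 by (intro borel_measurable_continuous_onI continuous_intros)
  have "AE x in distr lborel borel (\<lambda>z. (z \<bullet> e1, z \<bullet> e2)). P x"
    unfolding distr_lborel_frame_inverse[OF e] by (rule P)
  from AE_distrD[OF m this] show ?thesis .
qed

lemma nn_integral_frame:
  assumes e: "orthonormal_frame e1 e2" and [measurable]: "f \<in> borel_measurable borel"
  shows "(\<integral>\<^sup>+ z. f z \<partial>lborel) = (\<integral>\<^sup>+ x. f (frame e1 e2 x) \<partial>lborel)"
proof -
  have "(\<integral>\<^sup>+ z. f z \<partial>lborel) = (\<integral>\<^sup>+ z. f z \<partial>distr lborel borel (frame e1 e2))"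
    by (simp add: distr_lborel_frame[OF e])
  also have "\<dots> = (\<integral>\<^sup>+ x. f (frame e1 e2 x) \<partial>lborel)" by (rule nn_integral_distr) auto
  finally show ?thesis .
qed

lemma AE_coordinates_nonzero: "AE x in lborel. fst x \<noteq> (0::real) \<and> snd x \<noteq> (0::real)"
proof -
  have "({0} \<times> UNIV :: (real \<times> real) set) \<in> null_sets (lborel \<Otimes>\<^sub>M lborel)"
    by (auto simp: null_sets_def lborel.emeasure_pair_measure_Times)
  moreover have "(UNIV \<times> {0} :: (real \<times> real) set) \<in> null_sets (lborel \<Otimes>\<^sub>M lborel)"
    by (auto simp: null_sets_def lborel.emeasure_pair_measure_Times)
  ultimately have "({0} \<times> UNIV :: (real \<times> real) set) \<in> null_sets lborel" "(UNIV \<times> {0} :: (real \<times> real) set) \<in> null_sets lborel"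
    by (simp_all only: lborel_prod)
  then have "{0} \<times> UNIV \<union> UNIV \<times> {0} \<in> null_sets (lborel :: (real \<times> real) measure)" by (rule null_sets.Un)
  then show ?thesis by (rule AE_I') (auto simp: mem_Times_iff)
qed

text \<open>By Lindeloef's theorem, countably many balls on which the function vanishes almost everywhere cover the complement.\<close>

lemma AE_outside_ess_support:
  assumes "ess_support f \<subseteq> S"
  shows "AE w in lborel. w \<notin> S \<longrightarrow> f w = 0"
proof -
  have "\<exists>r>0. AE w in lebesgue. w \<in> ball z r \<longrightarrow> f w = 0" if "z \<notin> S" for z
    using that assms by (auto simp: ess_support_def)
  then obtain r where r: "\<And>z. z \<notin> S \<Longrightarrow> r z > 0" "\<And>z. z \<notin> S \<Longrightarrow> AE w in lebesgue. w \<in> ball z (r z) \<longrightarrow> f w = 0"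
    by metis
  obtain \<F> where F: "\<F> \<subseteq> (\<lambda>z. ball z (r z)) ` (- S)" "countable \<F>" "\<Union>\<F> = \<Union>((\<lambda>z. ball z (r z)) ` (- S))"
    using Lindelof[of "(\<lambda>z. ball z (r z)) ` (- S)"] by auto
  have "AE w in lebesgue. \<forall>B\<in>\<F>. w \<in> B \<longrightarrow> f w = 0"
    using F(1) r(2) by (subst AE_ball_countable[OF F(2)]) auto
  then have "AE w in lborel. \<forall>B\<in>\<F>. w \<in> B \<longrightarrow> f w = 0" by (simp add: AE_completion_iff)
  then show ?thesis
  proof eventually_elim
    fix w assume w: "\<forall>B\<in>\<F>. w \<in> B \<longrightarrow> f w = 0"
    show "w \<notin> S \<longrightarrow> f w = 0"
    proof
      assume "w \<notin> S"
      then have "w \<in> \<Union>\<F>" unfolding F(3) using r(1)[of w] by (auto intro!: bexI[of _ w])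
      then show "f w = 0" using w by blast
    qed
  qed
qed

text \<open>A Borel version of the kernel has positive mass on \<open>{x. c < fst x \<and> c < snd x \<and> norm x < 1}\<close> for some \<open>c > 0\<close>, and is
  almost everywhere invariant under reflections in the two lines. If the mass were 0 for all \<open>c\<close>, the kernel would vanish in
  one open quadrant, by symmetry in all four.\<close>

lemma radial_kernel_positive_mass:
  assumes \<rho>: "radial_kernel \<rho>" and e: "orthonormal_frame e1 e2"
  obtains \<rho>0 c \<kappa> where "\<rho>0 \<in> borel_measurable borel" "\<And>z. 0 \<le> \<rho>0 z" "AE z in lborel. \<rho> z = \<rho>0 z"
    "c > 0" "\<kappa> > 0"
    "ennreal \<kappa> \<le> (\<integral>\<^sup>+ x. ennreal (\<rho>0 (frame e1 e2 x)) * indicator {x. c < fst x \<and> c < snd x \<and> norm x < 1} x \<partial>lborel)"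
    "\<And>\<sigma> \<tau>. \<sigma> \<in> {1, -1} \<Longrightarrow> \<tau> \<in> {1, -1} \<Longrightarrow> AE x in lborel. \<rho>0 (frame (\<sigma> *\<^sub>R e1) (\<tau> *\<^sub>R e2) x) = \<rho>0 (frame e1 e2 x)"
proof -
  have int: "integrable lebesgue \<rho>" and pos: "AE z in lborel. 0 \<le> \<rho> z" and one: "integral\<^sup>L lebesgue \<rho> = 1"
    and supp: "ess_support \<rho> \<subseteq> ball 0 1"
    using \<rho> by (auto simp: radial_kernel_def AE_completion_iff)
  obtain r where r: "AE z in lborel. \<rho> z = r (norm z)"
    using \<rho> by (auto simp: radial_kernel_def AE_completion_iff)
  obtain g where g[measurable]: "g \<in> borel_measurable lborel" and ge: "AE z in lborel. \<rho> z = g z"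
    using completion_ex_borel_measurable_real[of \<rho> lborel] borel_measurable_integrable[OF int] by blast
  define \<rho>0 where "\<rho>0 z = max 0 (g z)" for z
  have m[measurable]: "\<rho>0 \<in> borel_measurable borel" using g unfolding \<rho>0_def by simp
  have nn: "0 \<le> \<rho>0 z" for z by (simp add: \<rho>0_def)
  have eq: "AE z in lborel. \<rho> z = \<rho>0 z" using pos ge by eventually_elim (auto simp: \<rho>0_def)
  have rad: "AE z in lborel. \<rho>0 z = r (norm z)" using eq r by eventually_elim auto
  have sym: "AE x in lborel. \<rho>0 (frame (\<sigma> *\<^sub>R e1) (\<tau> *\<^sub>R e2) x) = \<rho>0 (frame e1 e2 x)"
    if s: "\<sigma> \<in> {1, -1}" "\<tau> \<in> {1, -1}" for \<sigma> \<tau>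
    using AE_frame[OF orthonormal_frame_signs[OF e s] rad] AE_frame[OF e rad]
    by eventually_elim (simp add: frame_norm[OF orthonormal_frame_signs[OF e s]] frame_norm[OF e])
  have total: "(\<integral>\<^sup>+ z. ennreal (\<rho>0 z) \<partial>lborel) = 1"
  proof -
    have "(\<integral>\<^sup>+ z. ennreal (\<rho>0 z) \<partial>lborel) = (\<integral>\<^sup>+ z. ennreal (\<rho> z) \<partial>lborel)"
      by (rule nn_integral_cong_AE) (use eq in eventually_elim, simp)
    also have "\<dots> = (\<integral>\<^sup>+ z. ennreal (\<rho> z) \<partial>lebesgue)" by (simp add: nn_integral_completion)
    also have "\<dots> = 1"
      using pos one by (subst nn_integral_eq_integral[OF int]) (auto simp: AE_completion_iff)
    finally show ?thesis .
  qed
  have out: "AE z in lborel. 1 \<le> norm z \<longrightarrow> \<rho>0 z = 0"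
    using AE_outside_ess_support[OF supp] eq by eventually_elim auto
  let ?k = "\<lambda>x. \<rho>0 (frame e1 e2 x)"
  let ?G = "\<lambda>c::real. {x :: real \<times> real. c < fst x \<and> c < snd x \<and> norm x < 1}"
  have Gm[measurable]: "?G c \<in> sets borel" for c
    by (intro borel_open open_Collect_conj open_Collect_less continuous_intros)
  have "\<exists>n. (\<integral>\<^sup>+ x. ennreal (?k x) * indicator (?G (1 / real (Suc n))) x \<partial>lborel) \<noteq> 0"
  proof (rule ccontr)
    assume "\<not> ?thesis"
    then have "(\<integral>\<^sup>+ x. ennreal (?k x) * indicator (?G (1 / real (Suc n))) x \<partial>lborel) = 0" for n by blast
    then have "AE x in lborel. ennreal (?k x) * indicator (?G (1 / real (Suc n))) x = 0" for n
      by (subst (asm) nn_integral_0_iff_AE) auto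
    then have "AE x in lborel. \<forall>n. ennreal (?k x) * indicator (?G (1 / real (Suc n))) x = 0"
      unfolding AE_all_countable by blast
    then have quad: "AE x in lborel. 0 < fst x \<and> 0 < snd x \<and> norm x < 1 \<longrightarrow> ?k x = 0"
    proof eventually_elim
      fix x :: "real \<times> real"
      assume A: "\<forall>n. ennreal (?k x) * indicator (?G (1 / real (Suc n))) x = 0"
      show "0 < fst x \<and> 0 < snd x \<and> norm x < 1 \<longrightarrow> ?k x = 0"
      proof
        assume x: "0 < fst x \<and> 0 < snd x \<and> norm x < 1"
        then obtain n where "inverse (real (Suc n)) < min (fst x) (snd x)"
          using reals_Archimedean[of "min (fst x) (snd x)"] by auto
        then have "x \<in> ?G (1 / real (Suc n))" using x by (auto simp: inverse_eq_divide)
        moreover have "ennreal (?k x) * indicator (?G (1 / real (Suc n))) x = 0" using A by blast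
        ultimately have "ennreal (?k x) = 0" by (simp del: of_nat_Suc)
        then show "?k x = 0" using nn[of "frame e1 e2 x"] by (simp add: ennreal_eq_0_iff)
      qed
    qed
    have quadz: "AE z in lborel. 0 < z \<bullet> e1 \<and> 0 < z \<bullet> e2 \<and> norm (z \<bullet> e1, z \<bullet> e2) < 1 \<longrightarrow> \<rho>0 z = 0"
      using AE_frame_inverse[OF e quad] by (simp add: frame_decompose[OF e])
    have q: "AE x in lborel. 0 < \<sigma> * fst x \<and> 0 < \<tau> * snd x \<and> norm x < 1 \<longrightarrow> ?k x = 0"
      if s: "\<sigma> \<in> {1, -1}" "\<tau> \<in> {1, -1}" for \<sigma> \<tau>
      using AE_frame[OF orthonormal_frame_signs[OF e s] quadz] sym[OF s]
    proof eventually_elim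
      fix x
      have f: "frame (\<sigma> *\<^sub>R e1) (\<tau> *\<^sub>R e2) x = frame e1 e2 (\<sigma> * fst x, \<tau> * snd x)"
        by (simp add: frame_def mult.commute)
      have n: "norm (\<sigma> * fst x, \<tau> * snd x) = norm x"
        using s by (cases x) (auto simp: norm_Pair)
      assume "0 < frame (\<sigma> *\<^sub>R e1) (\<tau> *\<^sub>R e2) x \<bullet> e1 \<and> 0 < frame (\<sigma> *\<^sub>R e1) (\<tau> *\<^sub>R e2) x \<bullet> e2 \<and>
          norm (frame (\<sigma> *\<^sub>R e1) (\<tau> *\<^sub>R e2) x \<bullet> e1, frame (\<sigma> *\<^sub>R e1) (\<tau> *\<^sub>R e2) x \<bullet> e2) < 1 \<longrightarrow> \<rho>0 (frame (\<sigma> *\<^sub>R e1) (\<tau> *\<^sub>R e2) x) = 0"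
        "\<rho>0 (frame (\<sigma> *\<^sub>R e1) (\<tau> *\<^sub>R e2) x) = ?k x"
      then show "0 < \<sigma> * fst x \<and> 0 < \<tau> * snd x \<and> norm x < 1 \<longrightarrow> ?k x = 0"
        unfolding f by (simp add: frame_inner[OF e] n)
    qed
    have "AE x in lborel. ?k x = 0"
      using q[of 1 1, simplified] q[of 1 "-1", simplified] q[of "-1" 1, simplified] q[of "-1" "-1", simplified] AE_coordinates_nonzero AE_frame[OF e out]
    proof eventually_elim
      fix x assume "0 < fst x \<and> 0 < snd x \<and> norm x < 1 \<longrightarrow> ?k x = 0"
        "0 < fst x \<and> snd x < 0 \<and> norm x < 1 \<longrightarrow> ?k x = 0"
        "fst x < 0 \<and> 0 < snd x \<and> norm x < 1 \<longrightarrow> ?k x = 0"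
        "fst x < 0 \<and> snd x < 0 \<and> norm x < 1 \<longrightarrow> ?k x = 0"
        "fst x \<noteq> 0 \<and> snd x \<noteq> 0" "1 \<le> norm (frame e1 e2 x) \<longrightarrow> ?k x = 0"
      then show "?k x = 0" unfolding frame_norm[OF e] by (meson linorder_neqE_linordered_idom not_le)
    qed
    then have "(\<integral>\<^sup>+ x. ennreal (?k x) \<partial>lborel) = 0"
      by (subst nn_integral_0_iff_AE) (auto elim: eventually_mono)
    then show False using total nn_integral_frame[OF e, of "\<lambda>z. ennreal (\<rho>0 z)"] by simp
  qed
  then obtain n where n: "(\<integral>\<^sup>+ x. ennreal (?k x) * indicator (?G (1 / real (Suc n))) x \<partial>lborel) \<noteq> 0" ..
  let ?I = "\<integral>\<^sup>+ x. ennreal (?k x) * indicator (?G (1 / real (Suc n))) x \<partial>lborel"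
  have "?I \<le> (\<integral>\<^sup>+ x. ennreal (?k x) \<partial>lborel)"
    by (intro nn_integral_mono) (auto simp: indicator_def)
  also have "\<dots> = 1" using total nn_integral_frame[OF e, of "\<lambda>z. ennreal (\<rho>0 z)"] by simp
  finally have le1: "?I \<le> 1" .
  then have I: "ennreal (enn2real ?I) = ?I" by (intro ennreal_enn2real le_less_trans[OF le1]) simp
  have "?I < top" by (rule le_less_trans[OF le1]) simp
  then have "0 < enn2real ?I" using n by (simp only: enn2real_positive_iff) (simp add: zero_less_iff_neq_zero)
  then show ?thesis
    using that[OF m nn eq, of "1 / real (Suc n)" "enn2real ?I"] sym I by simp
qed

lemma nn_integral_scale2:
  fixes f :: "real \<times> real \<Rightarrow> ennreal"
  assumes [measurable]: "f \<in> borel_measurable borel" and \<epsilon>: "\<epsilon> > 0"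
  shows "(\<integral>\<^sup>+ x. f x \<partial>lborel) = ennreal (\<epsilon> ^ 2) * (\<integral>\<^sup>+ x. f (\<epsilon> *\<^sub>R x) \<partial>lborel)"
proof -
  have "lborel = density (distr lborel borel (\<lambda>x::real \<times> real. 0 + \<epsilon> *\<^sub>R x)) (\<lambda>_. ennreal (\<bar>\<epsilon>\<bar> ^ DIM(real \<times> real)))"
    using lborel_affine[of \<epsilon> "0 :: real \<times> real"] \<epsilon> by simp
  then have "(\<integral>\<^sup>+ x. f x \<partial>lborel) = (\<integral>\<^sup>+ x. f x \<partial>density (distr lborel borel (\<lambda>x::real \<times> real. \<epsilon> *\<^sub>R x)) (\<lambda>_. ennreal (\<epsilon> ^ 2)))"
    using \<epsilon> by (simp add: numeral_2_eq_2)
  also have "\<dots> = ennreal (\<epsilon> ^ 2) * (\<integral>\<^sup>+ x. f (\<epsilon> *\<^sub>R x) \<partial>lborel)"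
    by (subst nn_integral_density) (auto simp: nn_integral_distr nn_integral_cmult)
  finally show ?thesis .
qed

lemma AE_lborel_scale:
  fixes P :: "'a::euclidean_space \<Rightarrow> bool"
  assumes P: "AE z in lborel. P z" and c: "c \<noteq> 0"
  shows "AE z in lborel. P (c *\<^sub>R z)"
proof -
  have T: "(\<lambda>z::'a. 0 + c *\<^sub>R z) \<in> measurable lborel borel" by measurable
  have "AE z in density (distr lborel borel (\<lambda>z::'a. 0 + c *\<^sub>R z)) (\<lambda>_. ennreal (\<bar>c\<bar> ^ DIM('a))). P z"
    by (subst lborel_affine[OF c, of "0::'a", symmetric]) (rule P)
  then have "AE z in distr lborel borel (\<lambda>z::'a. 0 + c *\<^sub>R z). P z"
    using c by (subst (asm) AE_density) auto
  from AE_distrD[OF T this] show ?thesis by simp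
qed

lemma AE_lborel_translate:
  fixes P :: "'a::euclidean_space \<Rightarrow> bool"
  assumes P: "AE z in lborel. P z"
  shows "AE z in lborel. P (z + c)"
proof -
  have T: "(\<lambda>z::'a. c + z) \<in> measurable lborel borel" by measurable
  have "AE z in distr lborel borel ((+) c). P z" by (subst lborel_distr_plus) (rule P)
  from AE_distrD[OF T this] show ?thesis by (simp add: add.commute)
qed

section \<open>Selecting a good pair of increments\<close>

text \<open>The integrand of the energy, without the factor \<open>1 / norm z powr 2\<close>, for an increment with coordinates \<open>y\<close>.\<close>

definition increment_product ::
  "real \<Rightarrow> real \<Rightarrow> (real \<times> real \<Rightarrow> real) \<Rightarrow> real \<times> real \<Rightarrow> real \<times> real \<Rightarrow> real" where
  "increment_product \<theta>1 \<theta>2 w y x =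
     \<bar>w (fst x + fst y, snd x) - w x\<bar> powr \<theta>1 * \<bar>w (fst x, snd x + snd y) - w x\<bar> powr \<theta>2"

lemma corner_density_eq_sum:
  "corner_density \<theta>1 \<theta>2 w a b x = increment_product \<theta>1 \<theta>2 w (a, b) x + increment_product \<theta>1 \<theta>2 w (a, - b) x
     + (increment_product \<theta>1 \<theta>2 w (- a, b) x + increment_product \<theta>1 \<theta>2 w (- a, - b) x)"
  by (simp add: corner_density_def increment_product_def algebra_simps)

lemma increment_integral_measurable:
  assumes [measurable]: "w \<in> borel_measurable borel" and [measurable]: "Q \<in> sets borel"
  shows "(\<lambda>y. \<integral>\<^sup>+ x. ennreal (increment_product \<theta>1 \<theta>2 w y x) * indicator Q x \<partial>lborel) \<in> borel_measurable borel"
    and "increment_product \<theta>1 \<theta>2 w y \<in> borel_measurable borel"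
proof -
  have w[measurable]: "w \<in> borel_measurable (borel \<Otimes>\<^sub>M borel)" by (simp add: borel_prod)
  have "(\<lambda>(y, x). increment_product \<theta>1 \<theta>2 w y x) \<in> borel_measurable ((borel \<Otimes>\<^sub>M borel) \<Otimes>\<^sub>M (borel \<Otimes>\<^sub>M borel))"
    unfolding increment_product_def by measurable
  then have [measurable]: "(\<lambda>(y, x). increment_product \<theta>1 \<theta>2 w y x) \<in> borel_measurable (borel \<Otimes>\<^sub>M borel)"
    by (simp add: borel_prod)
  show "(\<lambda>y. \<integral>\<^sup>+ x. ennreal (increment_product \<theta>1 \<theta>2 w y x) * indicator Q x \<partial>lborel) \<in> borel_measurable borel"
    by measurable
  have "increment_product \<theta>1 \<theta>2 w y \<in> borel_measurable (borel \<Otimes>\<^sub>M borel)"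
    unfolding increment_product_def[abs_def] by measurable
  then show "increment_product \<theta>1 \<theta>2 w y \<in> borel_measurable borel" by (simp add: borel_prod)
qed

text \<open>The inner integral of the energy sees only the values of \<open>u\<close> in the domain, so it may be computed with the
  Borel representative \<open>u0\<close>; and \<open>norm z < \<epsilon>\<close> gives \<open>1 / norm z powr 2 \<ge> 1 / \<epsilon>\<^sup>2\<close>.\<close>

lemma energy_integrand_in_frame:
  fixes u u0 :: "real^2 \<Rightarrow> real"
  assumes e: "orthonormal_frame e1 e2" and u0[measurable]: "u0 \<in> borel_measurable borel"
    and ae: "AE x in lborel. x \<in> frame e1 e2 ` ({i0<..<i1} \<times> {j0<..<j1}) \<longrightarrow> u x = u0 x"
    and z: "norm z < \<epsilon>" "z \<noteq> 0"
  shows "ennreal (1 / \<epsilon>\<^sup>2) * (\<integral>\<^sup>+ x. ennreal (increment_product \<theta>1 \<theta>2 (\<lambda>x. u0 (frame e1 e2 x)) (z \<bullet> e1, z \<bullet> e2) x)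
              * indicator ({i0 + \<epsilon>..i1 - \<epsilon>} \<times> {j0 + \<epsilon>..j1 - \<epsilon>}) x \<partial>lborel)
    \<le> (\<integral>\<^sup>+ x. ennreal (\<bar>u (x + (z \<bullet> e1) *\<^sub>R e1) - u x\<bar> powr \<theta>1 * \<bar>u (x + (z \<bullet> e2) *\<^sub>R e2) - u x\<bar> powr \<theta>2 / norm z powr 2)
          \<partial>lebesgue_on (frame e1 e2 ` ({i0 + \<epsilon>..i1 - \<epsilon>} \<times> {j0 + \<epsilon>..j1 - \<epsilon>})))"
proof -
  let ?\<Omega> = "frame e1 e2 ` ({i0<..<i1} \<times> {j0<..<j1})"
  let ?Q = "{i0 + \<epsilon>..i1 - \<epsilon>} \<times> {j0 + \<epsilon>..j1 - \<epsilon>}"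
  let ?S = "frame e1 e2 ` ?Q"
  let ?w = "\<lambda>x. u0 (frame e1 e2 x)"
  let ?z1 = "(z \<bullet> e1) *\<^sub>R e1" and ?z2 = "(z \<bullet> e2) *\<^sub>R e2"
  let ?B = "\<lambda>u x. \<bar>u (x + ?z1) - u x\<bar> powr \<theta>1 * \<bar>u (x + ?z2) - u x\<bar> powr \<theta>2 / norm z powr 2"
  have Q[measurable]: "?Q \<in> sets borel" unfolding borel_prod[symmetric] by measurable
  have S[measurable]: "?S \<in> sets borel" by (rule frame_image_sets[OF e Q])
  have n1: "norm e1 = 1" "norm e2 = 1" using e by (auto simp: orthonormal_frame_def norm_eq_sqrt_inner)
  have zb: "\<bar>z \<bullet> e1\<bar> < \<epsilon>" "\<bar>z \<bullet> e2\<bar> < \<epsilon>"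
    using Cauchy_Schwarz_ineq2[of z e1] Cauchy_Schwarz_ineq2[of z e2] z(1) n1 by auto
  have in\<Omega>: "x \<in> ?\<Omega>" "x + ?z1 \<in> ?\<Omega>" "x + ?z2 \<in> ?\<Omega>" if "x \<in> ?S" for x
  proof -
    have ip: "e1 \<bullet> e1 = 1" "e2 \<bullet> e2 = 1" "e1 \<bullet> e2 = 0" "e2 \<bullet> e1 = 0"
      using e by (auto simp: orthonormal_frame_def inner_commute)
    show "x \<in> ?\<Omega>" "x + ?z1 \<in> ?\<Omega>" "x + ?z2 \<in> ?\<Omega>"
      using that zb z(1) norm_ge_zero[of z] unfolding frame_image[OF e] by (auto simp: inner_add_left ip)
  qed
  have "(\<integral>\<^sup>+ x. ennreal (?B u x) \<partial>lebesgue_on ?S) = (\<integral>\<^sup>+ x. ennreal (?B u x) * indicator ?S x \<partial>lebesgue)"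
    by (rule nn_integral_restrict_space) simp
  also have "\<dots> = (\<integral>\<^sup>+ x. ennreal (?B u x) * indicator ?S x \<partial>lborel)" by (rule nn_integral_completion)
  also have "\<dots> = (\<integral>\<^sup>+ x. ennreal (?B u0 x) * indicator ?S x \<partial>lborel)"
  proof (rule nn_integral_cong_AE)
    show "AE x in lborel. ennreal (?B u x) * indicator ?S x = ennreal (?B u0 x) * indicator ?S x"
      using ae AE_lborel_translate[OF ae, of ?z1] AE_lborel_translate[OF ae, of ?z2]
    proof eventually_elim
      fix x assume "x \<in> ?\<Omega> \<longrightarrow> u x = u0 x" "x + ?z1 \<in> ?\<Omega> \<longrightarrow> u (x + ?z1) = u0 (x + ?z1)"
        "x + ?z2 \<in> ?\<Omega> \<longrightarrow> u (x + ?z2) = u0 (x + ?z2)"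
      then show "ennreal (?B u x) * indicator ?S x = ennreal (?B u0 x) * indicator ?S x"
        using in\<Omega>[of x] by (cases "x \<in> ?S") simp_all
    qed
  qed
  also have "\<dots> = (\<integral>\<^sup>+ x. ennreal (?B u0 (frame e1 e2 x)) * indicator ?S (frame e1 e2 x) \<partial>lborel)"
    by (rule nn_integral_frame[OF e]) measurable
  also have "\<dots> = (\<integral>\<^sup>+ x. ennreal (increment_product \<theta>1 \<theta>2 ?w (z \<bullet> e1, z \<bullet> e2) x / norm z powr 2) * indicator ?Q x \<partial>lborel)"
  proof (intro nn_integral_cong)
    fix x
    have "frame e1 e2 x + ?z1 = frame e1 e2 (fst x + z \<bullet> e1, snd x)" "frame e1 e2 x + ?z2 = frame e1 e2 (fst x, snd x + z \<bullet> e2)"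
      by (simp_all add: frame_def algebra_simps)
    moreover have "indicator ?S (frame e1 e2 x) = (indicator ?Q x :: ennreal)"
      unfolding frame_image[OF e] by (simp add: indicator_def frame_inner[OF e])
    ultimately show "ennreal (?B u0 (frame e1 e2 x)) * indicator ?S (frame e1 e2 x)
       = ennreal (increment_product \<theta>1 \<theta>2 ?w (z \<bullet> e1, z \<bullet> e2) x / norm z powr 2) * indicator ?Q x"
      by (simp add: increment_product_def)
  qed
  also have "\<dots> \<ge> (\<integral>\<^sup>+ x. ennreal (1 / \<epsilon>\<^sup>2) * (ennreal (increment_product \<theta>1 \<theta>2 ?w (z \<bullet> e1, z \<bullet> e2) x) * indicator ?Q x) \<partial>lborel)"
  proof (rule nn_integral_mono)
    fix x
    have "norm z powr 2 \<le> \<epsilon>\<^sup>2"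
      using z by (simp add: power_mono)
    moreover have "0 < \<epsilon>" using z(1) norm_ge_zero[of z] by linarith
    ultimately have "1 / \<epsilon>\<^sup>2 \<le> 1 / norm z powr 2" using z by (intro divide_left_mono) auto
    moreover have ip0: "0 \<le> increment_product \<theta>1 \<theta>2 ?w (z \<bullet> e1, z \<bullet> e2) x" by (simp add: increment_product_def)
    ultimately have "1 / \<epsilon>\<^sup>2 * increment_product \<theta>1 \<theta>2 ?w (z \<bullet> e1, z \<bullet> e2) x \<le> 1 / norm z powr 2 * increment_product \<theta>1 \<theta>2 ?w (z \<bullet> e1, z \<bullet> e2) x"
      by (rule mult_right_mono)
    then have "ennreal (1 / \<epsilon>\<^sup>2) * ennreal (increment_product \<theta>1 \<theta>2 ?w (z \<bullet> e1, z \<bullet> e2) x) \<le> ennreal (increment_product \<theta>1 \<theta>2 ?w (z \<bullet> e1, z \<bullet> e2) x / norm z powr 2)"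
      using ip0 by (subst ennreal_mult[symmetric]) (auto intro!: ennreal_leI)
    then show "ennreal (1 / \<epsilon>\<^sup>2) * (ennreal (increment_product \<theta>1 \<theta>2 ?w (z \<bullet> e1, z \<bullet> e2) x) * indicator ?Q x)
       \<le> ennreal (increment_product \<theta>1 \<theta>2 ?w (z \<bullet> e1, z \<bullet> e2) x / norm z powr 2) * indicator ?Q x"
      unfolding mult.assoc[symmetric] by (rule mult_right_mono) simp
  qed
  also have "(\<integral>\<^sup>+ x. ennreal (1 / \<epsilon>\<^sup>2) * (ennreal (increment_product \<theta>1 \<theta>2 ?w (z \<bullet> e1, z \<bullet> e2) x) * indicator ?Q x) \<partial>lborel)
     = ennreal (1 / \<epsilon>\<^sup>2) * (\<integral>\<^sup>+ x. ennreal (increment_product \<theta>1 \<theta>2 ?w (z \<bullet> e1, z \<bullet> e2) x) * indicator ?Q x \<partial>lborel)"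
  proof (rule nn_integral_cmult)
    have [measurable]: "increment_product \<theta>1 \<theta>2 ?w (z \<bullet> e1, z \<bullet> e2) \<in> borel_measurable borel"
      by (rule increment_integral_measurable(2)[OF _ Q]) measurable
    show "(\<lambda>x. ennreal (increment_product \<theta>1 \<theta>2 ?w (z \<bullet> e1, z \<bullet> e2) x) * indicator ?Q x) \<in> borel_measurable lborel"
      by measurable
  qed
  finally show ?thesis .
qed

text \<open>Average the inner integral over the increments, with the kernel as weight. By the symmetry of the kernel, the four
  choices of signs may be summed.\<close>

lemma exists_good_increments:
  fixes u u0 \<rho> \<rho>0 :: "real^2 \<Rightarrow> real"
  assumes e: "orthonormal_frame e1 e2" and u0[measurable]: "u0 \<in> borel_measurable borel"
    and ae: "AE x in lborel. x \<in> frame e1 e2 ` ({i0<..<i1} \<times> {j0<..<j1}) \<longrightarrow> u x = u0 x"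
    and comp: "\<And>z. component X1 X2 z = (z \<bullet> e1) *\<^sub>R e1" "\<And>z. component X2 X1 z = (z \<bullet> e2) *\<^sub>R e2"
    and inner: "inner_part X1 \<Omega>1 \<epsilon> + inner_part X2 \<Omega>2 \<epsilon> = frame e1 e2 ` ({i0 + \<epsilon>..i1 - \<epsilon>} \<times> {j0 + \<epsilon>..j1 - \<epsilon>})"
    and \<rho>0[measurable]: "\<rho>0 \<in> borel_measurable borel" "\<And>z. 0 \<le> \<rho>0 z" "AE z in lborel. \<rho> z = \<rho>0 z"
    and c: "c > 0" and \<kappa>: "\<kappa> > 0"
      "ennreal \<kappa> \<le> (\<integral>\<^sup>+ x. ennreal (\<rho>0 (frame e1 e2 x)) * indicator {x. c < fst x \<and> c < snd x \<and> norm x < 1} x \<partial>lborel)"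
    and sym: "\<And>\<sigma> \<tau>. \<sigma> \<in> {1, -1} \<Longrightarrow> \<tau> \<in> {1, -1} \<Longrightarrow> AE x in lborel. \<rho>0 (frame (\<sigma> *\<^sub>R e1) (\<tau> *\<^sub>R e2) x) = \<rho>0 (frame e1 e2 x)"
    and \<epsilon>: "\<epsilon> > 0" and E: "energy_eps X1 X2 \<Omega>1 \<Omega>2 \<rho> \<theta>1 \<theta>2 2 \<epsilon> u < ennreal M" and M: "M > 0"
  shows "\<exists>a b. c * \<epsilon> < a \<and> a < \<epsilon> \<and> c * \<epsilon> < b \<and> b < \<epsilon> \<and>
    (\<integral>\<^sup>+ x. ennreal (corner_density \<theta>1 \<theta>2 (\<lambda>x. u0 (frame e1 e2 x)) a b x) * indicator ({i0 + \<epsilon>..i1 - \<epsilon>} \<times> {j0 + \<epsilon>..j1 - \<epsilon>}) x \<partial>lborel)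
       \<le> ennreal (4 * \<epsilon>\<^sup>2 * M / \<kappa>)"
proof (rule ccontr)
  assume contra: "\<not> ?thesis"
  let ?Q = "{i0 + \<epsilon>..i1 - \<epsilon>} \<times> {j0 + \<epsilon>..j1 - \<epsilon>}"
  let ?w = "\<lambda>x. u0 (frame e1 e2 x)"
  have Q[measurable]: "?Q \<in> sets borel" unfolding borel_prod[symmetric] by measurable
  have wm[measurable]: "?w \<in> borel_measurable borel" by measurable
  note ipm[measurable] = increment_integral_measurable(2)[OF wm Q]
  define H where "H y = (\<integral>\<^sup>+ x. ennreal (increment_product \<theta>1 \<theta>2 ?w y x) * indicator ?Q x \<partial>lborel)" for y
  define Hs where "Hs y = (\<integral>\<^sup>+ x. ennreal (corner_density \<theta>1 \<theta>2 ?w (fst y) (snd y) x) * indicator ?Q x \<partial>lborel)" for y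
  have Hm[measurable]: "H \<in> borel_measurable borel"
    unfolding H_def[abs_def] by (rule increment_integral_measurable(1)[OF wm Q])
  define F where "F z = ennreal (\<rho>0 (z /\<^sub>R \<epsilon>) / \<epsilon> ^ 4) * indicator {z. norm z < \<epsilon>} z * H (z \<bullet> e1, z \<bullet> e2)" for z
  have im: "(\<lambda>z. (z \<bullet> e1, z \<bullet> e2)) \<in> measurable borel borel"
    by (intro borel_measurable_continuous_onI continuous_intros)
  have [measurable]: "(\<lambda>z. H (z \<bullet> e1, z \<bullet> e2)) \<in> borel_measurable borel"
    by (rule measurable_compose[OF im Hm])
  have Fm[measurable]: "F \<in> borel_measurable borel" unfolding F_def[abs_def] by measurable
  have inv0: "inverse \<epsilon> \<noteq> 0" using \<epsilon> by simp
  have FE: "(\<integral>\<^sup>+ z. F z \<partial>lborel) \<le> energy_eps X1 X2 \<Omega>1 \<Omega>2 \<rho> \<theta>1 \<theta>2 2 \<epsilon> u"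
    unfolding energy_eps_def comp inner nn_integral_completion
  proof (rule nn_integral_mono_AE)
    show "AE z in lborel. F z \<le> ennreal (rescaled \<rho> \<epsilon> z) *
        (\<integral>\<^sup>+ x. ennreal (\<bar>u (x + (z \<bullet> e1) *\<^sub>R e1) - u x\<bar> powr \<theta>1 * \<bar>u (x + (z \<bullet> e2) *\<^sub>R e2) - u x\<bar> powr \<theta>2 / norm z powr 2)
          \<partial>lebesgue_on (frame e1 e2 ` ?Q))"
      using AE_lborel_scale[OF \<rho>0(3) inv0] AE_lborel_singleton[of 0]
    proof eventually_elim
      fix z assume r: "\<rho> (z /\<^sub>R \<epsilon>) = \<rho>0 (z /\<^sub>R \<epsilon>)" and z0: "z \<noteq> 0"
      show "F z \<le> ennreal (rescaled \<rho> \<epsilon> z) *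
        (\<integral>\<^sup>+ x. ennreal (\<bar>u (x + (z \<bullet> e1) *\<^sub>R e1) - u x\<bar> powr \<theta>1 * \<bar>u (x + (z \<bullet> e2) *\<^sub>R e2) - u x\<bar> powr \<theta>2 / norm z powr 2)
          \<partial>lebesgue_on (frame e1 e2 ` ?Q))" (is "_ \<le> _ * ?I")
      proof (cases "norm z < \<epsilon>")
        case True
        have "F z = ennreal (rescaled \<rho> \<epsilon> z) * (ennreal (1 / \<epsilon>\<^sup>2) * H (z \<bullet> e1, z \<bullet> e2))"
          using True \<epsilon> \<rho>0(2) unfolding F_def rescaled_def r mult.assoc[symmetric]
          by (subst ennreal_mult[symmetric]) (auto simp: power2_eq_square power4_eq_xxxx mult.assoc)
        also have "\<dots> \<le> ennreal (rescaled \<rho> \<epsilon> z) * ?I"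
          unfolding H_def by (intro mult_left_mono energy_integrand_in_frame[OF e u0 ae True z0]) simp
        finally show ?thesis .
      qed (simp add: F_def)
    qed
  qed
  let ?G = "\<lambda>x. ennreal (\<rho>0 (frame e1 e2 (x /\<^sub>R \<epsilon>)) / \<epsilon> ^ 4) * indicator {x. norm x < \<epsilon>} x"
  have nm: "{x :: real \<times> real. norm x < r} \<in> sets borel" for r
    by (intro borel_open open_Collect_less continuous_intros)
  have Gm[measurable]: "?G \<in> borel_measurable borel" using nm[of \<epsilon>] by measurable
  have flip[measurable]: "(\<lambda>x. H (\<sigma> * fst x, \<tau> * snd x)) \<in> borel_measurable borel" for \<sigma> \<tau>
  proof -
    have "(\<lambda>x::real \<times> real. (\<sigma> * fst x, \<tau> * snd x)) \<in> measurable borel borel"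
      by (intro borel_measurable_continuous_onI continuous_intros)
    from measurable_compose[OF this Hm] show ?thesis .
  qed
  \<comment> \<open>Four times the energy dominates the sum over the four reflections of the increment.\<close>
  have one: "(\<integral>\<^sup>+ x. ?G x * H (\<sigma> * fst x, \<tau> * snd x) \<partial>lborel) = (\<integral>\<^sup>+ z. F z \<partial>lborel)"
    if s: "\<sigma> \<in> {1, -1}" "\<tau> \<in> {1, -1}" for \<sigma> \<tau>
  proof -
    let ?f = "frame (\<sigma> *\<^sub>R e1) (\<tau> *\<^sub>R e2)"
    have es: "orthonormal_frame (\<sigma> *\<^sub>R e1) (\<tau> *\<^sub>R e2)" by (rule orthonormal_frame_signs[OF e s])
    have "(\<integral>\<^sup>+ z. F z \<partial>lborel) = (\<integral>\<^sup>+ x. F (?f x) \<partial>lborel)" by (rule nn_integral_frame[OF es]) measurable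
    also have "\<dots> = (\<integral>\<^sup>+ x. ?G x * H (\<sigma> * fst x, \<tau> * snd x) \<partial>lborel)"
    proof (rule nn_integral_cong_AE)
      have "AE x in lborel. \<rho>0 (?f (x /\<^sub>R \<epsilon>)) = \<rho>0 (frame e1 e2 (x /\<^sub>R \<epsilon>))"
        using AE_lborel_scale[OF sym[OF s] inv0] .
      then show "AE x in lborel. F (?f x) = ?G x * H (\<sigma> * fst x, \<tau> * snd x)"
      proof eventually_elim
        fix x assume r: "\<rho>0 (?f (x /\<^sub>R \<epsilon>)) = \<rho>0 (frame e1 e2 (x /\<^sub>R \<epsilon>))"
        have f: "?f x = frame e1 e2 (\<sigma> * fst x, \<tau> * snd x)" by (simp add: frame_def mult.commute)
        have "?f x /\<^sub>R \<epsilon> = ?f (x /\<^sub>R \<epsilon>)" by (simp add: frame_def algebra_simps)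
        moreover have "?f x \<bullet> e1 = \<sigma> * fst x" "?f x \<bullet> e2 = \<tau> * snd x"
          unfolding f by (simp_all add: frame_inner[OF e])
        ultimately show "F (?f x) = ?G x * H (\<sigma> * fst x, \<tau> * snd x)"
          using r by (simp add: F_def frame_norm[OF es] indicator_def)
      qed
    qed
    finally show ?thesis by simp
  qed
  have Hsum: "Hs x = (H (1 * fst x, 1 * snd x) + H (1 * fst x, -1 * snd x)) + (H (-1 * fst x, 1 * snd x) + H (-1 * fst x, -1 * snd x))" for x
  proof -
    let ?i = "\<lambda>y x. ennreal (increment_product \<theta>1 \<theta>2 ?w y x) * indicator ?Q x"
    have ip0: "0 \<le> increment_product \<theta>1 \<theta>2 ?w y x" for y x by (simp add: increment_product_def)
    have "Hs x = (\<integral>\<^sup>+ y. (?i (fst x, snd x) y + ?i (fst x, - snd x) y) + (?i (- fst x, snd x) y + ?i (- fst x, - snd x) y) \<partial>lborel)"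
      unfolding Hs_def corner_density_eq_sum
      by (intro nn_integral_cong) (simp add: ip0 distrib_right)
    also have "\<dots> = (H (fst x, snd x) + H (fst x, - snd x)) + (H (- fst x, snd x) + H (- fst x, - snd x))"
      unfolding H_def by (simp add: nn_integral_add)
    finally show ?thesis by simp
  qed
  have "(\<integral>\<^sup>+ x. ?G x * Hs x \<partial>lborel)
     = (\<integral>\<^sup>+ x. (?G x * H (1 * fst x, 1 * snd x) + ?G x * H (1 * fst x, -1 * snd x)) + (?G x * H (-1 * fst x, 1 * snd x) + ?G x * H (-1 * fst x, -1 * snd x)) \<partial>lborel)"
    unfolding Hsum by (simp only: distrib_left)
  also have "\<dots> = ((\<integral>\<^sup>+ x. ?G x * H (1 * fst x, 1 * snd x) \<partial>lborel) + (\<integral>\<^sup>+ x. ?G x * H (1 * fst x, -1 * snd x) \<partial>lborel))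
     + ((\<integral>\<^sup>+ x. ?G x * H (-1 * fst x, 1 * snd x) \<partial>lborel) + (\<integral>\<^sup>+ x. ?G x * H (-1 * fst x, -1 * snd x) \<partial>lborel))"
    by (subst nn_integral_add, measurable, subst nn_integral_add, measurable, subst nn_integral_add, measurable)
  also have "\<dots> = ((\<integral>\<^sup>+ z. F z \<partial>lborel) + (\<integral>\<^sup>+ z. F z \<partial>lborel)) + ((\<integral>\<^sup>+ z. F z \<partial>lborel) + (\<integral>\<^sup>+ z. F z \<partial>lborel))"
    by (subst (1 2 3 4) one) auto
  also have "\<dots> < (ennreal M + ennreal M) + (ennreal M + ennreal M)"
    using le_less_trans[OF FE E] by (intro add_strict_mono)
  also have "\<dots> = ennreal (4 * M)" using M by (simp add: ennreal_plus[symmetric] del: ennreal_plus)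
  finally have up: "(\<integral>\<^sup>+ x. ?G x * Hs x \<partial>lborel) < ennreal (4 * M)" .
  have Hsm[measurable]: "Hs \<in> borel_measurable borel" unfolding Hsum[abs_def] by measurable
  define \<Lambda> where "\<Lambda> = 4 * \<epsilon>\<^sup>2 * M / \<kappa>"
  have \<Lambda>: "\<Lambda> > 0" using \<epsilon> M \<kappa> by (simp add: \<Lambda>_def)
  let ?C = "{x :: real \<times> real. c < fst x \<and> c < snd x \<and> norm x < 1}"
  have Cm[measurable]: "?C \<in> sets borel"
    by (intro borel_open open_Collect_conj open_Collect_less continuous_intros)
  have big: "ennreal \<Lambda> \<le> Hs (\<epsilon> *\<^sub>R x)" if x: "x \<in> ?C" for x
  proof -
    have "\<bar>fst x\<bar> \<le> norm x" "\<bar>snd x\<bar> \<le> norm x"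
      using norm_fst_le[of "fst x" "snd x"] norm_snd_le[of "snd x" "fst x"] by simp_all
    then have "c * \<epsilon> < \<epsilon> * fst x" "\<epsilon> * fst x < \<epsilon>" "c * \<epsilon> < \<epsilon> * snd x" "\<epsilon> * snd x < \<epsilon>"
      using x \<epsilon> by (auto simp: mult.commute)
    then have "\<not> Hs (\<epsilon> *\<^sub>R x) \<le> ennreal \<Lambda>"
      using contra unfolding Hs_def \<Lambda>_def by (simp only: fst_scaleR snd_scaleR real_scaleR_def) blast
    then show ?thesis by simp
  qed
  have "ennreal (4 * M) = ennreal (\<Lambda> / \<epsilon>\<^sup>2) * ennreal \<kappa>"
    using \<epsilon> M \<kappa> \<Lambda> by (subst ennreal_mult[symmetric]) (auto simp: \<Lambda>_def)
  also have "\<dots> \<le> ennreal (\<Lambda> / \<epsilon>\<^sup>2) * (\<integral>\<^sup>+ x. ennreal (\<rho>0 (frame e1 e2 x)) * indicator ?C x \<partial>lborel)"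
    by (intro mult_left_mono \<kappa>(2)) simp
  also have "\<dots> = (\<integral>\<^sup>+ x. ennreal (\<Lambda> / \<epsilon>\<^sup>2) * (ennreal (\<rho>0 (frame e1 e2 x)) * indicator ?C x) \<partial>lborel)"
    by (rule nn_integral_cmult[symmetric]) measurable
  also have "\<dots> \<le> (\<integral>\<^sup>+ x. ennreal (\<epsilon>\<^sup>2) * (?G (\<epsilon> *\<^sub>R x) * Hs (\<epsilon> *\<^sub>R x)) \<partial>lborel)"
  proof (rule nn_integral_mono)
    fix x
    show "ennreal (\<Lambda> / \<epsilon>\<^sup>2) * (ennreal (\<rho>0 (frame e1 e2 x)) * indicator ?C x) \<le> ennreal (\<epsilon>\<^sup>2) * (?G (\<epsilon> *\<^sub>R x) * Hs (\<epsilon> *\<^sub>R x))"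
    proof (cases "x \<in> ?C")
      case True
      have "ennreal (\<Lambda> / \<epsilon>\<^sup>2) * (ennreal (\<rho>0 (frame e1 e2 x)) * indicator ?C x) = ennreal (\<epsilon>\<^sup>2) * (ennreal (\<rho>0 (frame e1 e2 x) / \<epsilon> ^ 4) * ennreal \<Lambda>)"
        using True \<Lambda> \<epsilon> \<rho>0(2) by (simp add: ennreal_mult[symmetric]) (simp add: power2_eq_square power4_eq_xxxx)
      also have "\<dots> \<le> ennreal (\<epsilon>\<^sup>2) * (ennreal (\<rho>0 (frame e1 e2 x) / \<epsilon> ^ 4) * Hs (\<epsilon> *\<^sub>R x))"
        by (intro mult_left_mono big[OF True]) auto
      also have "ennreal (\<rho>0 (frame e1 e2 x) / \<epsilon> ^ 4) = ?G (\<epsilon> *\<^sub>R x)"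
        using True \<epsilon> by (simp add: indicator_def)
      finally show ?thesis .
    qed simp
  qed
  also have "\<dots> = ennreal (\<epsilon>\<^sup>2) * (\<integral>\<^sup>+ x. ?G (\<epsilon> *\<^sub>R x) * Hs (\<epsilon> *\<^sub>R x) \<partial>lborel)"
  proof (rule nn_integral_cmult)
    have "(\<lambda>x::real \<times> real. \<epsilon> *\<^sub>R x) \<in> measurable borel borel" by measurable
    moreover have "(\<lambda>x. ?G x * Hs x) \<in> borel_measurable borel" by measurable
    ultimately have "(\<lambda>x. ?G (\<epsilon> *\<^sub>R x) * Hs (\<epsilon> *\<^sub>R x)) \<in> borel_measurable borel" by (rule measurable_compose)
    then show "(\<lambda>x. ?G (\<epsilon> *\<^sub>R x) * Hs (\<epsilon> *\<^sub>R x)) \<in> borel_measurable lborel" by simp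
  qed
  also have "\<dots> = (\<integral>\<^sup>+ x. ?G x * Hs x \<partial>lborel)"
    by (rule nn_integral_scale2[OF _ \<epsilon>, symmetric]) measurable
  finally show False using up by simp
qed

section \<open>Geometry of the domain and conclusion\<close>

lemma line_unit_vector:
  fixes X :: "'a::euclidean_space set"
  assumes "subspace X" "dim X = 1"
  obtains e where "e \<bullet> e = 1" "X = range (\<lambda>t. t *\<^sub>R e)"
proof -
  obtain B where B: "B \<subseteq> X" "\<And>x. x \<in> B \<Longrightarrow> norm x = 1" "card B = dim X" "span B = X"
    using orthonormal_basis_subspace[OF assms(1)] by metis
  then obtain e where e: "B = {e}" using assms(2) by (auto simp: card_1_singleton_iff)
  have "X = range (\<lambda>t. t *\<^sub>R e)" using B(4) unfolding e span_singleton by simp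
  moreover have "norm e = 1" using B(2) e by simp
  ultimately show ?thesis by (intro that[of e]) (auto simp: norm_eq_1)
qed

lemma component_frame:
  assumes e: "orthonormal_frame e1 e2" and X: "X1 = range (\<lambda>t. t *\<^sub>R e1)" "X2 = range (\<lambda>t. t *\<^sub>R e2)"
  shows "component X1 X2 z = (z \<bullet> e1) *\<^sub>R e1"
  unfolding component_def
proof (rule the_equality)
  have "z - (z \<bullet> e1) *\<^sub>R e1 = (z \<bullet> e2) *\<^sub>R e2"
    using frame_decompose[OF e, of z] by (simp add: frame_def diff_eq_eq add.commute)
  then show "(z \<bullet> e1) *\<^sub>R e1 \<in> X1 \<and> z - (z \<bullet> e1) *\<^sub>R e1 \<in> X2" using X by auto
  fix a assume "a \<in> X1 \<and> z - a \<in> X2"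
  then obtain s t where st: "a = s *\<^sub>R e1" "z - a = t *\<^sub>R e2" using X by auto
  then have "z = frame e1 e2 (s, t)" by (simp add: frame_def diff_eq_eq add.commute)
  then show "a = (z \<bullet> e1) *\<^sub>R e1" by (simp add: st(1) frame_inner[OF e])
qed

lemma open_connected_bounded_real:
  fixes U :: "real set"
  assumes "open U" "connected U" "bounded U" "U \<noteq> {}"
  obtains a b where "a < b" "U = {a<..<b}"
proof -
  have bd: "bdd_below U" "bdd_above U" using assms(3) by (auto simp: bounded_imp_bdd_below bounded_imp_bdd_above)
  have "U = {Inf U<..<Sup U}"
  proof (intro set_eqI iffI)
    fix x assume x: "x \<in> U"
    then obtain d where d: "d > 0" "ball x d \<subseteq> U" using assms(1) by (auto simp: open_contains_ball)
    have "x - d / 2 \<in> U" "x + d / 2 \<in> U" using d by (auto simp: subset_iff dist_real_def)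
    then have "Inf U \<le> x - d / 2" "x + d / 2 \<le> Sup U" using bd by (auto intro: cInf_lower cSup_upper)
    then show "x \<in> {Inf U<..<Sup U}" using d(1) by auto
  next
    fix x assume x: "x \<in> {Inf U<..<Sup U}"
    then obtain y z where "y \<in> U" "y < x" "z \<in> U" "x < z"
      using cInf_less_iff[OF assms(4) bd(1)] less_cSup_iff[OF assms(4) bd(2)] by auto
    then show "x \<in> U" using assms(2) unfolding connected_iff_interval by (meson less_imp_le)
  qed
  moreover from this have "Inf U < Sup U" using assms(4) by (metis greaterThanLessThan_empty not_less)
  ultimately show ?thesis by (rule that[rotated])
qed

lemma line_domain_interval:
  fixes e :: "'a::euclidean_space"
  assumes e: "e \<bullet> e = 1" and X: "X = range (\<lambda>t. t *\<^sub>R e)" and U: "bounded_domain_in X U"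
  obtains a b where "a < b" "U = (\<lambda>t. t *\<^sub>R e) ` {a<..<b}"
proof -
  have U': "openin (top_of_set X) U" "U \<noteq> {}" "bounded U" "connected U" using U by (auto simp: bounded_domain_in_def)
  obtain T where T: "open T" "U = X \<inter> T" using U'(1) by (auto simp: openin_open)
  define V where "V = (\<lambda>t. t *\<^sub>R e) -` U"
  have VU: "U = (\<lambda>t. t *\<^sub>R e) ` V" using T(2) X by (auto simp: V_def)
  have "V = (\<lambda>t. t *\<^sub>R e) -` T" using T(2) X by (auto simp: V_def)
  then have 1: "open V" using T(1) by (auto intro!: open_vimage continuous_intros)
  have V2: "V = (\<lambda>z. z \<bullet> e) ` U" unfolding VU image_image using e by simp
  have 2: "connected V" unfolding V2 by (intro connected_continuous_image U' continuous_intros)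
  have 3: "bounded V" unfolding V2 by (intro bounded_linear_image[OF U'(3)] bounded_linear_inner_left)
  have 4: "V \<noteq> {}" using VU U'(2) by auto
  obtain a b where "a < b" "V = {a<..<b}" using open_connected_bounded_real[OF 1 2 3 4] .
  then show ?thesis using that VU by metis
qed

lemma inner_part_interval:
  fixes e :: "'a::euclidean_space"
  assumes e: "e \<bullet> e = 1" and X: "X = range (\<lambda>t. t *\<^sub>R e)" and \<epsilon>: "\<epsilon> > 0"
  shows "inner_part X ((\<lambda>t. t *\<^sub>R e) ` {a<..<b}) \<epsilon> = (\<lambda>t. t *\<^sub>R e) ` {a + \<epsilon>..b - \<epsilon>}"
proof -
  have ne: "norm (t *\<^sub>R e) = \<bar>t\<bar>" for t using e by (simp add: norm_eq_sqrt_inner)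
  have e0: "e \<noteq> 0" using e by auto
  have mem: "x \<in> (\<lambda>x. x - z) ` S \<longleftrightarrow> x + z \<in> S" for x z :: 'a and S by force
  have inj: "t *\<^sub>R e \<in> (\<lambda>t. t *\<^sub>R e) ` S \<longleftrightarrow> t \<in> S" for t S using e0 by auto
  have iff: "x \<in> inner_part X ((\<lambda>t. t *\<^sub>R e) ` {a<..<b}) \<epsilon> \<longleftrightarrow> (\<forall>r. \<bar>r\<bar> < \<epsilon> \<longrightarrow> x + r *\<^sub>R e \<in> (\<lambda>t. t *\<^sub>R e) ` {a<..<b})" for x
  proof -
    have "{z \<in> X. norm z < \<epsilon>} = (\<lambda>r. r *\<^sub>R e) ` {r. \<bar>r\<bar> < \<epsilon>}"
      unfolding X using e by (auto simp: norm_eq_1[symmetric])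
    then show ?thesis unfolding inner_part_def INT_iff mem by simp
  qed
  show ?thesis
  proof (intro set_eqI iffI)
    fix x assume "x \<in> inner_part X ((\<lambda>t. t *\<^sub>R e) ` {a<..<b}) \<epsilon>"
    then have *: "x + r *\<^sub>R e \<in> (\<lambda>t. t *\<^sub>R e) ` {a<..<b}" if "\<bar>r\<bar> < \<epsilon>" for r using that iff by blast
    from *[of 0] \<epsilon> obtain t where t: "t \<in> {a<..<b}" "x = t *\<^sub>R e" by auto
    have **: "t + r \<in> {a<..<b}" if "\<bar>r\<bar> < \<epsilon>" for r
      using *[OF that] unfolding t(2) scaleR_left_distrib[symmetric] inj .
    have "a + \<epsilon> \<le> t" using **[of "a - t"] t(1) by (force simp: not_le)
    moreover have "t \<le> b - \<epsilon>" using **[of "b - t"] t(1) by (force simp: not_le)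
    ultimately show "x \<in> (\<lambda>t. t *\<^sub>R e) ` {a + \<epsilon>..b - \<epsilon>}" using t by auto
  next
    fix x assume "x \<in> (\<lambda>t. t *\<^sub>R e) ` {a + \<epsilon>..b - \<epsilon>}"
    then obtain t where t: "t \<in> {a + \<epsilon>..b - \<epsilon>}" "x = t *\<^sub>R e" by auto
    show "x \<in> inner_part X ((\<lambda>t. t *\<^sub>R e) ` {a<..<b}) \<epsilon>"
      unfolding iff t(2) scaleR_left_distrib[symmetric] inj using t(1) by auto
  qed
qed

lemma sum_of_segments:
  "(\<lambda>t. t *\<^sub>R e1) ` I + (\<lambda>t. t *\<^sub>R e2) ` J = frame e1 e2 ` (I \<times> J)"
  by (force simp: frame_def set_plus_def image_iff)

lemma gradient_measure_cong_AE:
  assumes "v \<in> borel_measurable (lebesgue_on U)" "v' \<in> borel_measurable (lebesgue_on U)"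
    and ae: "AE x in lebesgue_on U. v x = v' x" and v: "gradient_measure U v \<nu>"
  shows "gradient_measure U v' \<nu>"
proof -
  have "(LINT x|lebesgue_on U. v x * frechet_derivative f (at x) b) = (LINT x|lebesgue_on U. v' x * frechet_derivative f (at x) b)"
    if "f \<in> test_functions U" for f b
  proof -
    have "(\<lambda>x. frechet_derivative f (at x) b) \<in> borel_measurable borel"
      using test_function_directional(3)[OF that] by (rule borel_measurable_continuous_onI)
    then have [measurable]: "(\<lambda>x. frechet_derivative f (at x) b) \<in> borel_measurable (lebesgue_on U)"
      by (intro measurable_restrict_space1 measurable_completion) simp
    show ?thesis
      using assms(1,2) by (intro integral_cong_AE) (use ae in \<open>auto elim: eventually_mono\<close>)
  qed
  then show ?thesis using v unfolding gradient_measure_def by (simp cong: ball_cong)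
qed

lemma nn_integral_swap:
  fixes f :: "real \<times> real \<Rightarrow> ennreal"
  assumes [measurable]: "f \<in> borel_measurable borel"
  shows "(\<integral>\<^sup>+ x. f (prod.swap x) \<partial>lborel) = (\<integral>\<^sup>+ x. f x \<partial>lborel)"
proof -
  have "(\<lambda>x::real \<times> real. prod.swap x) \<in> borel_measurable borel"
    by (intro borel_measurable_continuous_onI) (auto simp: prod.swap_def intro!: continuous_intros)
  from measurable_compose[OF this assms]
  have m: "(\<lambda>x. f (prod.swap x)) \<in> borel_measurable borel" .
  show ?thesis
    unfolding nn_integral_lborel_pair(2)[OF m] nn_integral_lborel_pair(1)[OF assms] by simp
qed

lemma row_average_bound:
  assumes i: "i0 < i1" and [measurable]: "w \<in> borel_measurable borel" and b: "\<And>x. \<bar>w x\<bar> \<le> 1"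
  shows "\<bar>row_average i0 i1 w t\<bar> \<le> 1"
proof -
  have "ennreal \<bar>row_average i0 i1 w t\<bar> \<le> ennreal (1 / (i1 - i0)) * (\<integral>\<^sup>+ s. ennreal \<bar>w (s, t)\<bar> * indicator {i0<..<i1} s \<partial>lborel)"
    unfolding row_average_def by (rule average_le[OF i section_measurable(1) b]) measurable
  also have "\<dots> \<le> ennreal (1 / (i1 - i0)) * (\<integral>\<^sup>+ s. ennreal 1 * indicator {i0<..<i1} s \<partial>lborel)"
    by (intro mult_left_mono nn_integral_mono mult_right_mono ennreal_leI b) auto
  also have "\<dots> = ennreal 1" using i by (simp add: ennreal_mult[symmetric])
  finally show ?thesis by (simp add: ennreal_le_iff)
qed

text \<open>If \<open>u\<close>, in the coordinates given by \<open>e1\<close> and \<open>e2\<close>, is a limit of nearly column functions, then it differs from a function of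
  the second coordinate by a function of bounded variation.\<close>

lemma column_remainder_estimate:
  fixes u u0 :: "real^2 \<Rightarrow> real"
  assumes e: "orthonormal_frame e1 e2" and i: "i0 < i1" and j: "j0 < j1"
    and \<Omega>: "\<Omega> = frame e1 e2 ` ({i0<..<i1} \<times> {j0<..<j1})"
    and u: "u \<in> borel_measurable (lebesgue_on \<Omega>)" and u0[measurable]: "u0 \<in> borel_measurable borel" and u0b: "\<And>x. \<bar>u0 x\<bar> \<le> 1"
    and ae: "AE x in lborel. x \<in> \<Omega> \<longrightarrow> u x = u0 x" and K: "0 \<le> K"
    and approx: "\<And>\<delta>. \<delta> > 0 \<Longrightarrow> \<exists>g. nearly_column (K + \<delta>) g \<and>
       (\<integral>\<^sup>+ x. ennreal \<bar>g x - u0 (frame e1 e2 x)\<bar> * indicator ({i0<..<i1} \<times> {j0<..<j1}) x \<partial>lborel) \<le> ennreal \<delta>"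
  shows "\<exists>g \<in> borel_measurable borel. (\<lambda>x. u x - g (x \<bullet> e2)) \<in> BV_space \<Omega> \<inter> Linf_space \<Omega> \<and>
     Linf_norm \<Omega> (\<lambda>x. u x - g (x \<bullet> e2)) + grad_variation \<Omega> (\<lambda>x. u x - g (x \<bullet> e2))
       \<le> ennreal (K * (1 + (i1 - i0) + (j1 - j0)))"
proof -
  let ?R = "{i0<..<i1} \<times> {j0<..<j1}"
  let ?w = "\<lambda>x. u0 (frame e1 e2 x)"
  have wm: "?w \<in> borel_measurable borel" by measurable
  define g where "g = row_average i0 i1 ?w"
  have gm[measurable]: "g \<in> borel_measurable borel" unfolding g_def by (rule row_average_measurable[OF wm])
  have gb: "\<bar>g t\<bar> \<le> 1" for t unfolding g_def by (rule row_average_bound[OF i wm u0b])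
  define v where "v x = ?w x - g (snd x)" for x
  define v0 where "v0 z = u0 z - g (z \<bullet> e2)" for z
  have ipm[measurable]: "(\<lambda>z. z \<bullet> e2) \<in> borel_measurable borel"
    by (intro borel_measurable_continuous_onI continuous_intros)
  have v0m[measurable]: "v0 \<in> borel_measurable borel" unfolding v0_def[abs_def] by measurable
  have v0b: "\<bar>v0 x\<bar> \<le> 2" for x using u0b[of x] gb[of "x \<bullet> e2"] unfolding v0_def by linarith
  have v0v: "v0 (frame e1 e2 x) = v x" for x by (simp add: v0_def v_def frame_inner[OF e])
  note lim = limit_of_nearly_column[OF i j wm u0b K approx]
  have vm[measurable]: "v \<in> borel_measurable borel"
    unfolding v_def[abs_def] g_def by (rule lim(1))
  have AEv: "AE x in lborel. x \<in> ?R \<longrightarrow> \<bar>v x\<bar> \<le> K"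
    unfolding v_def g_def by (rule lim(2))
  have rect: "{a<..<b} \<times> {c<..<d} \<in> sets (borel :: (real \<times> real) measure)" for a b c d
    unfolding borel_prod[symmetric] by measurable
  have \<Omega>m[measurable]: "\<Omega> \<in> sets borel" unfolding \<Omega> by (rule frame_image_sets[OF e rect])
  have H1: "(\<integral>\<^sup>+ x. ennreal \<bar>v0 (frame e1 e2 (x + (h, 0))) - v0 (frame e1 e2 x)\<bar> * indicator ({i0<..<i1-h} \<times> {j0<..<j1}) x \<partial>lborel)
       \<le> ennreal (K * (j1 - j0) * h)" if "h > 0" for h
    unfolding v0v v_def g_def by (rule lim(3)[OF _ that])
  have H2: "(\<integral>\<^sup>+ x. ennreal \<bar>v0 (frame e2 e1 (x + (h, 0))) - v0 (frame e2 e1 x)\<bar> * indicator ({j0<..<j1-h} \<times> {i0<..<i1}) x \<partial>lborel)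
       \<le> ennreal (K * (i1 - i0) * h)" if h: "h > 0" for h
  proof -
    have fs: "frame e2 e1 x = frame e1 e2 (prod.swap x)" for x by (simp add: frame_def add.commute)
    let ?f = "\<lambda>x. ennreal \<bar>v (x + (0, h)) - v x\<bar> * indicator ({i0<..<i1} \<times> {j0<..<j1-h}) x"
    have fm: "?f \<in> borel_measurable borel" using rect[of i0 i1 j0 "j1 - h"] by measurable
    have "(\<integral>\<^sup>+ x. ennreal \<bar>v0 (frame e2 e1 (x + (h, 0))) - v0 (frame e2 e1 x)\<bar> * indicator ({j0<..<j1-h} \<times> {i0<..<i1}) x \<partial>lborel)
      = (\<integral>\<^sup>+ x. ?f (prod.swap x) \<partial>lborel)"
      unfolding fs v0v by (intro nn_integral_cong) (auto simp: indicator_def)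
    also have "\<dots> = (\<integral>\<^sup>+ x. ?f x \<partial>lborel)" by (rule nn_integral_swap[OF fm])
    also have "\<dots> \<le> ennreal (K * (i1 - i0) * h)" unfolding v_def g_def by (rule lim(4)[OF _ h])
    finally show ?thesis .
  qed
  have L: "0 \<le> K * (j1 - j0)" "0 \<le> K * (i1 - i0)" using K i j by auto
  obtain \<nu> where \<nu>: "gradient_measure \<Omega> v0 \<nu>" "total_variation \<Omega> \<nu> \<le> ennreal (K * (j1 - j0) + K * (i1 - i0))"
    using exists_gradient_measure[OF e v0m v0b i j L H1 H2 \<Omega>] by blast
  let ?v = "\<lambda>x. u x - g (x \<bullet> e2)"
  have v0l: "f \<in> borel_measurable (lebesgue_on \<Omega>)" if "f \<in> borel_measurable borel" for f :: "real^2 \<Rightarrow> real"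
    using that by (intro measurable_restrict_space1 measurable_completion) simp
  have vl: "?v \<in> borel_measurable (lebesgue_on \<Omega>)"
    by (intro borel_measurable_diff u v0l) measurable
  have ae': "AE x in lebesgue_on \<Omega>. v0 x = ?v x"
  proof -
    have "AE x in lebesgue. x \<in> \<Omega> \<longrightarrow> v0 x = ?v x"
      using ae unfolding AE_completion_iff by eventually_elim (simp add: v0_def)
    then show ?thesis by (subst AE_restrict_space_iff) auto
  qed
  have AEK: "AE x in lebesgue_on \<Omega>. \<bar>?v x\<bar> \<le> K"
  proof -
    have "AE z in lborel. z \<in> \<Omega> \<longrightarrow> \<bar>v0 z\<bar> \<le> K"
      using AE_frame_inverse[OF e AEv]
    proof eventually_elim
      fix z assume "(z \<bullet> e1, z \<bullet> e2) \<in> ?R \<longrightarrow> \<bar>v (z \<bullet> e1, z \<bullet> e2)\<bar> \<le> K"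
      then show "z \<in> \<Omega> \<longrightarrow> \<bar>v0 z\<bar> \<le> K"
        unfolding \<Omega> frame_image[OF e] v0v[symmetric] frame_decompose[OF e] by simp
    qed
    then have "AE z in lebesgue. z \<in> \<Omega> \<longrightarrow> \<bar>v0 z\<bar> \<le> K" by (simp add: AE_completion_iff)
    then have "AE z in lebesgue_on \<Omega>. \<bar>v0 z\<bar> \<le> K" by (subst AE_restrict_space_iff) auto
    then show ?thesis using ae' by eventually_elim simp
  qed
  have norm: "Linf_norm \<Omega> ?v \<le> ennreal K"
    unfolding Linf_norm_def
  proof (rule esssup_I)
    show "(\<lambda>x. ennreal \<bar>?v x\<bar>) \<in> borel_measurable (lebesgue_on \<Omega>)" using vl by measurable
    show "AE x in lebesgue_on \<Omega>. ennreal \<bar>?v x\<bar> \<le> ennreal K"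
      using AEK by eventually_elim (rule ennreal_leI)
  qed
  have gr: "gradient_measure \<Omega> ?v \<nu>" by (rule gradient_measure_cong_AE[OF v0l[OF v0m] vl ae' \<nu>(1)])
  have "grad_variation \<Omega> ?v \<le> total_variation \<Omega> \<nu>"
    unfolding grad_variation_def by (rule INF_lower) (use gr in simp)
  also note \<nu>(2)
  finally have grad: "grad_variation \<Omega> ?v \<le> ennreal (K * (j1 - j0) + K * (i1 - i0))" .
  have "bounded \<Omega>"
  proof -
    have "\<Omega> \<subseteq> frame e1 e2 ` ({i0..i1} \<times> {j0..j1})" unfolding \<Omega> by auto
    moreover have "compact (frame e1 e2 ` ({i0..i1} \<times> {j0..j1}))"
      by (intro compact_continuous_image continuous_on_subset[OF frame_continuous] compact_Times) auto
    ultimately show ?thesis using compact_imp_bounded bounded_subset by blast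
  qed
  then have "emeasure (lebesgue_on \<Omega>) (space (lebesgue_on \<Omega>)) < \<infinity>"
    using emeasure_bounded_finite[of \<Omega>] by (simp add: emeasure_restrict_space space_restrict_space)
  then have fin: "finite_measure (lebesgue_on \<Omega>)" by (intro finite_measureI) auto
  have int: "integrable (lebesgue_on \<Omega>) ?v"
    using AEK by (intro finite_measure.integrable_const_bound[OF fin _ vl, where B = K]) auto
  show ?thesis
  proof (intro bexI[OF _ gm] conjI IntI)
    show "?v \<in> BV_space \<Omega>" using int gr by (auto simp: BV_space_def)
    show "?v \<in> Linf_space \<Omega>" using vl le_less_trans[OF norm] by (simp add: Linf_space_def L_space_def)
    have "Linf_norm \<Omega> ?v + grad_variation \<Omega> ?v \<le> ennreal K + ennreal (K * (j1 - j0) + K * (i1 - i0))"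
      by (intro add_mono norm grad)
    also have "\<dots> = ennreal (K * (1 + (i1 - i0) + (j1 - j0)))"
      using K L by (subst ennreal_plus[symmetric]) (auto simp: algebra_simps)
    finally show "Linf_norm \<Omega> ?v + grad_variation \<Omega> ?v \<le> ennreal (K * (1 + (i1 - i0) + (j1 - j0)))" .
  qed
qed

text \<open>A Borel representative that is bounded everywhere and vanishes outside of the domain.\<close>

lemma bounded_borel_representative:
  assumes u: "u \<in> Linf_space \<Omega>" "Linf_norm \<Omega> u \<le> 1" and \<Omega>: "\<Omega> \<in> sets borel"
  obtains u0 where "u0 \<in> borel_measurable borel" "\<And>x. \<bar>u0 x\<bar> \<le> 1" "\<And>x. x \<notin> \<Omega> \<Longrightarrow> u0 x = 0"
    "AE x in lborel. x \<in> \<Omega> \<longrightarrow> u x = u0 x"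
proof -
  have um: "u \<in> borel_measurable (lebesgue_on \<Omega>)" using u(1) by (simp add: Linf_space_def L_space_def)
  have "AE x in lebesgue_on \<Omega>. ennreal \<bar>u x\<bar> \<le> esssup (lebesgue_on \<Omega>) (\<lambda>x. ennreal \<bar>u x\<bar>)"
    by (rule esssup_AE)
  then have "AE x in lebesgue_on \<Omega>. \<bar>u x\<bar> \<le> 1"
  proof eventually_elim
    fix x assume "ennreal \<bar>u x\<bar> \<le> esssup (lebesgue_on \<Omega>) (\<lambda>x. ennreal \<bar>u x\<bar>)"
    also have "\<dots> \<le> ennreal 1" using u(2) by (simp add: Linf_norm_def)
    finally show "\<bar>u x\<bar> \<le> 1" by (simp only: ennreal_le_iff zero_le_one)
  qed
  then have b: "AE x in lborel. x \<in> \<Omega> \<longrightarrow> \<bar>u x\<bar> \<le> 1"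
    using \<Omega> by (subst (asm) AE_restrict_space_iff) (auto simp: AE_completion_iff)
  have "(\<lambda>x. if x \<in> \<Omega> then u x else 0) \<in> borel_measurable lebesgue"
    using um \<Omega> by (subst borel_measurable_if) auto
  then obtain g where g[measurable]: "g \<in> borel_measurable lborel" and ge: "AE x in lborel. (if x \<in> \<Omega> then u x else 0) = g x"
    using completion_ex_borel_measurable_real by blast
  define u0 where "u0 x = (if x \<in> \<Omega> then max (-1) (min 1 (g x)) else 0)" for x
  have "u0 \<in> borel_measurable borel" using g \<Omega> unfolding u0_def by simp
  moreover have "AE x in lborel. x \<in> \<Omega> \<longrightarrow> u x = u0 x"
    using b ge by eventually_elim (auto simp: u0_def)
  ultimately show ?thesis by (intro that[of u0]) (auto simp: u0_def)
qed

lemma Liminf_at_right_frequently: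
  fixes f :: "real \<Rightarrow> ennreal"
  assumes "Liminf (at_right 0) f < C" "r > 0"
  shows "\<exists>\<epsilon>>0. \<epsilon> < r \<and> f \<epsilon> < C"
proof (rule ccontr)
  assume "\<not> ?thesis"
  then have "C \<le> f \<epsilon>" if "0 < \<epsilon>" "\<epsilon> < r" for \<epsilon>
    using that not_le by blast
  then have "eventually (\<lambda>\<epsilon>. C \<le> f \<epsilon>) (at_right 0)"
    using assms(2) by (auto simp: eventually_at_right_field)
  then have "C \<le> Liminf (at_right 0) f" by (rule Liminf_bounded)
  then show False using assms(1) by simp
qed


theorem theorem17:
  fixes X1 X2 \<Omega>1 \<Omega>2 \<Omega> :: "(real^2) set" and \<rho> :: "real^2 \<Rightarrow> real" and \<theta>1 \<theta>2 :: real
  assumes splitting: "orthogonal_splitting X1 X2" "dim X1 = 1" "dim X2 = 1"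
    and domains: "bounded_domain_in X1 \<Omega>1" "bounded_domain_in X2 \<Omega>2" "\<Omega> = \<Omega>1 + \<Omega>2"
    and kernel: "radial_kernel \<rho>"
    and exponents: "\<theta>1 > 0" "\<theta>2 > 0" "\<theta>1 + \<theta>2 \<le> 1"
  shows "\<exists>C\<ge>0. \<forall>u \<in> Linf_space \<Omega>.
    Linf_norm \<Omega> u \<le> 1 \<longrightarrow> energy X1 X2 \<Omega>1 \<Omega>2 \<rho> \<theta>1 \<theta>2 2 u < \<infinity> \<longrightarrow>
    (\<exists>ubar \<in> S_space X1 X2 \<Omega>1 \<Omega>2.
       (\<lambda>x. u x - ubar x) \<in> BV_space \<Omega> \<inter> Linf_space \<Omega> \<and>
       Linf_norm \<Omega> (\<lambda>x. u x - ubar x) + grad_variation \<Omega> (\<lambda>x. u x - ubar x)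
         \<le> ennreal C * (energy X1 X2 \<Omega>1 \<Omega>2 \<rho> \<theta>1 \<theta>2 2 u
              + ennreal (sqrt (enn2real (energy X1 X2 \<Omega>1 \<Omega>2 \<rho> \<theta>1 \<theta>2 2 u)))))"
proof -
  obtain e1 where e1: "e1 \<bullet> e1 = 1" "X1 = range (\<lambda>t. t *\<^sub>R e1)"
    using line_unit_vector[of X1] splitting by (auto simp: orthogonal_splitting_def)
  obtain e2 where e2: "e2 \<bullet> e2 = 1" "X2 = range (\<lambda>t. t *\<^sub>R e2)"
    using line_unit_vector[of X2] splitting by (auto simp: orthogonal_splitting_def)
  have "e1 \<in> X1" "e2 \<in> X2" unfolding e1 e2 by (auto intro: range_eqI[of _ _ 1])
  then have "e1 \<bullet> e2 = 0" using splitting(1) by (auto simp: orthogonal_splitting_def orthogonal_def)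
  then have e: "orthonormal_frame e1 e2" using e1 e2 by (simp add: orthonormal_frame_def)
  note e' = orthonormal_frame_swap[OF e]
  obtain i0 i1 where i: "i0 < i1" "\<Omega>1 = (\<lambda>t. t *\<^sub>R e1) ` {i0<..<i1}"
    using line_domain_interval[OF e1 domains(1)] .
  obtain j0 j1 where j: "j0 < j1" "\<Omega>2 = (\<lambda>t. t *\<^sub>R e2) ` {j0<..<j1}"
    using line_domain_interval[OF e2 domains(2)] .
  let ?R = "{i0<..<i1} \<times> {j0<..<j1}"
  have \<Omega>: "\<Omega> = frame e1 e2 ` ?R" unfolding domains(3) i(2) j(2) by (rule sum_of_segments)
  have \<Omega>': "\<Omega> = frame e2 e1 ` ({j0<..<j1} \<times> {i0<..<i1})"
    unfolding domains(3) i(2) j(2) by (subst add.commute) (rule sum_of_segments)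
  have rect: "?R \<in> sets borel" unfolding borel_prod[symmetric] by measurable
  have \<Omega>m: "\<Omega> \<in> sets borel" unfolding \<Omega> by (rule frame_image_sets[OF e rect])
  have inner: "inner_part X1 \<Omega>1 \<epsilon> + inner_part X2 \<Omega>2 \<epsilon> = frame e1 e2 ` ({i0 + \<epsilon>..i1 - \<epsilon>} \<times> {j0 + \<epsilon>..j1 - \<epsilon>})"
    if "\<epsilon> > 0" for \<epsilon>
    unfolding i(2) j(2) inner_part_interval[OF e1 that] inner_part_interval[OF e2 that] by (rule sum_of_segments)
  note comp = component_frame[OF e e1(2) e2(2)] component_frame[OF e' e2(2) e1(2)]
  obtain \<rho>0 c \<kappa> where \<rho>0: "\<rho>0 \<in> borel_measurable borel" "\<And>z. 0 \<le> \<rho>0 z" "AE z in lborel. \<rho> z = \<rho>0 z"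
    and c: "c > 0" and \<kappa>: "\<kappa> > 0"
      "ennreal \<kappa> \<le> (\<integral>\<^sup>+ x. ennreal (\<rho>0 (frame e1 e2 x)) * indicator {x. c < fst x \<and> c < snd x \<and> norm x < 1} x \<partial>lborel)"
    and sym: "\<And>\<sigma> \<tau>. \<sigma> \<in> {1, -1} \<Longrightarrow> \<tau> \<in> {1, -1} \<Longrightarrow> AE x in lborel. \<rho>0 (frame (\<sigma> *\<^sub>R e1) (\<tau> *\<^sub>R e2) x) = \<rho>0 (frame e1 e2 x)"
    using radial_kernel_positive_mass[OF kernel e] by blast
  \<comment> \<open>The bound \<open>4 \<epsilon>\<^sup>2 (E + \<eta>) / \<kappa>\<close> is at most \<open>C1 (E + \<eta>) a b\<close>, because \<open>a\<close> and \<open>b\<close> exceed \<open>c \<epsilon>\<close>.\<close>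
  define C1 where "C1 = 4 / (\<kappa> * c\<^sup>2)"
  have C1: "C1 > 0" using c \<kappa>(1) by (simp add: C1_def)
  define S where "S = 1 + (i1 - i0) + (j1 - j0)"
  have S: "S > 0" using i j by (simp add: S_def)
  define C2 where "C2 = 144 * C1 + sqrt (12 * C1)"
  have C2: "C2 > 0" using C1 by (simp add: C2_def add_pos_pos)
  show ?thesis
  proof (intro exI[of _ "C2 * S"] conjI ballI impI)
    show "0 \<le> C2 * S" using C2 S by simp
    fix u assume u: "u \<in> Linf_space \<Omega>" "Linf_norm \<Omega> u \<le> 1"
    let ?E = "energy X1 X2 \<Omega>1 \<Omega>2 \<rho> \<theta>1 \<theta>2 2 u"
    assume fin: "?E < \<infinity>"
    define E where "E = enn2real ?E"
    have E: "?E = ennreal E" "0 \<le> E" using fin by (auto simp: E_def)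
    have um: "u \<in> borel_measurable (lebesgue_on \<Omega>)" using u(1) by (simp add: Linf_space_def L_space_def)
    obtain u0 where u0[measurable]: "u0 \<in> borel_measurable borel" and u0b: "\<And>x. \<bar>u0 x\<bar> \<le> 1"
      and u00: "\<And>x. x \<notin> \<Omega> \<Longrightarrow> u0 x = 0" and ae: "AE x in lborel. x \<in> \<Omega> \<longrightarrow> u x = u0 x"
      using bounded_borel_representative[OF u \<Omega>m] by blast
    let ?w = "\<lambda>x. u0 (frame e1 e2 x)"
    have wm: "?w \<in> borel_measurable borel" by measurable
    have ws: "?w x = 0" if "x \<notin> ?R" for x
      using that by (intro u00) (auto simp: \<Omega> frame_image[OF e] frame_inner[OF e])
    define K where "K = 144 * C1 * E + sqrt (12 * C1 * E)"
    have K: "0 \<le> K" using C1 E by (simp add: K_def)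
    have small: "\<exists>\<epsilon> a b. 0 < \<epsilon> \<and> \<epsilon> < r \<and> 0 < a \<and> a < \<epsilon> \<and> 0 < b \<and> b < \<epsilon> \<and>
       (\<integral>\<^sup>+ x. ennreal (corner_density \<theta>1 \<theta>2 ?w a b x) * indicator ({i0 + \<epsilon>..i1 - \<epsilon>} \<times> {j0 + \<epsilon>..j1 - \<epsilon>}) x \<partial>lborel)
         \<le> ennreal (C1 * (E + \<eta>) * a * b)" if r: "r > 0" and \<eta>: "\<eta> > 0" for r \<eta>
    proof -
      have "?E < ennreal (E + \<eta>)" using E \<eta> by (simp add: ennreal_lessI)
      then obtain \<epsilon> where \<epsilon>: "\<epsilon> > 0" "\<epsilon> < r" "energy_eps X1 X2 \<Omega>1 \<Omega>2 \<rho> \<theta>1 \<theta>2 2 \<epsilon> u < ennreal (E + \<eta>)"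
        using Liminf_at_right_frequently[OF _ r] unfolding energy_def by blast
      have M: "E + \<eta> > 0" using E \<eta> by simp
      obtain a b where ab: "c * \<epsilon> < a" "a < \<epsilon>" "c * \<epsilon> < b" "b < \<epsilon>"
        and H: "(\<integral>\<^sup>+ x. ennreal (corner_density \<theta>1 \<theta>2 ?w a b x) * indicator ({i0 + \<epsilon>..i1 - \<epsilon>} \<times> {j0 + \<epsilon>..j1 - \<epsilon>}) x \<partial>lborel)
          \<le> ennreal (4 * \<epsilon>\<^sup>2 * (E + \<eta>) / \<kappa>)"
        using exists_good_increments[OF e u0 ae[unfolded \<Omega>] comp inner[OF \<epsilon>(1)] \<rho>0 c \<kappa> sym \<epsilon>(1,3) M] by blast
      have ce: "0 < c * \<epsilon>" using c \<epsilon> by simp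
      have "(c * \<epsilon>) * (c * \<epsilon>) \<le> a * b" using ab ce by (intro mult_mono) auto
      then have "4 / (\<kappa> * c\<^sup>2) * (E + \<eta>) * ((c * \<epsilon>) * (c * \<epsilon>)) \<le> 4 / (\<kappa> * c\<^sup>2) * (E + \<eta>) * (a * b)"
        using M \<kappa>(1) by (intro mult_left_mono) auto
      moreover have "4 / (\<kappa> * c\<^sup>2) * (E + \<eta>) * ((c * \<epsilon>) * (c * \<epsilon>)) = 4 * \<epsilon>\<^sup>2 * (E + \<eta>) / \<kappa>"
        using c \<kappa>(1) by (simp add: power2_eq_square)
      ultimately have "4 * \<epsilon>\<^sup>2 * (E + \<eta>) / \<kappa> \<le> C1 * (E + \<eta>) * a * b" by (simp add: C1_def mult.assoc)
      then have "(\<integral>\<^sup>+ x. ennreal (corner_density \<theta>1 \<theta>2 ?w a b x) * indicator ({i0 + \<epsilon>..i1 - \<epsilon>} \<times> {j0 + \<epsilon>..j1 - \<epsilon>}) x \<partial>lborel)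
         \<le> ennreal (C1 * (E + \<eta>) * a * b)"
        using H by (meson ennreal_leI order_trans)
      then show ?thesis using ab ce \<epsilon> by (intro exI[of _ \<epsilon>] exI[of _ a] exI[of _ b]) auto
    qed
    have bound: "ennreal (K * S) \<le> ennreal (C2 * S) * (?E + ennreal (sqrt (enn2real ?E)))"
    proof -
      have "K \<le> C2 * (E + sqrt E)"
      proof -
        have "K = 144 * C1 * E + sqrt (12 * C1) * sqrt E" by (simp add: K_def real_sqrt_mult)
        moreover have "0 \<le> 144 * C1 * sqrt E" "0 \<le> sqrt (12 * C1) * E" using C1 E by auto
        ultimately show ?thesis by (simp add: C2_def algebra_simps)
      qed
      then have "K * S \<le> (C2 * S) * (E + sqrt E)" using S mult_right_mono[of K "C2 * (E + sqrt E)" S] by (simp add: ac_simps)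
      then have "ennreal (K * S) \<le> ennreal ((C2 * S) * (E + sqrt E))" by (rule ennreal_leI)
      also have "\<dots> = ennreal (C2 * S) * (ennreal E + ennreal (sqrt E))"
        using C2 S E by (simp add: ennreal_mult)
      finally show ?thesis by (simp add: E)
    qed
    have meas: "(\<lambda>x. g (x \<bullet> d)) \<in> L_space \<Omega>" if [measurable]: "g \<in> borel_measurable borel" for g :: "real \<Rightarrow> real" and d :: "real^2"
    proof -
      have "(\<lambda>x. x \<bullet> d) \<in> borel_measurable borel"
        by (intro borel_measurable_continuous_onI continuous_intros)
      from measurable_compose[OF this that] show ?thesis
        unfolding L_space_def by (intro measurable_restrict_space1 measurable_completion) simp
    qed
    have line: "(\<lambda>x. g (x \<bullet> d)) \<in> L_space_line X U"
      if "g \<in> borel_measurable borel" "d \<bullet> d = 1" "X = range (\<lambda>t. t *\<^sub>R d)" for g :: "real \<Rightarrow> real" and d :: "real^2" and X U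
    proof -
      have "(\<lambda>t. g ((t *\<^sub>R d) \<bullet> d)) \<in> borel_measurable (lebesgue_on ((\<lambda>t. t *\<^sub>R d) -` U))"
        using that by (intro measurable_restrict_space1 measurable_completion) simp
      moreover have "linear (\<lambda>t. t *\<^sub>R d)" by (intro linearI) (auto simp: algebra_simps)
      moreover have "norm (t *\<^sub>R d) = \<bar>t\<bar>" for t using that(2) by (simp add: norm_eq_sqrt_inner)
      ultimately show ?thesis unfolding L_space_line_def using that(3) by (intro CollectI exI[of _ "\<lambda>t. t *\<^sub>R d"]) auto
    qed
    let ?goal = "\<exists>ubar \<in> S_space X1 X2 \<Omega>1 \<Omega>2.
       (\<lambda>x. u x - ubar x) \<in> BV_space \<Omega> \<inter> Linf_space \<Omega> \<and>
       Linf_norm \<Omega> (\<lambda>x. u x - ubar x) + grad_variation \<Omega> (\<lambda>x. u x - ubar x)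
         \<le> ennreal (C2 * S) * (?E + ennreal (sqrt (enn2real ?E)))"
    from column_or_row_limit[OF i(1) j(1) wm u0b ws exponents C1 E(2) small, folded K_def]
    show ?goal
    proof
      assume "\<forall>\<delta>>0. \<exists>g. nearly_column (K + \<delta>) g \<and>
            (\<integral>\<^sup>+ x. ennreal \<bar>g x - ?w x\<bar> * indicator ?R x \<partial>lborel) \<le> ennreal \<delta>"
      then obtain g where g: "g \<in> borel_measurable borel" and r: "(\<lambda>x. u x - g (x \<bullet> e2)) \<in> BV_space \<Omega> \<inter> Linf_space \<Omega>"
        "Linf_norm \<Omega> (\<lambda>x. u x - g (x \<bullet> e2)) + grad_variation \<Omega> (\<lambda>x. u x - g (x \<bullet> e2)) \<le> ennreal (K * S)"
        using column_remainder_estimate[OF e i(1) j(1) \<Omega> um u0 u0b ae K] unfolding S_def by blast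
      have "(\<lambda>x. g (x \<bullet> e2)) \<in> S_space X1 X2 \<Omega>1 \<Omega>2"
        unfolding S_space_def domains(3)[symmetric] using meas[OF g] line[OF g e2] e2(1)
        by (auto simp: comp intro!: disjI2 bexI[of _ "\<lambda>x. g (x \<bullet> e2)"])
      then show ?goal using r order_trans[OF r(2) bound] by (intro bexI[of _ "\<lambda>x. g (x \<bullet> e2)"] conjI)
    next
      assume *: "\<forall>\<delta>>0. \<exists>g. nearly_column (K + \<delta>) g \<and>
            (\<integral>\<^sup>+ x. ennreal \<bar>g x - ?w (prod.swap x)\<bar> * indicator ({j0<..<j1} \<times> {i0<..<i1}) x \<partial>lborel) \<le> ennreal \<delta>"
      have sw: "?w (prod.swap x) = u0 (frame e2 e1 x)" for x by (simp add: frame_def add.commute)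
      have S': "S = 1 + (j1 - j0) + (i1 - i0)" by (simp add: S_def)
      obtain g where g: "g \<in> borel_measurable borel" and r: "(\<lambda>x. u x - g (x \<bullet> e1)) \<in> BV_space \<Omega> \<inter> Linf_space \<Omega>"
        "Linf_norm \<Omega> (\<lambda>x. u x - g (x \<bullet> e1)) + grad_variation \<Omega> (\<lambda>x. u x - g (x \<bullet> e1)) \<le> ennreal (K * S)"
        using column_remainder_estimate[OF e' j(1) i(1) \<Omega>' um u0 u0b ae K] *[unfolded sw] unfolding S' by blast
      have "(\<lambda>x. g (x \<bullet> e1)) \<in> S_space X1 X2 \<Omega>1 \<Omega>2"
        unfolding S_space_def domains(3)[symmetric] using meas[OF g] line[OF g e1] e1(1)
        by (auto simp: comp intro!: disjI1 bexI[of _ "\<lambda>x. g (x \<bullet> e1)"])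
      then show ?goal using r order_trans[OF r(2) bound] by (intro bexI[of _ "\<lambda>x. g (x \<bullet> e1)"] conjI)
    qed
  qed
qed

end
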